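(* Let $k\geq 3$ and $n>(k-1)^2$ be integers, let $K$ be a field, let $S_n=K[x_1,\ldots,x_n]$, let $B$ be a collection of $k$-blocks of $[n]$, and let $M_B\subseteq S_n$ be the block ideal of $B$. Then $([n],B)$ is an $S(2,k,n)$ if and only if $$b_1(S_n/M_B)=\frac{n(n-1)}{k(k-1)}\quad\text{and}\quad b_{k-1}(S_n/M_B)=\binom{\frac{n(n-1)}{k(k-1)}}{k-1}.$$
   Context: $[n]=\{1,\ldots,n\}$. A $k$-block of $[n]$ is a $k$-element subset of $[n]$; a collection of $k$-blocks is a set of distinct $k$-blocks. A Steiner system $S(t,k,n)$ is a pair $([n],B)$ where $B$ is a collection of $k$-blocks of $[n]$ such that every $t$-block of $[n]$ is contained in a unique $k$-block in $B$. For a collection $B$ of $k$-blocks of $[n]$, the block ideal $M_B$ is the squarefree monomial ideal of $S_n$ whose minimal generators are the monomials $x_{i_1}\cdots x_{i_k}$ with $\{i_1,\ldots,i_k\}\in B$. For a monomial ideal $M$ of $S_n$, $b_i(S_n/M)$ denotes the $i$-th (total) Betti number of $S_n/M$, i.e. the rank of the free module in homological degree $i$ of the minimal (multigraded) free resolution of $S_n/M$ over $S_n$ (so homological degree $0$ corresponds to $S_n$ itself and $b_1$ is the number of minimal generators of $M$). *)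

theory Defs
  imports "HOL-Library.Poly_Mapping" "Jordan_Normal_Form.Matrix"
begin

section \<open>Blocks and Steiner systems\<close>

definition blocks :: "nat \<Rightarrow> nat \<Rightarrow> nat set set"
  where "blocks k n = {b. b \<subseteq> {1..n} \<and> card b = k}"

definition steiner_system :: "nat \<Rightarrow> nat \<Rightarrow> nat \<Rightarrow> nat set set \<Rightarrow> bool"
  where "steiner_system t k n B \<longleftrightarrow>
    B \<subseteq> blocks k n \<and> (\<forall>T\<in>blocks t n. \<exists>!b. b \<in> B \<and> T \<subseteq> b)"

section \<open>Polynomial rings\<close>

text \<open>A monomial is represented by its exponent function, and a polynomial by its finitely
  supported coefficient function; the product of the monoid algebra is the product of polynomials.
  The variables of the ambient ring are indexed by all natural numbers, and
  \<open>poly_ring n\<close> is the subring $S_n = K[x_1,\ldots,x_n]$.\<close>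

type_synonym exponent = "nat \<Rightarrow>\<^sub>0 nat"
type_synonym 'a mpoly = "exponent \<Rightarrow>\<^sub>0 'a"

definition exponents :: "nat \<Rightarrow> exponent set"
  where "exponents n = {m. Poly_Mapping.keys m \<subseteq> {1..n}}"

definition poly_ring :: "nat \<Rightarrow> 'a::field mpoly set"
  where "poly_ring n = {p. Poly_Mapping.keys p \<subseteq> exponents n}"

definition var :: "nat \<Rightarrow> 'a::field mpoly"
  where "var i = Poly_Mapping.single (Poly_Mapping.single i 1) 1"

definition ideal_span :: "nat \<Rightarrow> 'a::field mpoly set \<Rightarrow> 'a mpoly set"
  where "ideal_span n G =
    {(\<Sum>g\<in>F. c g * g) |F c. finite F \<and> F \<subseteq> G \<and> (\<forall>g\<in>F. c g \<in> poly_ring n)}"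

text \<open>For \<open>B \<subseteq> blocks k n\<close> all the generators below have the same degree \<open>k\<close>, so none of them
  divides another one and they are the minimal generators.\<close>

definition block_ideal :: "nat \<Rightarrow> nat set set \<Rightarrow> 'a::field mpoly set"
  where "block_ideal n B = ideal_span n ((\<lambda>b. \<Prod>i\<in>b. var i) ` B)"

section \<open>Minimal multigraded free resolutions and Betti numbers\<close>

definition free_module :: "nat \<Rightarrow> nat \<Rightarrow> 'a::field mpoly vec set"
  where "free_module n r = {v \<in> carrier_vec r. \<forall>j<r. v $ j \<in> poly_ring n}"

text \<open>The complex
  $\cdots \to S_n^{r_2} \to S_n^{r_1} \to S_n^{r_0} = S_n$, where \<open>d i\<close> (for \<open>i \<ge> 1\<close>) is the matrix
  of the differential from homological degree \<open>i\<close> to \<open>i - 1\<close> (\<open>d 0\<close> is irrelevant), and where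
  the \<open>q\<close>-th basis element in homological degree \<open>i\<close> has multidegree \<open>deg i q\<close>.
  Since the complex starts with $S_n$ itself, this is
  the usual notion for the quotient of $S_n$ by a proper monomial ideal \<open>M\<close>.
  In the homogeneity condition the entry in position \<open>(p,q)\<close>
  is zero or a scalar multiple of the monomial with exponent \<open>deg (Suc i) q - deg i p\<close>.
  Minimality says that each differential has its image in the multiple of the target by the
  ideal $(x_1,\ldots,x_n)$.\<close>

definition minimal_free_resolution ::
    "nat \<Rightarrow> 'a::field mpoly set \<Rightarrow> (nat \<Rightarrow> nat) \<Rightarrow> (nat \<Rightarrow> nat \<Rightarrow> exponent) \<Rightarrow>
     (nat \<Rightarrow> 'a mpoly mat) \<Rightarrow> bool"
  where "minimal_free_resolution n M r deg d \<longleftrightarrow>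
    \<comment> \<open>free modules and differentials over $S_n$\<close>
    r 0 = 1 \<and>
    (\<forall>i. d (Suc i) \<in> carrier_mat (r i) (r (Suc i))) \<and>
    (\<forall>i. \<forall>p<r i. \<forall>q<r (Suc i). d (Suc i) $$ (p, q) \<in> poly_ring n) \<and>
    \<comment> \<open>multigrading\<close>
    deg 0 0 = 0 \<and>
    (\<forall>i. \<forall>q<r i. deg i q \<in> exponents n) \<and>
    (\<forall>i. \<forall>p<r i. \<forall>q<r (Suc i). \<forall>m\<in>Poly_Mapping.keys (d (Suc i) $$ (p, q)).
       m + deg i p = deg (Suc i) q) \<and>
    \<comment> \<open>exactness; the cokernel of the first differential is $S_n/M$\<close>
    {(d 1 *\<^sub>v v) $ 0 |v. v \<in> free_module n (r 1)} = M \<and>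
    (\<forall>i. {v \<in> free_module n (r (Suc i)). d (Suc i) *\<^sub>v v = 0\<^sub>v (r i)} =
       {d (Suc (Suc i)) *\<^sub>v w |w. w \<in> free_module n (r (Suc (Suc i)))}) \<and>
    \<comment> \<open>minimality\<close>
    (\<forall>i. \<forall>p<r i. \<forall>q<r (Suc i). d (Suc i) $$ (p, q) \<in> ideal_span n (var ` {1..n}))"

text \<open>\<open>betti n M i\<close> is $b_i(S_n/M)$, for a proper monomial ideal \<open>M\<close> of $S_n$. The description is
  proper because minimal multigraded free resolutions exist and are unique up to isomorphism.\<close>

definition betti :: "nat \<Rightarrow> 'a::field mpoly set \<Rightarrow> nat \<Rightarrow> nat"
  where "betti n M i = (THE b. \<exists>r deg d. minimal_free_resolution n M r deg d \<and> r i = b)"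

end

theory Submission
  imports Defs "Jordan_Normal_Form.Determinant"
begin

text \<open>Write $b_i$ for the Betti numbers of $S_n/M_B$. The Taylor resolution has rank
  $\binom{|B|}{i}$ in degree $i$, so $b_i \le \binom{|B|}{i}$, and comparing it with a minimal resolution
  shows that equality holds iff the two differentials of the Taylor resolution adjacent to degree $i$
  vanish modulo the variables, i.e. iff no block lies in the union of $i - 1$ or of $i$ other blocks.
  For $i = 1$ this always holds, so $b_1 = |B|$. In a Steiner system two blocks meet in at most one
  point, so $k - 1$ blocks cannot cover another one. Conversely, let $|B| = n(n-1)/(k(k-1))$ and
  suppose that no block is covered by $k - 1$ others. A block without a private point meets every other
  block in at most one point; if there are $s > 0$ blocks with private points, deleting one private
  point from each and counting pairs leaves $n - s \le k - 1$ points, so all blocks share the same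
  $k - 1$ points, which contradicts the value of $|B|$. Hence all blocks meet in at most one point, and
  counting pairs shows that every pair is covered.\<close>

section \<open>Graded complexes and their comparison\<close>

text \<open>Since \<open>betti\<close> is a definite description, it has no value before a minimal
  resolution has been constructed and its ranks have been shown to be unique. Hence existence is
  proved for every block ideal, in a form that can be compared with the Taylor resolution in both
  directions. One of the two is indexed by numbers, the other by sets of blocks. So complexes are
  stripped of polynomials: a homogeneous map becomes a scalar matrix whose rows and columns carry
  degrees in an ordered set, and exactness becomes linear algebra in each degree separately. For
  existence, degrees that are subsets of [n] suffice, because the strand of a squarefree complex in
  degree \<alpha> depends only on the support of \<alpha>. The bound on n enters the combinatorics
  twice. It yields at least k blocks, so that a small cover can be padded to one by exactly k - 1
  blocks. And it turns the pair count, which bounds n - s by k(k - 1) + 1 - n, into n - s \<le> k -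
  1.\<close>

definition mmul :: "'y set \<Rightarrow> ('x \<Rightarrow> 'y \<Rightarrow> 'a::semiring_0) \<Rightarrow> ('y \<Rightarrow> 'z \<Rightarrow> 'a) \<Rightarrow> 'x \<Rightarrow> 'z \<Rightarrow> 'a"
  where "mmul Y A B = (\<lambda>x z. \<Sum>y\<in>Y. A x y * B y z)"

definition ident :: "'x set \<Rightarrow> 'x \<Rightarrow> 'x \<Rightarrow> 'a::zero_neq_one"
  where "ident X = (\<lambda>x y. if x = y \<and> x \<in> X then 1 else 0)"

text \<open>The monomial in a homogeneous entry has exponent g y - f x, so a nonzero coefficient
  requires f x to divide g y. Vanishing outside X and Y is part of the notion, so that equality of
  matrices is equality of functions.\<close>

definition gmat :: "'x set \<Rightarrow> ('x \<Rightarrow> 'o::order) \<Rightarrow> 'y set \<Rightarrow> ('y \<Rightarrow> 'o) \<Rightarrow> ('x \<Rightarrow> 'y \<Rightarrow> 'a::zero) \<Rightarrow> bool"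
  where "gmat X f Y g A \<longleftrightarrow> (\<forall>x y. A x y \<noteq> 0 \<longrightarrow> x \<in> X \<and> y \<in> Y \<and> f x \<le> g y)"

text \<open>If \<open>A\<close> holds the coefficients of a homogeneous map of free modules with basis degrees \<open>f\<close> and
  \<open>g\<close>, then \<open>unit_part f g A\<close> is its reduction modulo the variables.\<close>

definition unit_part :: "('x \<Rightarrow> 'o) \<Rightarrow> ('y \<Rightarrow> 'o) \<Rightarrow> ('x \<Rightarrow> 'y \<Rightarrow> 'a::zero) \<Rightarrow> 'x \<Rightarrow> 'y \<Rightarrow> 'a"
  where "unit_part f g A = (\<lambda>x y. if f x = g y then A x y else 0)"

lemma gmatD: "gmat X f Y g A \<Longrightarrow> A x y \<noteq> 0 \<Longrightarrow> x \<in> X \<and> y \<in> Y \<and> f x \<le> g y"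
  by (auto simp: gmat_def)

lemma mmul_assoc:
  assumes "finite Y" "finite Z"
  shows "mmul Z (mmul Y A B) C = mmul Y A (mmul Z B C)"
  unfolding mmul_def
  by (intro ext, simp add: sum_distrib_left sum_distrib_right mult.assoc, rule sum.swap)

lemma mmul_zero [simp]:
  "mmul Y A (\<lambda>_ _. 0) = (\<lambda>_ _. 0)" "mmul Y (\<lambda>_ _. 0) B = (\<lambda>_ _. 0)"
  by (auto simp: mmul_def)

lemma mmul_diff:
  fixes A :: "'x \<Rightarrow> 'y \<Rightarrow> 'a::ring"
  shows "mmul Y A (\<lambda>y z. B y z - C y z) = (\<lambda>x z. mmul Y A B x z - mmul Y A C x z)"
    "mmul Y (\<lambda>x y. A x y - A' x y) B = (\<lambda>x z. mmul Y A B x z - mmul Y A' B x z)"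
  by (auto simp: mmul_def algebra_simps sum_subtractf)

lemma mmul_ident_left:
  fixes A :: "'x \<Rightarrow> 'y \<Rightarrow> 'a::semiring_1"
  assumes "finite X" "\<And>x y. A x y \<noteq> 0 \<Longrightarrow> x \<in> X"
  shows "mmul X (ident X) A = A"
proof (intro ext)
  fix x y
  have "mmul X (ident X) A x y = (\<Sum>x'\<in>X. if x = x' then A x' y else 0)"
    unfolding mmul_def ident_def by (rule sum.cong) auto
  also have "\<dots> = A x y" using assms by auto
  finally show "mmul X (ident X) A x y = A x y" .
qed

lemma mmul_ident_right:
  fixes A :: "'x \<Rightarrow> 'y \<Rightarrow> 'a::semiring_1"
  assumes "finite Y" "\<And>x y. A x y \<noteq> 0 \<Longrightarrow> y \<in> Y"
  shows "mmul Y A (ident Y) = A"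
proof (intro ext)
  fix x y
  have "mmul Y A (ident Y) x y = (\<Sum>y'\<in>Y. if y' = y then A x y' else 0)"
    unfolding mmul_def ident_def by (rule sum.cong) auto
  also have "\<dots> = A x y" using assms by auto
  finally show "mmul Y A (ident Y) x y = A x y" .
qed

lemma gmat_mmul:
  assumes "gmat X f Y g A" "gmat Y g Z h B"
  shows "gmat X f Z h (mmul Y A B)"
  unfolding gmat_def
proof (intro allI impI)
  fix x z assume "mmul Y A B x z \<noteq> 0"
  then obtain y where "A x y * B y z \<noteq> 0"
    unfolding mmul_def by (meson sum.not_neutral_contains_not_neutral)
  hence "A x y \<noteq> 0" "B y z \<noteq> 0" by auto
  thus "x \<in> X \<and> z \<in> Z \<and> f x \<le> h z"
    using gmatD[OF assms(1)] gmatD[OF assms(2)] by (meson order_trans)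
qed

lemma gmat_diff:
  fixes A :: "'x \<Rightarrow> 'y \<Rightarrow> 'a::ab_group_add"
  assumes "gmat X f Y g A" "gmat X f Y g B"
  shows "gmat X f Y g (\<lambda>x y. A x y - B x y)"
  using assms unfolding gmat_def by (metis diff_self)

lemma gmat_ident: "gmat X f X f (ident X)"
  by (auto simp: gmat_def ident_def)

lemma gmat_zero: "gmat X f Y g (\<lambda>_ _. 0)"
  by (auto simp: gmat_def)

text \<open>A nonzero term A x y * B y z with f x = h z has f x \<le> g y \<le> h z, so by
  antisymmetry both factors are unit entries. Reduction modulo the variables therefore respects
  composition.\<close>

lemma unit_part_mmul:
  assumes "gmat X f Y g A" "gmat Y g Z h B"
  shows "unit_part f h (mmul Y A B) = mmul Y (unit_part f g A) (unit_part g h B)"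
proof (intro ext)
  fix x z
  have "f x = g y \<and> g y = h z" if "f x = h z" "A x y * B y z \<noteq> 0" for y
  proof -
    from that have "A x y \<noteq> 0" "B y z \<noteq> 0" by auto
    with gmatD[OF assms(1)] gmatD[OF assms(2)] have "f x \<le> g y" "g y \<le> h z" by blast+
    with that show ?thesis by (metis order_antisym)
  qed
  hence "f x = h z \<Longrightarrow> A x y * B y z = unit_part f g A x y * unit_part g h B y z" for y
    by (auto simp: unit_part_def)
  moreover have "f x \<noteq> h z \<Longrightarrow> unit_part f g A x y * unit_part g h B y z = 0" for y
    by (auto simp: unit_part_def)
  ultimately show "unit_part f h (mmul Y A B) x z = mmul Y (unit_part f g A) (unit_part g h B) x z"
    by (simp add: unit_part_def[of f h] mmul_def)
qed

text \<open>Padding Q with zero columns and P with zero rows gives square matrices of size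
  \<open>card X\<close> over a field, where a left inverse is also a right inverse. If Y were
  smaller than X, a zero row of P' would contradict P' Q' = 1.\<close>

lemma mmul_left_inverse_imp_right_inverse:
  fixes P :: "'y \<Rightarrow> 'x \<Rightarrow> 'a::field"
  assumes fin: "finite X" "finite Y" and card: "card Y \<le> card X"
    and QP: "mmul Y Q P = ident X"
    and P0: "\<And>x y. P y x \<noteq> 0 \<Longrightarrow> y \<in> Y" and Q0: "\<And>x y. Q x y \<noteq> 0 \<Longrightarrow> y \<in> Y"
  shows "card Y = card X" "mmul X P Q = ident Y"
proof -
  define m where "m = card X"
  define l where "l = card Y"
  obtain a where a: "bij_betw a {0..<m} X" using ex_bij_betw_nat_finite[OF fin(1)] m_def by auto
  obtain b where b: "bij_betw b {0..<l} Y" using ex_bij_betw_nat_finite[OF fin(2)] l_def by auto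
  have lm: "l \<le> m" using card l_def m_def by simp
  define Q' where "Q' = mat m m (\<lambda>(i,j). if j < l then Q (a i) (b j) else 0)"
  define P' where "P' = mat m m (\<lambda>(i,j). if i < l then P (b i) (a j) else 0)"
  have aX: "i < m \<Longrightarrow> a i \<in> X" for i using a by (auto simp: bij_betw_def)
  have ainj: "i < m \<Longrightarrow> j < m \<Longrightarrow> a i = a j \<longleftrightarrow> i = j" for i j
    using a by (auto simp: bij_betw_def inj_on_def)
  have bY: "i < l \<Longrightarrow> b i \<in> Y" for i using b by (auto simp: bij_betw_def)
  have binj: "i < l \<Longrightarrow> j < l \<Longrightarrow> b i = b j \<longleftrightarrow> i = j" for i j
    using b by (auto simp: bij_betw_def inj_on_def)
  have "Q' * P' = 1\<^sub>m m"
  proof (rule eq_matI)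
    fix i j assume ij: "i < dim_row (1\<^sub>m m :: 'a mat)" "j < dim_col (1\<^sub>m m :: 'a mat)"
    have "(Q' * P') $$ (i,j) = (\<Sum>t = 0..<m. Q' $$ (i,t) * P' $$ (t,j))"
      using ij by (simp add: Q'_def P'_def scalar_prod_def)
    also have "\<dots> = (\<Sum>t = 0..<l. Q' $$ (i,t) * P' $$ (t,j))"
      by (rule sum.mono_neutral_right) (use lm ij in \<open>auto simp: Q'_def P'_def\<close>)
    also have "\<dots> = (\<Sum>t = 0..<l. Q (a i) (b t) * P (b t) (a j))"
      by (rule sum.cong) (use lm ij in \<open>auto simp: Q'_def P'_def\<close>)
    also have "\<dots> = mmul Y Q P (a i) (a j)"
      unfolding mmul_def by (rule sum.reindex_bij_betw[OF b])
    also have "\<dots> = (1\<^sub>m m) $$ (i,j)" using ij by (simp add: QP ident_def aX ainj)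
    finally show "(Q' * P') $$ (i,j) = (1\<^sub>m m) $$ (i,j)" .
  qed (auto simp: Q'_def P'_def)
  hence PQ: "P' * Q' = 1\<^sub>m m"
    using mat_mult_left_right_inverse[of Q' m P'] by (simp add: Q'_def P'_def)
  have PQ_entry: "(\<Sum>t = 0..<m. P' $$ (i,t) * Q' $$ (t,j)) = (if i = j then 1 else 0)"
    if "i < m" "j < m" for i j
    using arg_cong[OF PQ, of "\<lambda>A. A $$ (i,j)"] that by (simp add: Q'_def P'_def scalar_prod_def)
  have "l = m"
  proof (rule ccontr)
    assume "l \<noteq> m"
    with lm have "l < m" by simp
    thus False using PQ_entry[of l l] by (simp add: P'_def)
  qed
  thus "card Y = card X" by (simp add: l_def m_def)
  show "mmul X P Q = ident Y"
  proof (intro ext)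
    fix y z
    show "mmul X P Q y z = ident Y y z"
    proof (cases "y \<in> Y \<and> z \<in> Y")
      case True
      then obtain i j where ij: "y = b i" "z = b j" "i < l" "j < l"
        using b by (auto simp: bij_betw_def)
      have "mmul X P Q y z = (\<Sum>t = 0..<m. P (b i) (a t) * Q (a t) (b j))"
        unfolding mmul_def ij by (rule sum.reindex_bij_betw[OF a, symmetric])
      also have "\<dots> = (\<Sum>t = 0..<m. P' $$ (i,t) * Q' $$ (t,j))"
        by (rule sum.cong) (use ij \<open>l = m\<close> in \<open>auto simp: P'_def Q'_def\<close>)
      also have "\<dots> = ident Y y z"
        using PQ_entry[of i j] ij \<open>l = m\<close> by (simp add: ident_def bY binj)
      finally show ?thesis .
    next
      case False
      hence "P y x * Q x z = 0" for x using P0[of y x] Q0[of x z] by auto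
      hence "mmul X P Q y z = 0" unfolding mmul_def by (intro sum.neutral) blast
      thus ?thesis using False by (auto simp: ident_def)
    qed
  qed
qed

definition strand :: "'x set \<Rightarrow> ('x \<Rightarrow> 'o::order) \<Rightarrow> 'o \<Rightarrow> ('x \<Rightarrow> 'a::zero) \<Rightarrow> bool"
  where "strand X f \<alpha> c \<longleftrightarrow> (\<forall>x. c x \<noteq> 0 \<longrightarrow> x \<in> X \<and> f x \<le> \<alpha>)"

text \<open>A multigraded complex of free modules is encoded by scalars: \<open>D i p q\<close> is the coefficient of the
  only monomial that the entry \<open>(p, q)\<close> of the differential may contain, and \<open>strand X f \<alpha>\<close> is
  the component of degree \<open>\<alpha>\<close> of the free module with basis \<open>X\<close>. The set \<open>M\<close> consists of the
  degrees of the monomials in the resolved ideal.\<close>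

definition graded_resolution ::
    "'o::order set \<Rightarrow> 'o set \<Rightarrow> (nat \<Rightarrow> 'x set) \<Rightarrow> (nat \<Rightarrow> 'x \<Rightarrow> 'o) \<Rightarrow> (nat \<Rightarrow> 'x \<Rightarrow> 'x \<Rightarrow> 'a::field) \<Rightarrow> bool"
  where "graded_resolution \<Delta> M X f D \<longleftrightarrow>
    (\<exists>e. X 0 = {e} \<and> (\<forall>\<alpha>\<in>\<Delta>. f 0 e \<le> \<alpha>) \<and>
      (\<forall>\<alpha>\<in>\<Delta>. \<alpha> \<in> M \<longleftrightarrow> (\<exists>w. strand (X 1) (f 1) \<alpha> w \<and> (\<Sum>q\<in>X 1. D 0 e q * w q) \<noteq> 0))) \<and>
    (\<forall>i. finite (X i) \<and> f i ` X i \<subseteq> \<Delta> \<and> gmat (X i) (f i) (X (Suc i)) (f (Suc i)) (D i)) \<and>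
    (\<forall>i. mmul (X (Suc i)) (D i) (D (Suc i)) = (\<lambda>_ _. 0)) \<and>
    (\<forall>i. \<forall>\<alpha>\<in>\<Delta>. \<forall>c. strand (X (Suc i)) (f (Suc i)) \<alpha> c \<and> (\<forall>p. (\<Sum>q\<in>X (Suc i). D i p q * c q) = 0) \<longrightarrow>
       (\<exists>w. strand (X (Suc (Suc i))) (f (Suc (Suc i))) \<alpha> w \<and>
          (\<forall>p. (\<Sum>q\<in>X (Suc (Suc i)). D (Suc i) p q * w q) = c p)))"

text \<open>Stated for a single differential, since the Taylor resolution may be minimal around one
  homological degree and not around another. The index i belongs to the map from degree i + 1 to
  degree i.\<close>

definition minimal_at :: "(nat \<Rightarrow> 'x \<Rightarrow> 'o) \<Rightarrow> (nat \<Rightarrow> 'x \<Rightarrow> 'x \<Rightarrow> 'a::zero) \<Rightarrow> nat \<Rightarrow> bool"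
  where "minimal_at f D i \<longleftrightarrow> (\<forall>p q. D i p q \<noteq> 0 \<longrightarrow> f i p \<noteq> f (Suc i) q)"

lemma minimal_at_iff: "minimal_at f D i \<longleftrightarrow> unit_part (f i) (f (Suc i)) (D i) = (\<lambda>_ _. 0)"
  by (auto simp: minimal_at_def unit_part_def fun_eq_iff)

section \<open>Lifting homogeneous maps through a resolution\<close>

context
  fixes \<Delta> M :: "'o::order set" and X f and D :: "nat \<Rightarrow> 'x \<Rightarrow> 'x \<Rightarrow> 'a::field"
  assumes res: "graded_resolution \<Delta> M X f D"
begin

lemma res_finite: "finite (X i)" and res_deg: "f i ` X i \<subseteq> \<Delta>"
  and res_gmat: "gmat (X i) (f i) (X (Suc i)) (f (Suc i)) (D i)"
  and res_complex: "mmul (X (Suc i)) (D i) (D (Suc i)) = (\<lambda>_ _. 0)"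
  using res unfolding graded_resolution_def by blast+

lemma res_exact:
  assumes "\<alpha> \<in> \<Delta>" "strand (X (Suc i)) (f (Suc i)) \<alpha> c" "\<And>p. (\<Sum>q\<in>X (Suc i). D i p q * c q) = 0"
  shows "\<exists>w. strand (X (Suc (Suc i))) (f (Suc (Suc i))) \<alpha> w \<and>
          (\<forall>p. (\<Sum>q\<in>X (Suc (Suc i)). D (Suc i) p q * w q) = c p)"
proof -
  have "\<forall>i. \<forall>\<alpha>\<in>\<Delta>. \<forall>c. strand (X (Suc i)) (f (Suc i)) \<alpha> c \<and> (\<forall>p. (\<Sum>q\<in>X (Suc i). D i p q * c q) = 0) \<longrightarrow>
       (\<exists>w. strand (X (Suc (Suc i))) (f (Suc (Suc i))) \<alpha> w \<and>
          (\<forall>p. (\<Sum>q\<in>X (Suc (Suc i)). D (Suc i) p q * w q) = c p))"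
    using res unfolding graded_resolution_def by blast
  thus ?thesis using assms by blast
qed

text \<open>Every column of A is a cycle of the degree attached to it. Exactness in that degree
  gives a preimage of the same degree, so the lifted columns again form a homogeneous
  matrix.\<close>

lemma lift_columns:
  assumes A: "gmat (X (Suc i)) (f (Suc i)) Z h A" "h ` Z \<subseteq> \<Delta>" "mmul (X (Suc i)) (D i) A = (\<lambda>_ _. 0)"
  shows "\<exists>W. gmat (X (Suc (Suc i))) (f (Suc (Suc i))) Z h W \<and> mmul (X (Suc (Suc i))) (D (Suc i)) W = A"
proof -
  have "\<forall>z\<in>Z. \<exists>w. strand (X (Suc (Suc i))) (f (Suc (Suc i))) (h z) w \<and>
          (\<forall>p. (\<Sum>q\<in>X (Suc (Suc i)). D (Suc i) p q * w q) = A p z)"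
  proof
    fix z assume "z \<in> Z"
    show "\<exists>w. strand (X (Suc (Suc i))) (f (Suc (Suc i))) (h z) w \<and>
          (\<forall>p. (\<Sum>q\<in>X (Suc (Suc i)). D (Suc i) p q * w q) = A p z)"
    proof (rule res_exact)
      show "h z \<in> \<Delta>" using \<open>z \<in> Z\<close> assms by auto
      show "strand (X (Suc i)) (f (Suc i)) (h z) (\<lambda>p. A p z)"
        using A(1) by (auto simp: gmat_def strand_def)
      show "(\<Sum>q\<in>X (Suc i). D i p q * A q z) = 0" for p
        using fun_cong[OF fun_cong[OF A(3)], of p z] by (simp add: mmul_def)
    qed
  qed
  then obtain w where w: "\<And>z. z \<in> Z \<Longrightarrow> strand (X (Suc (Suc i))) (f (Suc (Suc i))) (h z) (w z)"
      "\<And>z p. z \<in> Z \<Longrightarrow> (\<Sum>q\<in>X (Suc (Suc i)). D (Suc i) p q * w z q) = A p z"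
    by metis
  define W where "W = (\<lambda>y z. if z \<in> Z then w z y else 0)"
  have "gmat (X (Suc (Suc i))) (f (Suc (Suc i))) Z h W"
    using w(1) by (auto simp: gmat_def W_def strand_def)
  moreover have "mmul (X (Suc (Suc i))) (D (Suc i)) W p z = A p z" for p z
    using w(2)[of z p] gmatD[OF A(1), of p z] by (cases "z \<in> Z") (auto simp: W_def mmul_def)
  ultimately show ?thesis by blast
qed

lemma res_head:
  obtains e where "X 0 = {e}" "\<forall>\<alpha>\<in>\<Delta>. f 0 e \<le> \<alpha>"
    "\<And>\<alpha>. \<alpha> \<in> \<Delta> \<Longrightarrow> \<alpha> \<in> M \<longleftrightarrow> (\<exists>w. strand (X 1) (f 1) \<alpha> w \<and> (\<Sum>q\<in>X 1. D 0 e q * w q) \<noteq> 0)"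
proof -
  from conjunct1[OF res[unfolded graded_resolution_def]]
  obtain e where e: "X 0 = {e}" "\<forall>\<alpha>\<in>\<Delta>. f 0 e \<le> \<alpha>"
    "\<forall>\<alpha>\<in>\<Delta>. \<alpha> \<in> M \<longleftrightarrow> (\<exists>w. strand (X 1) (f 1) \<alpha> w \<and> (\<Sum>q\<in>X 1. D 0 e q * w q) \<noteq> 0)"
    by (elim exE conjE)
  show thesis by (rule that[OF e(1,2)]) (rule bspec[OF e(3)])
qed


text \<open>At the bottom of the complex, membership of the degree in M replaces the cycle
  condition: the strand of the ring in one degree is a line, so a single nonzero value of the
  differential reaches all scalars.\<close>

lemma lift_columns_head:
  assumes A: "gmat (X 0) (f 0) Z h A" "h ` Z \<subseteq> \<Delta>" "\<And>x z. A x z \<noteq> 0 \<Longrightarrow> h z \<in> M"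
  shows "\<exists>W. gmat (X (Suc 0)) (f (Suc 0)) Z h W \<and> mmul (X (Suc 0)) (D 0) W = A"
proof -
  obtain e where e: "X 0 = {e}" 
    "\<And>\<alpha>. \<alpha> \<in> \<Delta> \<Longrightarrow> \<alpha> \<in> M \<longleftrightarrow> (\<exists>w. strand (X 1) (f 1) \<alpha> w \<and> (\<Sum>q\<in>X 1. D 0 e q * w q) \<noteq> 0)"
    using res_head by metis
  have "\<forall>z\<in>Z. \<exists>w. strand (X 1) (f 1) (h z) w \<and> (\<Sum>q\<in>X 1. D 0 e q * w q) = A e z"
  proof
    fix z assume "z \<in> Z"
    show "\<exists>w. strand (X 1) (f 1) (h z) w \<and> (\<Sum>q\<in>X 1. D 0 e q * w q) = A e z"
    proof (cases "A e z = 0")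
      case True
      thus ?thesis by (intro exI[of _ "\<lambda>_. 0"]) (auto simp: strand_def)
    next
      case False
      hence "h z \<in> M" "h z \<in> \<Delta>" using A \<open>z \<in> Z\<close> by auto
      then obtain w where w: "strand (X 1) (f 1) (h z) w" "(\<Sum>q\<in>X 1. D 0 e q * w q) \<noteq> 0"
        using e by blast
      \<comment> \<open>The given w hits some nonzero scalar s; scaling by A e z / s hits the
        required one.\<close>
      define s where "s = (\<Sum>q\<in>X 1. D 0 e q * w q)"
      have "(\<Sum>q\<in>X 1. D 0 e q * (w q * (A e z / s))) = s * (A e z / s)"
        unfolding s_def sum_distrib_right by (simp add: mult.assoc)
      hence "(\<Sum>q\<in>X 1. D 0 e q * (w q * (A e z / s))) = A e z" using w(2) s_def by simp
      moreover have "strand (X 1) (f 1) (h z) (\<lambda>q. w q * (A e z / s))"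
        using w(1) by (auto simp: strand_def)
      ultimately show ?thesis by blast
    qed
  qed
  then obtain w where w: "\<And>z. z \<in> Z \<Longrightarrow> strand (X 1) (f 1) (h z) (w z)"
      "\<And>z. z \<in> Z \<Longrightarrow> (\<Sum>q\<in>X 1. D 0 e q * w z q) = A e z"
    by metis
  define W where "W = (\<lambda>y z. if z \<in> Z then w z y else 0)"
  have "gmat (X (Suc 0)) (f (Suc 0)) Z h W"
    using w(1) by (auto simp: gmat_def W_def strand_def)
  moreover have "mmul (X (Suc 0)) (D 0) W p z = A p z" for p z
  proof (cases "p = e")
    case True
    thus ?thesis using w(2)[of z] gmatD[OF A(1), of p z] by (cases "z \<in> Z") (auto simp: W_def mmul_def)
  next
    case False
    hence "A p z = 0" "D 0 p q = 0" for q
      using gmatD[OF A(1), of p z] gmatD[OF res_gmat[of 0], of p q] e by auto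
    thus ?thesis by (simp add: mmul_def)
  qed
  ultimately show ?thesis by blast
qed

text \<open>Testing the differential on the basis vector z exhibits a nonzero value in degree
  \<open>f 1 z\<close>. This provides the membership in M that \<open>lift_columns_head\<close>
  demands when the first map of a chain map is lifted.\<close>

lemma res_head_degree: "D 0 x z \<noteq> 0 \<Longrightarrow> f 1 z \<in> M"
proof -
  assume D: "D 0 x z \<noteq> 0"
  obtain e where e: "X 0 = {e}" 
    "\<And>\<alpha>. \<alpha> \<in> \<Delta> \<Longrightarrow> \<alpha> \<in> M \<longleftrightarrow> (\<exists>w. strand (X 1) (f 1) \<alpha> w \<and> (\<Sum>q\<in>X 1. D 0 e q * w q) \<noteq> 0)"
    using res_head by metis
  have xz: "x = e" "z \<in> X 1" using gmatD[OF res_gmat[of 0] D] e by auto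
  have "strand (X 1) (f 1) (f 1 z) (\<lambda>q. if q = z then 1 else 0 :: 'a)"
    using xz by (auto simp: strand_def)
  moreover have "(\<Sum>q\<in>X 1. D 0 e q * (if q = z then 1 else 0)) = D 0 e z"
    using xz res_finite[of 1] by (simp add: if_distrib[of "(*) _"] cong: if_cong)
  moreover have "f 1 z \<in> \<Delta>" using res_deg[of 1] xz by auto
  ultimately show ?thesis using e(2) D xz by metis
qed

end

text \<open>The comparison theorem for resolutions: starting from the identity of the ring, the
  columns of \<phi> D are lifted one homological degree at a time. Both complexes resolve the same
  M, so the first lift is possible.\<close>

lemma chain_map_exists:
  fixes X :: "nat \<Rightarrow> 'x set" and Y :: "nat \<Rightarrow> 'y set"
    and D :: "nat \<Rightarrow> 'x \<Rightarrow> 'x \<Rightarrow> 'a::field" and E :: "nat \<Rightarrow> 'y \<Rightarrow> 'y \<Rightarrow> 'a"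
  assumes X: "graded_resolution \<Delta> M X f D" and Y: "graded_resolution \<Delta> M Y g E"
  shows "\<exists>\<phi> :: nat \<Rightarrow> 'y \<Rightarrow> 'x \<Rightarrow> 'a. \<phi> 0 = (\<lambda>y x. if y \<in> Y 0 \<and> x \<in> X 0 then 1 else 0) \<and>
    (\<forall>i. gmat (Y i) (g i) (X i) (f i) (\<phi> i)) \<and>
    (\<forall>i. mmul (Y (Suc i)) (E i) (\<phi> (Suc i)) = mmul (X i) (\<phi> i) (D i))"
proof -
  define \<phi>0 :: "'y \<Rightarrow> 'x \<Rightarrow> 'a" where "\<phi>0 = (\<lambda>y x. if y \<in> Y 0 \<and> x \<in> X 0 then 1 else 0)"
  \<comment> \<open>One step of the recursion sees only the current map, so the invariant records
    that the columns to be lifted next are cycles.\<close>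
  define P where "P = (\<lambda>i \<phi>. gmat (Y i) (g i) (X i) (f i) \<phi> \<and>
    (case i of 0 \<Rightarrow> \<phi> = \<phi>0 | Suc j \<Rightarrow>
       mmul (Y (Suc j)) (E j) (mmul (X (Suc j)) \<phi> (D (Suc j))) = (\<lambda>_ _. 0)))"
  define Q where "Q = (\<lambda>i \<phi> \<phi>'. mmul (Y (Suc i)) (E i) \<phi>' = mmul (X i) \<phi> (D i))"
  have "\<exists>\<phi>. \<forall>i. P i (\<phi> i) \<and> Q i (\<phi> i) (\<phi> (Suc i))"
  proof (rule dependent_nat_choice)
    have "gmat (Y 0) (g 0) (X 0) (f 0) \<phi>0"
      using res_head[OF Y] res_deg[OF X, of 0] unfolding gmat_def \<phi>0_def
      by (metis image_subset_iff singletonD)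
    thus "\<exists>\<phi>. P 0 \<phi>" by (auto simp: P_def)
  next
    fix \<phi> i assume P: "P i \<phi>"
    have gm: "gmat (Y i) (g i) (X (Suc i)) (f (Suc i)) (mmul (X i) \<phi> (D i))"
      by (rule gmat_mmul[OF _ res_gmat[OF X]]) (use P in \<open>auto simp: P_def\<close>)
    have "\<exists>\<phi>'. gmat (Y (Suc i)) (g (Suc i)) (X (Suc i)) (f (Suc i)) \<phi>' \<and>
       mmul (Y (Suc i)) (E i) \<phi>' = mmul (X i) \<phi> (D i)"
    proof (cases i)
      case 0
      have "f (Suc 0) z \<in> M" if "mmul (X 0) \<phi> (D 0) y z \<noteq> 0" for y z
      proof -
        from that obtain x where "\<phi> y x * D 0 x z \<noteq> 0"
          unfolding mmul_def by (meson sum.not_neutral_contains_not_neutral)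
        thus ?thesis using res_head_degree[OF X, of x z] by auto
      qed
      thus ?thesis using lift_columns_head[OF Y, of "X 1" "f 1"] gm res_deg[OF X, of 1] 0 by auto
    next
      case (Suc j)
      thus ?thesis using lift_columns[OF Y gm[unfolded Suc]] res_deg[OF X, of "Suc i"] P
        by (auto simp: P_def)
    qed
    then obtain \<phi>' where \<phi>': "gmat (Y (Suc i)) (g (Suc i)) (X (Suc i)) (f (Suc i)) \<phi>'"
       "mmul (Y (Suc i)) (E i) \<phi>' = mmul (X i) \<phi> (D i)" by blast
    have "mmul (Y (Suc i)) (E i) (mmul (X (Suc i)) \<phi>' (D (Suc i))) =
        mmul (X (Suc i)) (mmul (X i) \<phi> (D i)) (D (Suc i))"
      using \<phi>'(2) mmul_assoc[OF res_finite[OF Y] res_finite[OF X], of _ _ "E i" \<phi>'] by metis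
    also have "\<dots> = (\<lambda>_ _. 0)"
      by (simp add: mmul_assoc[OF res_finite[OF X] res_finite[OF X]] res_complex[OF X])
    finally show "\<exists>\<phi>'. P (Suc i) \<phi>' \<and> Q i \<phi> \<phi>'" using \<phi>' by (auto simp: P_def Q_def)
  qed
  then obtain \<phi> where "\<forall>i. P i (\<phi> i) \<and> Q i (\<phi> i) (\<phi> (Suc i))" by blast
  hence "P i (\<phi> i)" "Q i (\<phi> i) (\<phi> (Suc i))" for i by auto
  thus ?thesis using \<open>P 0 (\<phi> 0)\<close> unfolding P_def Q_def \<phi>0_def by (intro exI[of _ \<phi>]) (auto split: nat.splits)
qed

text \<open>An endomorphism over the identity is homotopic to it, and both \<open>D h\<close> and \<open>h D\<close>
  vanish modulo the variables wherever the differentials do.\<close>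

lemma unit_part_endomorphism:
  fixes X :: "nat \<Rightarrow> 'x set" and D :: "nat \<Rightarrow> 'x \<Rightarrow> 'x \<Rightarrow> 'a::field"
  assumes X: "graded_resolution \<Delta> M X f D"
    and chi0: "\<chi> 0 = ident (X 0)" and gm: "\<And>i. gmat (X i) (f i) (X i) (f i) (\<chi> i)"
    and ch: "\<And>i. mmul (X (Suc i)) (D i) (\<chi> (Suc i)) = mmul (X i) (\<chi> i) (D i)"
    and min: "minimal_at f D i" "minimal_at f D (Suc i)"
  shows "unit_part (f (Suc i)) (f (Suc i)) (\<chi> (Suc i)) = ident (X (Suc i))"
proof -
  note fin = res_finite[OF X]
  define \<delta> where "\<delta> = (\<lambda>i x y. \<chi> i x y - ident (X i) x y)"
  have \<delta>gm: "gmat (X i) (f i) (X i) (f i) (\<delta> i)" for i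
    unfolding \<delta>_def by (rule gmat_diff[OF gm gmat_ident])
  have \<delta>ch: "mmul (X (Suc i)) (D i) (\<delta> (Suc i)) = mmul (X i) (\<delta> i) (D i)" for i
    unfolding \<delta>_def mmul_diff ch using mmul_ident_left[OF fin, of "D i" i]
      mmul_ident_right[OF fin, of "D i" "Suc i"] gmatD[OF res_gmat[OF X]] by simp
  \<comment> \<open>The second clause says that \<delta> - h D is a cycle. The next component of the
    homotopy is a lift of it, which is what Q expresses.\<close>
  define P where "P = (\<lambda>i h. gmat (X (Suc i)) (f (Suc i)) (X i) (f i) h \<and>
    mmul (X (Suc i)) (D i) (mmul (X i) h (D i)) = mmul (X (Suc i)) (D i) (\<delta> (Suc i)))"
  define Q where "Q = (\<lambda>i h h'. mmul (X (Suc (Suc i))) (D (Suc i)) h' =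
     (\<lambda>x y. \<delta> (Suc i) x y - mmul (X i) h (D i) x y))"
  have "\<exists>h. \<forall>i. P i (h i) \<and> Q i (h i) (h (Suc i))"
  proof (rule dependent_nat_choice)
    \<comment> \<open>Since \<chi> is the identity in degree 0, the homotopy can start with
      zero.\<close>
    have "\<delta> 0 = (\<lambda>_ _. 0)" by (simp add: \<delta>_def chi0)
    hence "P 0 (\<lambda>_ _. 0)" by (simp add: P_def gmat_zero \<delta>ch)
    thus "\<exists>h. P 0 h" by blast
  next
    fix h i assume P: "P i h"
    define A where "A = (\<lambda>x y. \<delta> (Suc i) x y - mmul (X i) h (D i) x y)"
    have "\<exists>h'. gmat (X (Suc (Suc i))) (f (Suc (Suc i))) (X (Suc i)) (f (Suc i)) h' \<and>
        mmul (X (Suc (Suc i))) (D (Suc i)) h' = A"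
    proof (rule lift_columns[OF X])
      show "gmat (X (Suc i)) (f (Suc i)) (X (Suc i)) (f (Suc i)) A"
        unfolding A_def using P by (intro gmat_diff \<delta>gm gmat_mmul[OF _ res_gmat[OF X]]) (simp add: P_def)
      show "f (Suc i) ` X (Suc i) \<subseteq> \<Delta>" by (rule res_deg[OF X])
      show "mmul (X (Suc i)) (D i) A = (\<lambda>_ _. 0)"
        unfolding A_def mmul_diff using P by (simp add: P_def)
    qed
    then obtain h' where h': "gmat (X (Suc (Suc i))) (f (Suc (Suc i))) (X (Suc i)) (f (Suc i)) h'"
        "mmul (X (Suc (Suc i))) (D (Suc i)) h' = A" by blast
    have "mmul (X (Suc i)) A (D (Suc i)) = mmul (X (Suc i)) (\<delta> (Suc i)) (D (Suc i))"
      unfolding A_def mmul_diff by (simp add: mmul_assoc[OF fin fin] res_complex[OF X])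
    hence "mmul (X (Suc (Suc i))) (D (Suc i)) (mmul (X (Suc i)) h' (D (Suc i))) =
        mmul (X (Suc (Suc i))) (D (Suc i)) (\<delta> (Suc (Suc i)))"
      using h'(2) by (simp add: mmul_assoc[OF fin fin, symmetric] \<delta>ch)
    thus "\<exists>h'. P (Suc i) h' \<and> Q i h h'" using h' by (auto simp: P_def Q_def A_def)
  qed
  then obtain h where h: "\<And>i. P i (h i)" "\<And>i. Q i (h i) (h (Suc i))" by blast
  have u1: "unit_part (f (Suc i)) (f (Suc i)) (mmul (X (Suc (Suc i))) (D (Suc i)) (h (Suc i))) = (\<lambda>_ _. 0)"
    using h(1)[of "Suc i"] min(2)
    by (subst unit_part_mmul[OF res_gmat[OF X]]) (auto simp: P_def minimal_at_iff)
  have u2: "unit_part (f (Suc i)) (f (Suc i)) (mmul (X i) (h i) (D i)) = (\<lambda>_ _. 0)"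
    using h(1)[of i] min(1)
    by (subst unit_part_mmul[OF _ res_gmat[OF X]]) (auto simp: P_def minimal_at_iff)
  have \<delta>0: "\<delta> (Suc i) x y = 0" if "f (Suc i) x = f (Suc i) y" for x y
    using fun_cong[OF fun_cong[OF u1], of x y] fun_cong[OF fun_cong[OF u2], of x y] that
      fun_cong[OF fun_cong[OF h(2)[of i, unfolded Q_def]], of x y]
    by (simp add: unit_part_def)
  show ?thesis
  proof (intro ext)
    fix x y
    show "unit_part (f (Suc i)) (f (Suc i)) (\<chi> (Suc i)) x y = ident (X (Suc i)) x y"
      using \<delta>0[of x y] by (auto simp: \<delta>_def unit_part_def ident_def)
  qed
qed

text \<open>Chain maps in both directions compose to an endomorphism of X that reduces to the
  identity in degree i + 1, by minimality of X on both sides of that degree. The assumed inequality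
  of ranks then makes the reduced maps mutually inverse, and minimality is transported from X to Y.
  The same statement serves for uniqueness of ranks and for the comparison with the Taylor
  resolution.\<close>

theorem minimal_rank_comparison:
  fixes X :: "nat \<Rightarrow> 'x set" and Y :: "nat \<Rightarrow> 'y set"
    and D :: "nat \<Rightarrow> 'x \<Rightarrow> 'x \<Rightarrow> 'a::field" and E :: "nat \<Rightarrow> 'y \<Rightarrow> 'y \<Rightarrow> 'a"
  assumes X: "graded_resolution \<Delta> M X f D" and Y: "graded_resolution \<Delta> M Y g E"
    and min: "minimal_at f D i" "minimal_at f D (Suc i)"
    and card: "card (Y (Suc i)) \<le> card (X (Suc i))"
  shows "card (Y (Suc i)) = card (X (Suc i))" "minimal_at g E i" "minimal_at g E (Suc i)"
proof -
  note finX = res_finite[OF X] and finY = res_finite[OF Y]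
  obtain \<phi> :: "nat \<Rightarrow> 'y \<Rightarrow> 'x \<Rightarrow> 'a" where \<phi>0: "\<phi> 0 = (\<lambda>y x. if y \<in> Y 0 \<and> x \<in> X 0 then 1 else 0)"
    and \<phi>: "\<And>i. gmat (Y i) (g i) (X i) (f i) (\<phi> i)"
      "\<And>i. mmul (Y (Suc i)) (E i) (\<phi> (Suc i)) = mmul (X i) (\<phi> i) (D i)"
    using chain_map_exists[OF X Y] by blast
  obtain \<psi> :: "nat \<Rightarrow> 'x \<Rightarrow> 'y \<Rightarrow> 'a" where \<psi>0: "\<psi> 0 = (\<lambda>y x. if y \<in> X 0 \<and> x \<in> Y 0 then 1 else 0)"
    and \<psi>: "\<And>i. gmat (X i) (f i) (Y i) (g i) (\<psi> i)"
      "\<And>i. mmul (X (Suc i)) (D i) (\<psi> (Suc i)) = mmul (Y i) (\<psi> i) (E i)"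
    using chain_map_exists[OF Y X] by blast
  define \<chi> where "\<chi> = (\<lambda>i. mmul (Y i) (\<psi> i) (\<phi> i))"
  define P where "P = unit_part (g (Suc i)) (f (Suc i)) (\<phi> (Suc i))"
  define Q where "Q = unit_part (f (Suc i)) (g (Suc i)) (\<psi> (Suc i))"
  \<comment> \<open>Both modules in degree 0 have one basis element and both maps are 1 there, so
    the composite is the identity and not merely homotopic to it.\<close>
  obtain e e' where "X 0 = {e}" "Y 0 = {e'}" using res_head[OF X] res_head[OF Y] by metis
  hence \<chi>0: "\<chi> 0 = ident (X 0)"
    unfolding \<chi>_def mmul_def ident_def \<phi>0 \<psi>0 by (auto simp: fun_eq_iff)
  have \<chi>ch: "mmul (X (Suc i)) (D i) (\<chi> (Suc i)) = mmul (X i) (\<chi> i) (D i)" for i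
    unfolding \<chi>_def by (simp add: mmul_assoc[OF finX finY, symmetric] \<psi>(2))
      (simp add: mmul_assoc[OF finY finY] mmul_assoc[OF finY finX] \<phi>(2))
  have "unit_part (f (Suc i)) (f (Suc i)) (\<chi> (Suc i)) = ident (X (Suc i))"
    using gmat_mmul[OF \<psi>(1) \<phi>(1)]
    by (intro unit_part_endomorphism[OF X \<chi>0 _ \<chi>ch min]) (simp add: \<chi>_def)
  hence QP: "mmul (Y (Suc i)) Q P = ident (X (Suc i))"
    unfolding \<chi>_def P_def Q_def by (simp add: unit_part_mmul[OF \<psi>(1) \<phi>(1)])
  have P0: "P y x \<noteq> 0 \<Longrightarrow> y \<in> Y (Suc i)" for x y
    using gmatD[OF \<phi>(1), of "Suc i" y x] by (auto simp: P_def unit_part_def split: if_splits)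
  have Q0: "Q x y \<noteq> 0 \<Longrightarrow> y \<in> Y (Suc i)" for x y
    using gmatD[OF \<psi>(1), of "Suc i" x y] by (auto simp: Q_def unit_part_def split: if_splits)
  show "card (Y (Suc i)) = card (X (Suc i))"
    by (rule mmul_left_inverse_imp_right_inverse(1)[OF finX finY card QP P0 Q0])
  have PQ: "mmul (X (Suc i)) P Q = ident (Y (Suc i))"
    by (rule mmul_left_inverse_imp_right_inverse(2)[OF finX finY card QP P0 Q0])
  define E0 where "E0 = unit_part (g i) (g (Suc i)) (E i)"
  define E1 where "E1 = unit_part (g (Suc i)) (g (Suc (Suc i))) (E (Suc i))"
  \<comment> \<open>Reducing E \<phi> = \<phi> D gives E0 P = 0, because D reduces to 0; the right
    inverse Q of P then cancels P. For E1 the argument is repeated with \<psi> and the left inverse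
    P of Q.\<close>
  have "mmul (Y (Suc i)) E0 P = (\<lambda>_ _. 0)"
    unfolding E0_def P_def unit_part_mmul[OF res_gmat[OF Y] \<phi>(1), symmetric] \<phi>(2)
      unit_part_mmul[OF \<phi>(1) res_gmat[OF X]]
    using min(1) by (simp add: minimal_at_iff)
  moreover have "mmul (X (Suc i)) (mmul (Y (Suc i)) E0 P) Q = E0"
    unfolding mmul_assoc[OF finY finX] PQ
    using gmatD[OF res_gmat[OF Y, of i]]
    by (intro mmul_ident_right[OF finY]) (auto simp: E0_def unit_part_def split: if_splits)
  ultimately show "minimal_at g E i" by (simp add: minimal_at_iff E0_def)
  have "mmul (Y (Suc i)) Q E1 = (\<lambda>_ _. 0)"
    unfolding E1_def Q_def unit_part_mmul[OF \<psi>(1) res_gmat[OF Y], symmetric] \<psi>(2)[symmetric]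
      unit_part_mmul[OF res_gmat[OF X] \<psi>(1)]
    using min(2) by (simp add: minimal_at_iff)
  moreover have "mmul (X (Suc i)) P (mmul (Y (Suc i)) Q E1) = E1"
    unfolding mmul_assoc[OF finX finY, symmetric] PQ
    using gmatD[OF res_gmat[OF Y, of "Suc i"]]
    by (intro mmul_ident_left[OF finY]) (auto simp: E1_def unit_part_def split: if_splits)
  ultimately show "minimal_at g E (Suc i)" by (simp add: minimal_at_iff E1_def)
qed

section \<open>Strands of minimal free resolutions\<close>

abbreviation lookup :: "('b \<Rightarrow>\<^sub>0 'c::zero) \<Rightarrow> 'b \<Rightarrow> 'c" where "lookup \<equiv> Poly_Mapping.lookup"

lemma lookup_single_mult:
  fixes w :: "'a::semiring_0 mpoly"
  shows "lookup (Poly_Mapping.single m a * w) l =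
    (if lookup m \<le> lookup l then a * lookup w (l - m) else 0)"
proof -
  have "lookup (Poly_Mapping.single m a * w) l =
      (\<Sum>k. (a when m = k) * (\<Sum>q. lookup w q when l = k + q))"
    by (simp add: lookup_mult lookup_single)
  also have "\<dots> = (\<Sum>k. (a * (\<Sum>q. lookup w q when l = k + q)) when m = k)"
    by (simp add: when_mult)
  also have "\<dots> = a * (\<Sum>q. lookup w q when l = m + q)" by simp
  also have "\<dots> = (if lookup m \<le> lookup l then a * lookup w (l - m) else 0)"
  proof (cases "lookup m \<le> lookup l")
    case True
    hence "l = m + (l - m)"
      by (intro poly_mapping_eqI) (auto simp: lookup_add lookup_minus le_fun_def)
    hence "l = m + q \<longleftrightarrow> q = l - m" for q by (metis add_left_cancel)
    thus ?thesis using True by simp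
  next
    case False
    hence "l \<noteq> m + q" for q by (auto simp: le_fun_def lookup_add)
    thus ?thesis using False by simp
  qed
  finally show ?thesis .
qed

section \<open>Exponent arithmetic and multidegree components\<close>

lemma exponents_minus: "m \<in> exponents n \<Longrightarrow> m - l \<in> exponents n"
  by (auto simp: exponents_def in_keys_iff lookup_minus subset_iff)

lemma exponents_add: "m + l \<in> exponents n \<longleftrightarrow> m \<in> exponents n \<and> l \<in> exponents n"
  by (auto simp: exponents_def in_keys_iff lookup_add subset_iff)

lemma exponent_minus_add: "lookup l \<le> lookup m \<Longrightarrow> m - l + l = (m :: exponent)"
  by (intro poly_mapping_eqI) (auto simp: lookup_add lookup_minus le_fun_def)

lemma lookup_le_add: "lookup l \<le> lookup (m + l :: exponent)"
  by (auto simp: lookup_add le_fun_def)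

lemma exponent_add_diff: "m + l - l = (m :: exponent)"
  by (intro poly_mapping_eqI) (auto simp: lookup_add lookup_minus)

text \<open>The coordinates of the degree \<alpha> part of v, when the basis element q has degree
  \<delta> q. Subtraction of exponents is truncated, so the case that \<delta> q does not divide
  \<alpha> must be excluded explicitly. Degrees are compared through \<open>lookup\<close>, whose
  pointwise order is divisibility.\<close>

definition component :: "(nat \<Rightarrow> exponent) \<Rightarrow> nat \<Rightarrow> exponent \<Rightarrow> 'a::field mpoly vec \<Rightarrow> nat \<Rightarrow> 'a"
  where "component \<delta> r \<alpha> v =
    (\<lambda>q. if q < r \<and> lookup (\<delta> q) \<le> lookup \<alpha> then lookup (v $ q) (\<alpha> - \<delta> q) else 0)"

definition homogeneous_vec :: "(nat \<Rightarrow> exponent) \<Rightarrow> nat \<Rightarrow> exponent \<Rightarrow> (nat \<Rightarrow> 'a) \<Rightarrow> 'a::field mpoly vec"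
  where "homogeneous_vec \<delta> r \<alpha> c = vec r (\<lambda>q. Poly_Mapping.single (\<alpha> - \<delta> q) (c q))"

definition homogeneous_mat ::
    "(nat \<Rightarrow> exponent) \<Rightarrow> nat \<Rightarrow> (nat \<Rightarrow> exponent) \<Rightarrow> nat \<Rightarrow> (nat \<Rightarrow> nat \<Rightarrow> 'a) \<Rightarrow> 'a::field mpoly mat"
  where "homogeneous_mat \<delta> a \<epsilon> b A =
    mat a b (\<lambda>(p, q). Poly_Mapping.single (\<epsilon> q - \<delta> p) (A p q))"

abbreviation (input) degs :: "(nat \<Rightarrow> exponent) \<Rightarrow> nat \<Rightarrow> nat \<Rightarrow> nat"
  where "degs \<delta> \<equiv> (\<lambda>q. lookup (\<delta> q))"

lemma component_eqI:
  assumes "v \<in> carrier_vec r" "w \<in> carrier_vec r"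
    and "\<And>\<alpha>. component \<delta> r \<alpha> v = component \<delta> r \<alpha> w"
  shows "v = w"
proof (rule eq_vecI)
  fix q assume "q < dim_vec w"
  hence q: "q < r" using assms(2) by simp
  show "v $ q = w $ q"
  proof (rule poly_mapping_eqI)
    fix m
    show "lookup (v $ q) m = lookup (w $ q) m"
      using fun_cong[OF assms(3)[of "m + \<delta> q"], of q] q lookup_le_add[of "\<delta> q" m]
      by (simp add: component_def exponent_add_diff)
  qed
qed (use assms in simp)

text \<open>A sum of exponents lies in \<open>exponents n\<close> iff both summands do, so shifting
  by the basis degrees does not change which variables beyond n occur. Membership can thus be
  checked degree by degree.\<close>

lemma free_module_iff_component:
  assumes "\<And>q. q < r \<Longrightarrow> \<delta> q \<in> exponents n"
  shows "v \<in> free_module n r \<longleftrightarrow> v \<in> carrier_vec r \<and>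
    (\<forall>\<alpha>. \<alpha> \<notin> exponents n \<longrightarrow> component \<delta> r \<alpha> v = (\<lambda>_. 0))"
proof safe
  assume v: "v \<in> free_module n r"
  thus "v \<in> carrier_vec r" by (simp add: free_module_def)
  fix \<alpha> assume \<alpha>: "\<alpha> \<notin> exponents n"
  show "component \<delta> r \<alpha> v = (\<lambda>_. 0)"
  proof
    fix q
    have "lookup (v $ q) (\<alpha> - \<delta> q) = 0" if q: "q < r" "degs \<delta> q \<le> lookup \<alpha>"
    proof -
      have "\<alpha> - \<delta> q \<notin> exponents n"
        using \<alpha> exponent_minus_add[OF q(2)] assms[OF q(1)] exponents_add by metis
      moreover have "Poly_Mapping.keys (v $ q) \<subseteq> exponents n"
        using v q by (auto simp: free_module_def poly_ring_def)
      ultimately show ?thesis by (auto simp: in_keys_iff subset_iff)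
    qed
    thus "component \<delta> r \<alpha> v q = 0" by (simp add: component_def)
  qed
next
  assume v: "v \<in> carrier_vec r"
    and 0: "\<forall>\<alpha>. \<alpha> \<notin> exponents n \<longrightarrow> component \<delta> r \<alpha> v = (\<lambda>_. 0)"
  have "m \<in> exponents n" if "q < r" "lookup (v $ q) m \<noteq> 0" for q m
  proof (rule ccontr)
    assume "m \<notin> exponents n"
    hence "component \<delta> r (m + \<delta> q) v q = 0" using 0 exponents_add by metis
    thus False using that lookup_le_add[of "\<delta> q" m] by (simp add: component_def exponent_add_diff)
  qed
  thus "v \<in> free_module n r"
    using v by (auto simp: free_module_def poly_ring_def in_keys_iff)
qed

lemma component_homogeneous_vec:
  assumes "strand {..<r} (degs \<delta>) (lookup \<alpha>) c"
  shows "component \<delta> r \<beta> (homogeneous_vec \<delta> r \<alpha> c) = (if \<beta> = \<alpha> then c else (\<lambda>_. 0))"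
proof
  fix q
  have c: "c q \<noteq> 0 \<Longrightarrow> q < r \<and> degs \<delta> q \<le> lookup \<alpha>" using assms by (auto simp: strand_def)
  \<comment> \<open>Truncated subtraction of \<delta> q is injective on multiples of \<delta> q, and
    c q \<noteq> 0 makes \<alpha> such a multiple.\<close>
  have "\<beta> = \<alpha>" if "c q \<noteq> 0" "degs \<delta> q \<le> lookup \<beta>" "\<alpha> - \<delta> q = \<beta> - \<delta> q"
    using exponent_minus_add c that by metis
  thus "component \<delta> r \<beta> (homogeneous_vec \<delta> r \<alpha> c) q = (if \<beta> = \<alpha> then c else (\<lambda>_. 0)) q"
    using c by (auto simp: component_def homogeneous_vec_def lookup_single when_def)
qed

lemma strand_component: "strand {..<r} (degs \<delta>) (lookup \<alpha>) (component \<delta> r \<alpha> v)"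
  by (auto simp: strand_def component_def)

lemma homogeneous_vec_free_module:
  "\<alpha> \<in> exponents n \<Longrightarrow> homogeneous_vec \<delta> r \<alpha> c \<in> free_module n r"
  by (auto simp: homogeneous_vec_def free_module_def poly_ring_def exponents_minus split: if_splits)

text \<open>The justification of the scalar encoding: the monomial in entry (p, q) shifts degrees by
  exactly the difference of the basis degrees, so the polynomial matrix acts on every multidegree by
  the same scalar matrix A.\<close>

lemma component_mult:
  assumes A: "gmat {..<a} (degs \<delta>) {..<b} (degs \<epsilon>) A" and w: "w \<in> carrier_vec b"
  shows "component \<delta> a \<alpha> (homogeneous_mat \<delta> a \<epsilon> b A *\<^sub>v w) =
    (\<lambda>p. \<Sum>q<b. A p q * component \<epsilon> b \<alpha> w q)"
proof
  fix p
  show "component \<delta> a \<alpha> (homogeneous_mat \<delta> a \<epsilon> b A *\<^sub>v w) p = (\<Sum>q<b. A p q * component \<epsilon> b \<alpha> w q)"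
  proof (cases "p < a \<and> degs \<delta> p \<le> lookup \<alpha>")
    case True
    have entry: "lookup (Poly_Mapping.single (\<epsilon> q - \<delta> p) (A p q) * w $ q) (\<alpha> - \<delta> p) =
        A p q * component \<epsilon> b \<alpha> w q" if "q < b" for q
    proof (cases "A p q = 0")
      case False
      hence le: "degs \<delta> p \<le> degs \<epsilon> q" using gmatD[OF A] by blast
      have "lookup (\<epsilon> q - \<delta> p) \<le> lookup (\<alpha> - \<delta> p) \<longleftrightarrow> degs \<epsilon> q \<le> lookup \<alpha>"
        using le True by (auto simp: le_fun_def lookup_minus) (metis diff_le_mono eq_diff_iff le_diff_iff)+
      moreover have "(\<alpha> - \<delta> p) - (\<epsilon> q - \<delta> p) = \<alpha> - \<epsilon> q"
        using le True by (intro poly_mapping_eqI) (auto simp: le_fun_def lookup_minus)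
      ultimately show ?thesis using that by (simp add: lookup_single_mult component_def)
    qed simp
    have "(homogeneous_mat \<delta> a \<epsilon> b A *\<^sub>v w) $ p =
        (\<Sum>q<b. Poly_Mapping.single (\<epsilon> q - \<delta> p) (A p q) * w $ q)"
      using True w by (simp add: homogeneous_mat_def scalar_prod_def atLeast0LessThan)
    thus ?thesis using True entry by (simp add: component_def[of \<delta>] lookup_sum)
  next
    case False
    have "A p q * component \<epsilon> b \<alpha> w q = 0" for q
    proof (rule ccontr)
      assume "A p q * component \<epsilon> b \<alpha> w q \<noteq> 0"
      hence "p < a" "degs \<delta> p \<le> degs \<epsilon> q" "degs \<epsilon> q \<le> lookup \<alpha>"
        using gmatD[OF A, of p q] by (auto simp: component_def split: if_splits)
      thus False using False order_trans by blast
    qed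
    hence "(\<Sum>q<b. A p q * component \<epsilon> b \<alpha> w q) = 0" by (intro sum.neutral) blast
    thus ?thesis using False by (auto simp: component_def)
  qed
qed

lemma homogeneous_mat_carrier: "homogeneous_mat \<delta> a \<epsilon> b A \<in> carrier_mat a b"
  by (simp add: homogeneous_mat_def)

section \<open>From minimal free resolutions to scalar complexes\<close>

lemma lookup_zero_ideal_span_vars:
  assumes "p \<in> ideal_span n (var ` S)"
  shows "lookup (p :: 'a::field mpoly) 0 = 0"
proof -
  obtain c F where p: "p = (\<Sum>g\<in>F. c g * g)" "F \<subseteq> var ` S"
    using assms unfolding ideal_span_def by blast
  have "lookup (c g * g) 0 = 0" if g: "g \<in> F" for g
  proof -
    obtain i where "g = var i" using p(2) g by blast
    hence "c g * g = Poly_Mapping.single (Poly_Mapping.single i 1) 1 * c g"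
      by (simp add: var_def mult.commute)
    moreover have "\<not> lookup (Poly_Mapping.single i (1::nat)) \<le> lookup (0 :: exponent)"
      by (auto simp: le_fun_def lookup_single when_def)
    ultimately show ?thesis by (simp only: lookup_single_mult if_False)
  qed
  thus ?thesis by (simp add: p lookup_sum)
qed

definition ideal_degrees :: "nat \<Rightarrow> 'a::field mpoly set \<Rightarrow> (nat \<Rightarrow> nat) set"
  where "ideal_degrees n M = lookup ` {m \<in> exponents n. Poly_Mapping.single m 1 \<in> M}"

lemma ideal_degrees_iff:
  "m \<in> exponents n \<Longrightarrow> lookup m \<in> ideal_degrees n M \<longleftrightarrow> Poly_Mapping.single m 1 \<in> M"
  by (auto simp: ideal_degrees_def poly_mapping_eq_iff[symmetric])

text \<open>The multigrading leaves room for one monomial in each entry, and D collects its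
  coefficient. Statements about strands follow by feeding homogeneous vectors into the polynomial
  complex and reading off one component of the result.\<close>

lemma graded_resolution_of_minimal_free_resolution:
  fixes d :: "nat \<Rightarrow> 'a::field mpoly mat"
  assumes "minimal_free_resolution n M r deg d"
  obtains D :: "nat \<Rightarrow> nat \<Rightarrow> nat \<Rightarrow> 'a" where
    "graded_resolution (lookup ` exponents n) (ideal_degrees n M) (\<lambda>i. {..<r i}) (\<lambda>i. degs (deg i)) D"
    "\<And>i. minimal_at (\<lambda>i. degs (deg i)) D i"
proof -
  have r0: "r 0 = 1"
    and car: "\<And>i. d (Suc i) \<in> carrier_mat (r i) (r (Suc i))"
    and deg0: "deg 0 0 = 0"
    and deg: "\<And>i q. q < r i \<Longrightarrow> deg i q \<in> exponents n"
    and keys: "\<And>i p q m. p < r i \<Longrightarrow> q < r (Suc i) \<Longrightarrow>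
      m \<in> Poly_Mapping.keys (d (Suc i) $$ (p, q)) \<Longrightarrow> m + deg i p = deg (Suc i) q"
    and head: "{(d 1 *\<^sub>v v) $ 0 |v. v \<in> free_module n (r 1)} = M"
    and exact: "\<And>i. {v \<in> free_module n (r (Suc i)). d (Suc i) *\<^sub>v v = 0\<^sub>v (r i)} =
       {d (Suc (Suc i)) *\<^sub>v w |w. w \<in> free_module n (r (Suc (Suc i)))}"
    and min: "\<And>i p q. p < r i \<Longrightarrow> q < r (Suc i) \<Longrightarrow> d (Suc i) $$ (p, q) \<in> ideal_span n (var ` {1..n})"
    using assms unfolding minimal_free_resolution_def by simp_all
  define D where "D = (\<lambda>i p q. if p < r i \<and> q < r (Suc i)
    then lookup (d (Suc i) $$ (p, q)) (deg (Suc i) q - deg i p) else 0)"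
  define f where "f = (\<lambda>i. degs (deg i))"
  have entry: "d (Suc i) $$ (p, q) = Poly_Mapping.single (deg (Suc i) q - deg i p) (D i p q)"
    if "p < r i" "q < r (Suc i)" for i p q
  proof (rule poly_mapping_eqI)
    fix m
    have "m = deg (Suc i) q - deg i p" if "lookup (d (Suc i) $$ (p, q)) m \<noteq> 0"
      using keys[OF \<open>p < r i\<close> \<open>q < r (Suc i)\<close>, of m] that exponent_add_diff[of m "deg i p"]
      by (simp add: in_keys_iff)
    thus "lookup (d (Suc i) $$ (p, q)) m =
        lookup (Poly_Mapping.single (deg (Suc i) q - deg i p) (D i p q)) m"
      using that by (auto simp: lookup_single when_def D_def)
  qed
  have hom: "d (Suc i) = homogeneous_mat (deg i) (r i) (deg (Suc i)) (r (Suc i)) (D i)" for i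
    by (rule eq_matI) (use car[of i] entry in \<open>auto simp: homogeneous_mat_def\<close>)
  have gm: "gmat {..<r i} (f i) {..<r (Suc i)} (f (Suc i)) (D i)" for i
    unfolding gmat_def f_def
  proof (intro allI impI)
    fix p q assume D: "D i p q \<noteq> 0"
    hence pq: "p < r i" "q < r (Suc i)" by (auto simp: D_def split: if_splits)
    hence "deg (Suc i) q - deg i p \<in> Poly_Mapping.keys (d (Suc i) $$ (p, q))"
      using D by (simp add: D_def in_keys_iff)
    from keys[OF pq this] lookup_le_add[of "deg i p" "deg (Suc i) q - deg i p"]
    show "p \<in> {..<r i} \<and> q \<in> {..<r (Suc i)} \<and> degs (deg i) p \<le> degs (deg (Suc i)) q"
      using pq by simp
  qed
  note cm = component_mult[OF gm[unfolded f_def], folded hom]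
  have fmc: "v \<in> free_module n s \<Longrightarrow> v \<in> carrier_vec s" for v :: "'a mpoly vec" and s
    by (simp add: free_module_def)
  have hvc: "homogeneous_vec \<delta> s \<alpha> c \<in> carrier_vec s" for \<delta> s \<alpha> and c :: "nat \<Rightarrow> 'a"
    by (simp add: homogeneous_vec_def)
  have comp0: "component \<delta> s \<alpha> (0\<^sub>v s) = (\<lambda>_. 0 :: 'a)" for \<delta> s \<alpha>
    by (auto simp: component_def)
  have dcar: "d (Suc i) *\<^sub>v v \<in> carrier_vec (r i)" for i v
    using car[of i] by (simp add: mult_mat_vec_carrier carrier_vecI)
  show thesis
  proof (rule that[of D])
    show "minimal_at (\<lambda>i. degs (deg i)) D i" for i
      unfolding minimal_at_def
    proof (intro allI impI notI)
      fix p q assume D: "D i p q \<noteq> 0" and eq: "degs (deg i) p = degs (deg (Suc i)) q"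
      hence pq: "p < r i" "q < r (Suc i)" by (auto simp: D_def split: if_splits)
      \<comment> \<open>Between equal degrees the coefficient is the constant term of the entry, and
        elements of the ideal of the variables have none.\<close>
      have "deg (Suc i) q - deg i p = 0" by (intro poly_mapping_eqI) (simp add: lookup_minus eq)
      thus False using D pq lookup_zero_ideal_span_vars[OF min[OF pq]] by (simp add: D_def)
    qed
    show "graded_resolution (lookup ` exponents n) (ideal_degrees n M) (\<lambda>i. {..<r i}) (\<lambda>i. degs (deg i)) D"
      unfolding graded_resolution_def f_def[symmetric]
    proof (intro conjI allI)
      show "\<exists>e. {..<r 0} = {e} \<and> (\<forall>\<alpha>\<in>lookup ` exponents n. f 0 e \<le> \<alpha>) \<and>
        (\<forall>\<alpha>\<in>lookup ` exponents n. (\<alpha> \<in> ideal_degrees n M) =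
           (\<exists>w. strand {..<r 1} (f 1) \<alpha> w \<and> (\<Sum>q<r 1. D 0 e q * w q) \<noteq> 0))"
      proof (intro exI[of _ 0] conjI ballI)
        show "{..<r 0} = {0}" using r0 by auto
        show "f 0 0 \<le> \<alpha>" for \<alpha> by (simp add: f_def deg0 le_fun_def)
        fix \<beta> assume "\<beta> \<in> lookup ` exponents n"
        then obtain \<alpha> where \<alpha>: "\<beta> = lookup \<alpha>" "\<alpha> \<in> exponents n" by blast
        have c0: "component (deg 0) (r 0) \<alpha> v 0 = lookup (v $ 0) \<alpha>" for v :: "'a mpoly vec"
          by (simp add: component_def deg0 r0 le_fun_def)
        show "(\<beta> \<in> ideal_degrees n M) =
           (\<exists>w. strand {..<r 1} (f 1) \<beta> w \<and> (\<Sum>q<r 1. D 0 0 q * w q) \<noteq> 0)"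
        proof
          assume "\<beta> \<in> ideal_degrees n M"
          hence "Poly_Mapping.single \<alpha> 1 \<in> M" using \<alpha> ideal_degrees_iff by blast
          then obtain v where v: "v \<in> free_module n (r 1)" "(d 1 *\<^sub>v v) $ 0 = Poly_Mapping.single \<alpha> 1"
            using head by force
          have "(\<Sum>q<r 1. D 0 0 q * component (deg 1) (r 1) \<alpha> v q) = 1"
            using fun_cong[OF cm[of v 0 \<alpha>], of 0] c0[of "d 1 *\<^sub>v v"] v fmc by simp
          thus "\<exists>w. strand {..<r 1} (f 1) \<beta> w \<and> (\<Sum>q<r 1. D 0 0 q * w q) \<noteq> 0"
            using strand_component[of "r 1" "deg 1" \<alpha> v]
            by (intro exI[of _ "component (deg 1) (r 1) \<alpha> v"]) (simp add: f_def \<alpha>)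
        next
          assume "\<exists>w. strand {..<r 1} (f 1) \<beta> w \<and> (\<Sum>q<r 1. D 0 0 q * w q) \<noteq> 0"
          then obtain w where w: "strand {..<r 1} (f 1) \<beta> w" "(\<Sum>q<r 1. D 0 0 q * w q) \<noteq> 0" by blast
          \<comment> \<open>Membership in M is tested on monomials with coefficient 1, so the
            nonzero value s is normalised.\<close>
          define s where "s = (\<Sum>q<r 1. D 0 0 q * w q)"
          define u where "u = (\<lambda>q. w q / s)"
          have u: "strand {..<r 1} (degs (deg 1)) (lookup \<alpha>) u" "(\<Sum>q<r 1. D 0 0 q * u q) = 1"
            using w by (auto simp: u_def strand_def f_def \<alpha> sum_divide_distrib[symmetric] s_def)
          define v where "v = homogeneous_vec (deg 1) (r 1) \<alpha> u"
          have cv: "component (deg 1) (r 1) \<gamma> v = (if \<gamma> = \<alpha> then u else (\<lambda>_. 0))" for \<gamma>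
            unfolding v_def by (rule component_homogeneous_vec[OF u(1)])
          have "(d 1 *\<^sub>v v) $ 0 = Poly_Mapping.single \<alpha> 1"
          proof (rule poly_mapping_eqI)
            fix \<gamma>
            have "lookup ((d 1 *\<^sub>v v) $ 0) \<gamma> = component (deg 0) (r 0) \<gamma> (d 1 *\<^sub>v v) 0"
              by (simp add: component_def deg0 r0 le_fun_def)
            also have "\<dots> = (\<Sum>q<r 1. D 0 0 q * component (deg 1) (r 1) \<gamma> v q)"
              using fun_cong[OF cm[of v 0 \<gamma>], of 0] hvc by (simp add: v_def)
            also have "\<dots> = lookup (Poly_Mapping.single \<alpha> 1) \<gamma>"
              unfolding cv using u(2) by (auto simp: lookup_single when_def)
            finally show "lookup ((d 1 *\<^sub>v v) $ 0) \<gamma> = lookup (Poly_Mapping.single \<alpha> 1) \<gamma>" .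
          qed
          moreover have "v \<in> free_module n (r 1)"
            unfolding v_def by (rule homogeneous_vec_free_module[OF \<alpha>(2)])
          ultimately have "Poly_Mapping.single \<alpha> 1 \<in> M" using head by force
          thus "\<beta> \<in> ideal_degrees n M" using \<alpha> ideal_degrees_iff by blast
        qed
      qed
      fix i
      show "finite {..<r i}" by simp
      show "f i ` {..<r i} \<subseteq> lookup ` exponents n" using deg by (auto simp: f_def)
      show "gmat {..<r i} (f i) {..<r (Suc i)} (f (Suc i)) (D i)" by (rule gm)
      show "mmul {..<r (Suc i)} (D i) (D (Suc i)) = (\<lambda>_ _. 0)"
      proof (intro ext)
        fix p z
        show "mmul {..<r (Suc i)} (D i) (D (Suc i)) p z = 0"
        proof (cases "z < r (Suc (Suc i))")
          case False
          thus ?thesis using gmatD[OF gm[of "Suc i"]] unfolding mmul_def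
            by (intro sum.neutral) (auto simp: D_def)
        next
          case True
          define \<alpha> where "\<alpha> = deg (Suc (Suc i)) z"
          \<comment> \<open>Column z of the product D D is read off from the two differentials
            applied to basis vector z, which is homogeneous of degree \<alpha>.\<close>
          define c where "c = (\<lambda>q. if q = z then 1 else 0 :: 'a)"
          have c: "strand {..<r (Suc (Suc i))} (degs (deg (Suc (Suc i)))) (lookup \<alpha>) c"
            using True by (auto simp: strand_def c_def \<alpha>_def)
          define v where "v = homogeneous_vec (deg (Suc (Suc i))) (r (Suc (Suc i))) \<alpha> c"
          have "v \<in> free_module n (r (Suc (Suc i)))"
            unfolding v_def \<alpha>_def by (rule homogeneous_vec_free_module[OF deg[OF True]])
          hence "d (Suc i) *\<^sub>v (d (Suc (Suc i)) *\<^sub>v v) = 0\<^sub>v (r i)" using exact[of i] by blast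
          hence "0 = component (deg i) (r i) \<alpha> (d (Suc i) *\<^sub>v (d (Suc (Suc i)) *\<^sub>v v)) p"
            using comp0 by simp
          also have "\<dots> = (\<Sum>q<r (Suc i). D i p q * (\<Sum>y<r (Suc (Suc i)). D (Suc i) q y * c y))"
            using hvc[of "deg (Suc (Suc i))" "r (Suc (Suc i))" \<alpha> c] dcar[of "Suc i" v]
            by (simp add: cm v_def component_homogeneous_vec[OF c])
          also have "\<dots> = mmul {..<r (Suc i)} (D i) (D (Suc i)) p z"
            using True by (simp add: c_def mmul_def if_distrib[of "(*) _"] cong: if_cong)
          finally show ?thesis by simp
        qed
      qed
      show "\<forall>\<alpha>\<in>lookup ` exponents n. \<forall>c. strand {..<r (Suc i)} (f (Suc i)) \<alpha> c \<and>
          (\<forall>p. (\<Sum>q<r (Suc i). D i p q * c q) = 0) \<longrightarrow>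
          (\<exists>w. strand {..<r (Suc (Suc i))} (f (Suc (Suc i))) \<alpha> w \<and>
             (\<forall>p. (\<Sum>q<r (Suc (Suc i)). D (Suc i) p q * w q) = c p))"
      proof (intro ballI allI impI)
        fix \<beta> c
        assume "\<beta> \<in> lookup ` exponents n"
          and c: "strand {..<r (Suc i)} (f (Suc i)) \<beta> c \<and> (\<forall>p. (\<Sum>q<r (Suc i). D i p q * c q) = 0)"
        then obtain \<alpha> where \<alpha>: "\<beta> = lookup \<alpha>" "\<alpha> \<in> exponents n" by blast
        have sc: "strand {..<r (Suc i)} (degs (deg (Suc i))) (lookup \<alpha>) c"
          using c \<alpha> by (simp add: f_def)
        \<comment> \<open>The scalar cycle c becomes a polynomial cycle concentrated in degree
          \<alpha>. The degree \<alpha> component of any polynomial preimage is then a scalar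
          preimage of c.\<close>
        define v where "v = homogeneous_vec (deg (Suc i)) (r (Suc i)) \<alpha> c"
        have cv: "component (deg (Suc i)) (r (Suc i)) \<gamma> v = (if \<gamma> = \<alpha> then c else (\<lambda>_. 0))" for \<gamma>
          unfolding v_def by (rule component_homogeneous_vec[OF sc])
        have "d (Suc i) *\<^sub>v v = 0\<^sub>v (r i)"
        proof (rule component_eqI[OF dcar zero_carrier_vec])
          fix \<gamma>
          show "component (deg i) (r i) \<gamma> (d (Suc i) *\<^sub>v v) = component (deg i) (r i) \<gamma> (0\<^sub>v (r i))"
            using c hvc by (auto simp: cm v_def comp0 cv[unfolded v_def])
        qed
        moreover have "v \<in> free_module n (r (Suc i))"
          unfolding v_def by (rule homogeneous_vec_free_module[OF \<alpha>(2)])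
        ultimately obtain w where w: "w \<in> free_module n (r (Suc (Suc i)))" "v = d (Suc (Suc i)) *\<^sub>v w"
          using exact[of i] by blast
        have "(\<Sum>q<r (Suc (Suc i)). D (Suc i) p q * component (deg (Suc (Suc i))) (r (Suc (Suc i))) \<alpha> w q) = c p" for p
          using fun_cong[OF cm[OF fmc[OF w(1)], of \<alpha>], of p] cv[of \<alpha>] w(2) by simp
        thus "\<exists>w. strand {..<r (Suc (Suc i))} (f (Suc (Suc i))) \<beta> w \<and>
             (\<forall>p. (\<Sum>q<r (Suc (Suc i)). D (Suc i) p q * w q) = c p)"
          using strand_component[of "r (Suc (Suc i))" "deg (Suc (Suc i))" \<alpha> w]
          by (intro exI[of _ "component (deg (Suc (Suc i))) (r (Suc (Suc i))) \<alpha> w"]) (simp add: f_def \<alpha>)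
      qed
    qed
  qed
qed

section \<open>Existence of squarefree minimal resolutions\<close>

text \<open>Finite dimensionality by elimination of one coordinate: the vectors of V vanishing at x
  are spanned by induction, and one vector v that does not vanish there accounts for the
  rest.\<close>

lemma finite_spanning_subset:
  fixes V :: "('x \<Rightarrow> 'a::field) set"
  assumes "finite X" "\<And>c p. c \<in> V \<Longrightarrow> c p \<noteq> 0 \<Longrightarrow> p \<in> X"
    and "\<And>c d a. c \<in> V \<Longrightarrow> d \<in> V \<Longrightarrow> (\<lambda>p. c p + a * d p) \<in> V"
  shows "\<exists>S\<subseteq>V. finite S \<and> (\<forall>c\<in>V. \<exists>w. \<forall>p. c p = (\<Sum>s\<in>S. w s * s p))"
  using assms
proof (induction X arbitrary: V rule: finite_induct)
  case empty
  have "\<forall>c\<in>V. \<exists>w. \<forall>p. c p = (\<Sum>s\<in>{}. w s * s p)" using empty.prems(1) by fastforce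
  thus ?case by (intro exI[of _ "{}"]) auto
next
  case (insert x X)
  define V0 where "V0 = {c \<in> V. c x = 0}"
  have "\<exists>S\<subseteq>V0. finite S \<and> (\<forall>c\<in>V0. \<exists>w. \<forall>p. c p = (\<Sum>s\<in>S. w s * s p))"
  proof (rule insert.IH)
    show "p \<in> X" if "c \<in> V0" "c p \<noteq> 0" for c p
      using insert.prems(1)[of c p] that by (auto simp: V0_def)
    show "(\<lambda>p. c p + a * d p) \<in> V0" if "c \<in> V0" "d \<in> V0" for c d a
      using insert.prems(2) that by (auto simp: V0_def)
  qed
  then obtain S where S: "S \<subseteq> V0" "finite S" "\<And>c. c \<in> V0 \<Longrightarrow> \<exists>w. \<forall>p. c p = (\<Sum>s\<in>S. w s * s p)"
    by metis
  show ?case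
  proof (cases "V = V0")
    case True
    thus ?thesis using S by blast
  next
    case False
    then obtain v where v: "v \<in> V" "v x \<noteq> 0" by (auto simp: V0_def)
    hence vS: "v \<notin> S" using S(1) by (auto simp: V0_def)
    have "\<exists>w. \<forall>p. c p = (\<Sum>s\<in>insert v S. w s * s p)" if c: "c \<in> V" for c
    proof -
      \<comment> \<open>Subtracting t times v makes the coordinate x vanish, so that the spanning
        set S of V0 applies.\<close>
      define t where "t = c x / v x"
      have "(\<lambda>p. c p + (- t) * v p) \<in> V0"
        using insert.prems(2)[OF c v(1), of "- t"] v(2) by (simp add: V0_def t_def)
      then obtain w where w: "\<And>p. c p + (- t) * v p = (\<Sum>s\<in>S. w s * s p)" using S(3) by blast
      have "c p = (\<Sum>s\<in>insert v S. (w(v := t)) s * s p)" for p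
      proof -
        have "(\<Sum>s\<in>S. (w(v := t)) s * s p) = (\<Sum>s\<in>S. w s * s p)"
          using vS by (intro sum.cong) auto
        thus ?thesis using vS S(2) w[of p] by (simp add: algebra_simps)
      qed
      thus ?thesis by blast
    qed
    moreover have "insert v S \<subseteq> V" using S(1) v(1) by (auto simp: V0_def)
    ultimately show ?thesis using S(2) by (intro exI[of _ "insert v S"]) blast
  qed
qed

text \<open>\<open>V \<sigma>\<close> stands for the component of squarefree degree \<open>\<sigma>\<close> of a module, and an element of \<open>G\<close> is
  a generator together with its degree.\<close>

definition generates ::
    "nat \<Rightarrow> (nat set \<Rightarrow> (nat \<Rightarrow> 'a::field) set) \<Rightarrow> (nat set \<times> (nat \<Rightarrow> 'a)) set \<Rightarrow> bool"
  where "generates n V G \<longleftrightarrow> finite G \<and> (\<forall>g\<in>G. fst g \<subseteq> {1..n} \<and> snd g \<in> V (fst g)) \<and>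
    (\<forall>\<sigma>\<subseteq>{1..n}. \<forall>c\<in>V \<sigma>. \<exists>w. strand G fst \<sigma> w \<and> (\<forall>p. c p = (\<Sum>g\<in>G. w g * snd g p)))"

text \<open>There are finitely many squarefree degrees, and each component has a finite spanning
  set. Their disjoint union works; tagging with the degree keeps apart equal vectors chosen in
  different degrees.\<close>

lemma generating_set_exists:
  fixes V :: "nat set \<Rightarrow> (nat \<Rightarrow> 'a::field) set"
  assumes "finite X" "\<And>\<sigma> c p. c \<in> V \<sigma> \<Longrightarrow> c p \<noteq> 0 \<Longrightarrow> p \<in> X"
    and "\<And>\<sigma> c d a. c \<in> V \<sigma> \<Longrightarrow> d \<in> V \<sigma> \<Longrightarrow> (\<lambda>p. c p + a * d p) \<in> V \<sigma>"
  shows "\<exists>G. generates n V G"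
proof -
  have "\<forall>\<sigma>. \<exists>S. S \<subseteq> V \<sigma> \<and> finite S \<and> (\<forall>c\<in>V \<sigma>. \<exists>w. \<forall>p. c p = (\<Sum>s\<in>S. w s * s p))"
  proof
    fix \<sigma>
    show "\<exists>S. S \<subseteq> V \<sigma> \<and> finite S \<and> (\<forall>c\<in>V \<sigma>. \<exists>w. \<forall>p. c p = (\<Sum>s\<in>S. w s * s p))"
      by (rule finite_spanning_subset[OF assms(1)]) (fact assms(2), fact assms(3))
  qed
  from choice[OF this] obtain S where S: "\<And>\<sigma>. S \<sigma> \<subseteq> V \<sigma>" "\<And>\<sigma>. finite (S \<sigma>)"
    "\<And>\<sigma> c. c \<in> V \<sigma> \<Longrightarrow> \<exists>w. \<forall>p. c p = (\<Sum>s\<in>S \<sigma>. w s * s p)" by blast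
  define G where "G = Sigma (Pow {1..n}) S"
  have finG: "finite G" unfolding G_def by (intro finite_SigmaI S(2)) simp
  have "\<exists>w. strand G fst \<sigma> w \<and> (\<forall>p. c p = (\<Sum>g\<in>G. w g * snd g p))"
    if \<sigma>: "\<sigma> \<subseteq> {1..n}" and c: "c \<in> V \<sigma>" for \<sigma> c
  proof -
    obtain w where w: "\<And>p. c p = (\<Sum>s\<in>S \<sigma>. w s * s p)" using S(3)[OF c] by blast
    define u where "u = (\<lambda>g. if g \<in> Pair \<sigma> ` S \<sigma> then w (snd g) else 0)"
    have sub: "Pair \<sigma> ` S \<sigma> \<subseteq> G" using \<sigma> by (auto simp: G_def)
    have "(\<Sum>g\<in>G. u g * snd g p) = c p" for p
    proof -
      have "(\<Sum>g\<in>G. u g * snd g p) = (\<Sum>g\<in>Pair \<sigma> ` S \<sigma>. u g * snd g p)"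
        by (rule sum.mono_neutral_right[OF finG sub]) (simp add: u_def)
      also have "\<dots> = (\<Sum>s\<in>S \<sigma>. w s * s p)"
        by (subst sum.reindex) (auto simp: inj_on_def u_def)
      finally show ?thesis using w by simp
    qed
    moreover have "strand G fst \<sigma> u" using sub by (auto simp: strand_def u_def)
    ultimately show ?thesis by (intro exI[of _ u]) simp
  qed
  moreover have "fst g \<subseteq> {1..n} \<and> snd g \<in> V (fst g)" if "g \<in> G" for g
    using that subsetD[OF S(1)] by (auto simp: G_def)
  ultimately have "generates n V G" unfolding generates_def using finG by simp
  thus ?thesis by blast
qed

text \<open>A graded Nakayama argument: a relation of degree \<sigma> with a nonzero coefficient at
  a generator of degree exactly \<sigma> expresses that generator by others whose degrees lie in
  \<sigma>. It could then be dropped, against minimality of the cardinality.\<close>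

lemma minimum_generating_set_independent:
  fixes V :: "nat set \<Rightarrow> (nat \<Rightarrow> 'a::field) set"
  assumes G: "generates n V G" and least: "\<And>G'. generates n V G' \<Longrightarrow> card G \<le> card G'"
    and w: "strand G fst \<sigma> w" "\<And>p. (\<Sum>g\<in>G. w g * snd g p) = 0" and g0: "g0 \<in> G" "fst g0 = \<sigma>"
  shows "w g0 = 0"
proof (rule ccontr)
  assume nz: "w g0 \<noteq> 0"
  have finG: "finite G" using G by (simp add: generates_def)
  have "generates n V (G - {g0})"
    unfolding generates_def
  proof (intro conjI allI impI ballI)
    show "finite (G - {g0})" using finG by simp
    show "fst g \<subseteq> {1..n}" "snd g \<in> V (fst g)" if "g \<in> G - {g0}" for g
      using G that by (auto simp: generates_def)
    fix \<tau> c assume "\<tau> \<subseteq> {1..n}" "c \<in> V \<tau>"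
    then obtain u where u: "strand G fst \<tau> u" "\<And>p. c p = (\<Sum>g\<in>G. u g * snd g p)"
      using G unfolding generates_def by blast
    \<comment> \<open>The multiple of the relation is chosen to cancel g0. It is needed only when u
      g0 \<noteq> 0, and then \<sigma> \<subseteq> \<tau>, so the new coefficients stay in the
      strand of \<tau>.\<close>
    define u' where "u' = (\<lambda>g. u g - u g0 / w g0 * w g)"
    have u'0: "u' g0 = 0" using nz by (simp add: u'_def)
    have "strand (G - {g0}) fst \<tau> u'"
      unfolding strand_def
    proof (intro allI impI)
      fix g assume g: "u' g \<noteq> 0"
      hence "g \<noteq> g0" using u'0 by blast
      from g have "u g \<noteq> 0 \<or> (u g0 \<noteq> 0 \<and> w g \<noteq> 0)" by (auto simp: u'_def)
      thus "g \<in> G - {g0} \<and> fst g \<subseteq> \<tau>"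
      proof
        assume "u g \<noteq> 0"
        thus ?thesis using u(1) \<open>g \<noteq> g0\<close> unfolding strand_def by blast
      next
        assume "u g0 \<noteq> 0 \<and> w g \<noteq> 0"
        hence "fst g0 \<subseteq> \<tau>" "g \<in> G" "fst g \<subseteq> \<sigma>" using u(1) w(1) unfolding strand_def by blast+
        thus ?thesis using \<open>g \<noteq> g0\<close> g0(2) by auto
      qed
    qed
    moreover have "c p = (\<Sum>g\<in>G - {g0}. u' g * snd g p)" for p
    proof -
      have "(\<Sum>g\<in>G - {g0}. u' g * snd g p) = (\<Sum>g\<in>G. u' g * snd g p)"
        using finG u'0 by (intro sum.mono_neutral_left) auto
      also have "\<dots> = (\<Sum>g\<in>G. u g * snd g p) - u g0 / w g0 * (\<Sum>g\<in>G. w g * snd g p)"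
        by (simp add: u'_def algebra_simps sum_subtractf sum_distrib_left)
      also have "\<dots> = c p" using u(2)[of p] w(2)[of p] by simp
      finally show ?thesis by simp
    qed
    ultimately show "\<exists>w. strand (G - {g0}) fst \<tau> w \<and> (\<forall>p. c p = (\<Sum>g\<in>G - {g0}. w g * snd g p))"
      by blast
  qed
  hence "card G \<le> card (G - {g0})" by (rule least)
  thus False using card_Diff1_less[OF finG g0(1)] by simp
qed

text \<open>One step of the resolution. The columns of A' enumerate a generating set of least
  cardinality for the kernels of A in all squarefree degrees. The last conclusion is the
  independence of these generators, phrased so that it can be applied to the columns of the
  following map.\<close>

lemma minimal_syzygies_exist:
  fixes n b :: nat and L :: "nat \<Rightarrow> nat set" and A :: "nat \<Rightarrow> nat \<Rightarrow> 'a::field"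
  obtains b' L' A' where
    "\<And>q. q < b' \<Longrightarrow> L' q \<subseteq> {1..n}"
    "gmat {..<b} L {..<b'} L' (A' :: nat \<Rightarrow> nat \<Rightarrow> 'a)"
    "mmul {..<b} A A' = (\<lambda>_ _. 0)"
    "\<And>\<sigma> c. \<sigma> \<subseteq> {1..n} \<Longrightarrow> strand {..<b} L \<sigma> c \<Longrightarrow> \<forall>p. (\<Sum>q<b. A p q * c q) = 0 \<Longrightarrow>
       \<exists>w. strand {..<b'} L' \<sigma> w \<and> (\<forall>p. (\<Sum>q<b'. A' p q * w q) = c p)"
    "\<And>\<sigma> c q. strand {..<b'} L' \<sigma> c \<Longrightarrow> \<forall>p. (\<Sum>q<b'. A' p q * c q) = 0 \<Longrightarrow> q < b' \<Longrightarrow> L' q = \<sigma> \<Longrightarrow> c q = 0"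
proof -
  define V where "V = (\<lambda>\<sigma>. {c. strand {..<b} L \<sigma> c \<and> (\<forall>p. (\<Sum>q<b. A p q * c q) = 0)})"
  have "\<exists>G. generates n V G"
  proof (rule generating_set_exists[of "{..<b}"])
    show "(\<lambda>p. c p + a * d p) \<in> V \<sigma>" if cd: "c \<in> V \<sigma>" "d \<in> V \<sigma>" for \<sigma> c d a
    proof -
      have "(\<Sum>q<b. A p q * (c q + a * d q)) = (\<Sum>q<b. A p q * c q) + a * (\<Sum>q<b. A p q * d q)" for p
        by (simp add: algebra_simps sum.distrib sum_distrib_left)
      thus ?thesis using cd unfolding V_def strand_def
        by simp (metis add.left_neutral mult_zero_right)
    qed
  qed (auto simp: V_def strand_def)
  then obtain G where G: "generates n V G" and least: "\<And>G'. generates n V G' \<Longrightarrow> card G \<le> card G'"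
    using ex_has_least_nat[of "generates n V" _ card] by metis
  have finG: "finite G" using G by (simp add: generates_def)
  define b' where "b' = card G"
  obtain e where e: "bij_betw e {..<b'} G"
    using ex_bij_betw_nat_finite[OF finG] by (auto simp: b'_def atLeast0LessThan)
  have eG: "q < b' \<Longrightarrow> e q \<in> G" for q using e by (auto simp: bij_betw_def)
  define L' where "L' = (\<lambda>q. fst (e q))"
  define A' where "A' = (\<lambda>p q. if q < b' then snd (e q) p else 0)"
  have eV: "q < b' \<Longrightarrow> snd (e q) \<in> V (L' q)" for q
    using G eG by (auto simp: generates_def L'_def)
  have reindex: "(\<Sum>q<b'. A' p q * w (e q)) = (\<Sum>g\<in>G. w g * snd g p)" for w p
  proof -
    have "(\<Sum>q<b'. A' p q * w (e q)) = (\<Sum>q<b'. w (e q) * snd (e q) p)"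
      by (rule sum.cong) (auto simp: A'_def mult.commute)
    also have "\<dots> = (\<Sum>g\<in>G. w g * snd g p)" by (rule sum.reindex_bij_betw[OF e])
    finally show ?thesis .
  qed
  show thesis
  proof (rule that[of b' L' A'])
    show "L' q \<subseteq> {1..n}" if "q < b'" for q
      using G eG[OF that] by (auto simp: generates_def L'_def)
    show "gmat {..<b} L {..<b'} L' A'"
      unfolding gmat_def using eV by (auto simp: A'_def V_def strand_def)
    show "mmul {..<b} A A' = (\<lambda>_ _. 0)"
    proof (intro ext)
      show "mmul {..<b} A A' p q = 0" for p q
        using eV[of q] by (cases "q < b'") (auto simp: mmul_def A'_def V_def)
    qed
  next
    fix \<sigma> c assume "\<sigma> \<subseteq> {1..n}" "strand {..<b} L \<sigma> c" "\<forall>p. (\<Sum>q<b. A p q * c q) = 0"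
    hence "c \<in> V \<sigma>" by (simp add: V_def)
    then obtain w where w: "strand G fst \<sigma> w" "\<And>p. c p = (\<Sum>g\<in>G. w g * snd g p)"
      using G \<open>\<sigma> \<subseteq> {1..n}\<close> unfolding generates_def by blast
    define u where "u = (\<lambda>q. if q < b' then w (e q) else 0)"
    have "(\<Sum>q<b'. A' p q * u q) = (\<Sum>q<b'. A' p q * w (e q))" for p
      by (rule sum.cong) (auto simp: u_def)
    moreover have "strand {..<b'} L' \<sigma> u" using w(1) unfolding strand_def u_def L'_def by (metis lessThan_iff)
    ultimately show "\<exists>w. strand {..<b'} L' \<sigma> w \<and> (\<forall>p. (\<Sum>q<b'. A' p q * w q) = c p)"
      using w(2) reindex by (intro exI[of _ u]) simp
  next
    fix \<sigma> c q
    assume c: "strand {..<b'} L' \<sigma> c" "\<forall>p. (\<Sum>q<b'. A' p q * c q) = 0" and q: "q < b'" "L' q = \<sigma>"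
    define i where "i = inv_into {..<b'} e"
    have ie: "i (e x) = x" if "x < b'" for x
      using e that by (auto simp: i_def bij_betw_def)
    have ei: "e (i g) = g" "i g < b'" if "g \<in> G" for g
      using e that f_inv_into_f[of g e "{..<b'}"] inv_into_into[of g e "{..<b'}"]
      by (auto simp: i_def bij_betw_def)
    define w where "w = (\<lambda>g. if g \<in> G then c (i g) else 0)"
    have "w (e q) = 0"
    proof (rule minimum_generating_set_independent[OF G least _ _ eG[OF q(1)]])
      show "strand G fst \<sigma> w"
        using c(1) ei(1) unfolding strand_def w_def L'_def by metis
      have "(\<Sum>q<b'. A' p q * w (e q)) = (\<Sum>q<b'. A' p q * c q)" for p
        by (rule sum.cong) (auto simp: w_def eG ie)
      thus "(\<Sum>g\<in>G. w g * snd g p) = 0" for p using reindex[of p w] c(2) by simp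
      show "fst (e q) = \<sigma>" using q(2) by (simp add: L'_def)
    qed
    thus "c q = 0" using q(1) by (simp add: w_def eG ie)
  qed
qed

text \<open>Minimal syzygies are iterated by dependent choice from the row of ones that maps the N
  generators to the ring. The antichain condition says that the generators are minimal, which makes
  the recursion start correctly.\<close>

lemma squarefree_resolution_exists:
  fixes N n :: nat and L1 :: "nat \<Rightarrow> nat set"
  assumes L1: "\<And>q. q < N \<Longrightarrow> L1 q \<subseteq> {1..n}" "\<And>q. q < N \<Longrightarrow> L1 q \<noteq> {}"
    and antichain: "\<And>q q'. q < N \<Longrightarrow> q' < N \<Longrightarrow> L1 q' \<subseteq> L1 q \<Longrightarrow> q' = q"
  obtains r L and D :: "nat \<Rightarrow> nat \<Rightarrow> nat \<Rightarrow> 'a::field" where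
    "r 0 = 1" "L 0 = (\<lambda>_. {})" "r 1 = N" "L 1 = L1" "\<And>q. q < N \<Longrightarrow> D 0 0 q = 1"
    "\<And>i q. q < r i \<Longrightarrow> L i q \<subseteq> {1..n}"
    "\<And>i. gmat {..<r i} (L i) {..<r (Suc i)} (L (Suc i)) (D i)"
    "\<And>i. mmul {..<r (Suc i)} (D i) (D (Suc i)) = (\<lambda>_ _. 0)"
    "\<And>i \<sigma> c. \<sigma> \<subseteq> {1..n} \<Longrightarrow> strand {..<r (Suc i)} (L (Suc i)) \<sigma> c \<Longrightarrow>
       \<forall>p. (\<Sum>q<r (Suc i). D i p q * c q) = 0 \<Longrightarrow>
       \<exists>w. strand {..<r (Suc (Suc i))} (L (Suc (Suc i))) \<sigma> w \<and> (\<forall>p. (\<Sum>q<r (Suc (Suc i)). D (Suc i) p q * w q) = c p)"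
    "\<And>i. minimal_at L D i"
proof -
  \<comment> \<open>A state consists of two consecutive modules and the map between them. The clause
    on cycles says that no cycle involves a generator of its own degree; for the columns of the next
    map this is the minimality of that map, which the last clause records.\<close>
  define ok where "ok = (\<lambda>(b :: nat, L :: nat \<Rightarrow> nat set, b' :: nat, L' :: nat \<Rightarrow> nat set, A :: nat \<Rightarrow> nat \<Rightarrow> 'a).
    (\<forall>q<b. L q \<subseteq> {1..n}) \<and> (\<forall>q<b'. L' q \<subseteq> {1..n}) \<and> gmat {..<b} L {..<b'} L' A \<and>
    (\<forall>\<sigma> c q. strand {..<b'} L' \<sigma> c \<longrightarrow> (\<forall>p. (\<Sum>q<b'. A p q * c q) = 0) \<longrightarrow> q < b' \<longrightarrow> L' q = \<sigma> \<longrightarrow> c q = 0) \<and>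
    (\<forall>p q. A p q \<noteq> 0 \<longrightarrow> L p \<noteq> L' q))"
  define next_step where "next_step = (\<lambda>(b :: nat, L :: nat \<Rightarrow> nat set, b' :: nat, L' :: nat \<Rightarrow> nat set, A :: nat \<Rightarrow> nat \<Rightarrow> 'a)
      (c :: nat, K :: nat \<Rightarrow> nat set, c' :: nat, K' :: nat \<Rightarrow> nat set, A' :: nat \<Rightarrow> nat \<Rightarrow> 'a).
    c = b' \<and> K = L' \<and> mmul {..<b'} A A' = (\<lambda>_ _. 0) \<and>
    (\<forall>\<sigma> x. \<sigma> \<subseteq> {1..n} \<longrightarrow> strand {..<b' :: nat} L' \<sigma> x \<longrightarrow> (\<forall>p. (\<Sum>q<b'. A p q * x q) = 0) \<longrightarrow>
       (\<exists>w. strand {..<c' :: nat} K' \<sigma> w \<and> (\<forall>p. (\<Sum>q<c'. A' p q * w q) = x p))))"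
  define s0 where "s0 = (1 :: nat, \<lambda>_ :: nat. {} :: nat set, N, L1, \<lambda>(p :: nat) (q :: nat). if p = 0 \<and> q < N then 1 else 0 :: 'a)"
  have "\<exists>s. \<forall>i. (ok (s i) \<and> (i = 0 \<longrightarrow> s i = s0)) \<and> next_step (s i) (s (Suc i))"
  proof (rule dependent_nat_choice)
    \<comment> \<open>In degree \<open>L1 q\<close> the antichain leaves q as the only generator, so
      the sum that must vanish is c q.\<close>
    have "c q = 0" if c: "strand {..<N} L1 \<sigma> c" "(\<Sum>q<N. c q) = 0"
      and q: "q < N" "L1 q = \<sigma>" for \<sigma> q and c :: "nat \<Rightarrow> 'a"
    proof -
      have "c q' = 0" if "q' \<noteq> q" for q'
        using c(1) q antichain[of q q'] that by (auto simp: strand_def)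
      hence "(\<Sum>q'<N. c q') = (\<Sum>q'\<in>{q}. c q')" using q by (intro sum.mono_neutral_right) auto
      thus ?thesis using c(2) by simp
    qed
    moreover have "(\<Sum>q<N. (if q < N then 1 else 0) * c q) = (\<Sum>q<N. c q)" for c :: "nat \<Rightarrow> 'a"
      by (rule sum.cong) auto
    ultimately have "ok s0" using L1(1) L1(2)[THEN not_sym] unfolding ok_def s0_def by (auto simp: gmat_def)
    thus "\<exists>s. ok s \<and> (0 = 0 \<longrightarrow> s = s0)" by blast
  next
    fix s and i :: nat assume s: "ok s \<and> (i = 0 \<longrightarrow> s = s0)"
    obtain b L b' L' A where sd: "s = (b, L, b', L', A)" by (metis prod_cases5)
    obtain c' K' A' where K: "\<And>q. q < c' \<Longrightarrow> K' q \<subseteq> {1..n}"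
      "gmat {..<b'} L' {..<c'} K' (A' :: nat \<Rightarrow> nat \<Rightarrow> 'a)"
      "mmul {..<b'} A A' = (\<lambda>_ _. 0)"
      "\<And>\<sigma> c. \<sigma> \<subseteq> {1..n} \<Longrightarrow> strand {..<b'} L' \<sigma> c \<Longrightarrow> \<forall>p. (\<Sum>q<b'. A p q * c q) = 0 \<Longrightarrow>
         \<exists>w. strand {..<c'} K' \<sigma> w \<and> (\<forall>p. (\<Sum>q<c'. A' p q * w q) = c p)"
      "\<And>\<sigma> c q. strand {..<c'} K' \<sigma> c \<Longrightarrow> \<forall>p. (\<Sum>q<c'. A' p q * c q) = 0 \<Longrightarrow> q < c' \<Longrightarrow> K' q = \<sigma> \<Longrightarrow> c q = 0"
      by (rule minimal_syzygies_exist[where b = b' and L = L' and A = A and n = n]) (rule that)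
    have "L' p \<noteq> K' q" if pq: "A' p q \<noteq> 0" for p q
    proof
      assume eq: "L' p = K' q"
      have "p < b'" using gmatD[OF K(2) pq] by simp
      have "strand {..<b'} L' (K' q) (\<lambda>p. A' p q)" using K(2) by (auto simp: strand_def gmat_def)
      moreover have "(\<Sum>y<b'. A x y * A' y q) = 0" for x
        using fun_cong[OF fun_cong[OF K(3)], of x q] by (simp add: mmul_def)
      moreover have "\<forall>\<sigma> c q. strand {..<b'} L' \<sigma> c \<longrightarrow> (\<forall>p. (\<Sum>q<b'. A p q * c q) = 0) \<longrightarrow>
          q < b' \<longrightarrow> L' q = \<sigma> \<longrightarrow> c q = 0"
        using s unfolding ok_def sd prod.case by (elim conjE)
      ultimately have "A' p q = 0"
        using \<open>p < b'\<close> eq by (elim allE[of _ "K' q"] allE[of _ "\<lambda>p. A' p q"] allE[of _ p]) simp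
      thus False using pq by simp
    qed
    hence "ok (b', L', c', K', A')" using s K(1,2,5) unfolding ok_def sd by auto
    moreover have "next_step s (b', L', c', K', A')" using K(3,4) unfolding next_step_def sd by auto
    ultimately show "\<exists>y. (ok y \<and> (Suc i = 0 \<longrightarrow> y = s0)) \<and> next_step s y" by blast
  qed
  then obtain s where s: "\<And>i. ok (s i)" "s 0 = s0" "\<And>i. next_step (s i) (s (Suc i))" by blast
  define r where "r = (\<lambda>i. fst (s i))"
  define L where "L = (\<lambda>i. fst (snd (s i)))"
  define D where "D = (\<lambda>i. snd (snd (snd (snd (s i)))))"
  have sd: "s i = (r i, L i, r (Suc i), L (Suc i), D i)" for i
    using s(3)[of i] by (cases "s i"; cases "s (Suc i)") (auto simp: next_step_def r_def L_def D_def)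
  note ok = s(1)[unfolded sd ok_def prod.case]
  note nx = s(3)[unfolded sd next_step_def prod.case]
  show thesis
  proof (rule that[of r L D])
    show "r 0 = 1" "L 0 = (\<lambda>_. {})" "r 1 = N" "L 1 = L1"
      using s(2) sd[of 0] by (auto simp: s0_def)
    have "D 0 = (\<lambda>p q. if p = 0 \<and> q < N then 1 else 0)"
      using s(2) sd[of 0] by (simp add: s0_def)
    thus "q < N \<Longrightarrow> D 0 0 q = 1" for q by simp
    show "L i q \<subseteq> {1..n}" if "q < r i" for i q using ok[of i] that by blast
    show "gmat {..<r i} (L i) {..<r (Suc i)} (L (Suc i)) (D i)" for i using ok[of i] by blast
    show "mmul {..<r (Suc i)} (D i) (D (Suc i)) = (\<lambda>_ _. 0)" for i using nx[of i] by blast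
    show "\<exists>w. strand {..<r (Suc (Suc i))} (L (Suc (Suc i))) \<sigma> w \<and>
        (\<forall>p. (\<Sum>q<r (Suc (Suc i)). D (Suc i) p q * w q) = c p)"
      if "\<sigma> \<subseteq> {1..n}" "strand {..<r (Suc i)} (L (Suc i)) \<sigma> c"
        "\<forall>p. (\<Sum>q<r (Suc i). D i p q * c q) = 0" for i \<sigma> c
      using nx[of i] that by blast
    show "minimal_at L D i" for i using ok[of i] unfolding minimal_at_def by blast
  qed
qed

section \<open>The Taylor resolution\<close>

definition subset_sign :: "nat set \<Rightarrow> nat \<Rightarrow> 'a::ring_1"
  where "subset_sign A j = (- 1) ^ card {l \<in> A. l < j}"

definition taylor_basis :: "nat \<Rightarrow> nat \<Rightarrow> nat set set"
  where "taylor_basis N i = {A. A \<subseteq> {..<N} \<and> card A = i}"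

text \<open>Up to the implicit monomials this is the boundary map of the full simplex on N vertices,
  written from the face A: a column C containing A and one more vertex j gets the sign of the
  position of j in C. At most one summand is nonzero.\<close>

definition taylor_diff :: "nat \<Rightarrow> nat \<Rightarrow> nat set \<Rightarrow> nat set \<Rightarrow> 'a::ring_1"
  where "taylor_diff N i A C = (if A \<in> taylor_basis N i
    then \<Sum>j\<in>{..<N} - A. if C = insert j A then subset_sign A j else 0 else 0)"

lemma subset_sign_nonzero: "subset_sign A j \<noteq> (0 :: 'a::field)"
  by (simp add: subset_sign_def)

lemma subset_sign_insert_less:
  assumes "finite A" "j \<notin> A" "j < l"
  shows "subset_sign (insert j A) l = - subset_sign A l"
proof -
  have "{x \<in> insert j A. x < l} = insert j {x \<in> A. x < l}" using assms by auto
  thus ?thesis using assms by (simp add: subset_sign_def)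
qed

lemma subset_sign_insert_greater: "j < l \<Longrightarrow> subset_sign (insert l A) j = subset_sign A j"
proof -
  assume "j < l"
  hence "{x \<in> insert l A. x < j} = {x \<in> A. x < j}" by auto
  thus ?thesis by (simp add: subset_sign_def)
qed

lemma subset_sign_below: "(\<And>l. l \<in> A \<Longrightarrow> j \<le> l) \<Longrightarrow> subset_sign A j = 1"
proof -
  assume "\<And>l. l \<in> A \<Longrightarrow> j \<le> l"
  hence below: "{l \<in> A. l < j} = {}" by force
  show ?thesis unfolding subset_sign_def below by simp
qed

lemma finite_taylor_basis: "finite (taylor_basis N i)"
  by (rule finite_subset[of _ "Pow {..<N}"]) (auto simp: taylor_basis_def)

lemma taylor_basis_finite: "A \<in> taylor_basis N i \<Longrightarrow> finite A"
  by (auto simp: taylor_basis_def intro: finite_subset)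

lemma taylor_basis_insert:
  "A \<in> taylor_basis N i \<Longrightarrow> j < N \<Longrightarrow> j \<notin> A \<Longrightarrow> insert j A \<in> taylor_basis N (Suc i)"
  using taylor_basis_finite[of A N i] by (auto simp: taylor_basis_def)

lemma taylor_diff_sum:
  assumes "A \<in> taylor_basis N i"
  shows "(\<Sum>C\<in>taylor_basis N (Suc i). taylor_diff N i A C * c C) =
    (\<Sum>j\<in>{..<N} - A. subset_sign A j * c (insert j A))"
proof -
  have "(\<Sum>C\<in>taylor_basis N (Suc i). taylor_diff N i A C * c C) =
      (\<Sum>C\<in>taylor_basis N (Suc i). \<Sum>j\<in>{..<N} - A. if C = insert j A then subset_sign A j * c C else 0)"
    using assms by (auto simp: taylor_diff_def sum_distrib_right intro!: sum.cong)
  also have "\<dots> = (\<Sum>j\<in>{..<N} - A. \<Sum>C\<in>taylor_basis N (Suc i). if C = insert j A then subset_sign A j * c C else 0)"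
    by (rule sum.swap)
  also have "\<dots> = (\<Sum>j\<in>{..<N} - A. subset_sign A j * c (insert j A))"
    using assms by (auto simp: finite_taylor_basis taylor_basis_insert intro!: sum.cong)
  finally show ?thesis .
qed

lemma taylor_diff_nonzero:
  assumes "taylor_diff N i A C \<noteq> 0"
  obtains j where "A \<in> taylor_basis N i" "j < N" "j \<notin> A" "C = insert j A"
proof -
  have A: "A \<in> taylor_basis N i" using assms by (auto simp: taylor_diff_def split: if_splits)
  hence "(\<Sum>j\<in>{..<N} - A. if C = insert j A then subset_sign A j else 0) \<noteq> (0 :: 'a)"
    using assms by (simp add: taylor_diff_def)
  then obtain j where "j \<in> {..<N} - A" "(if C = insert j A then subset_sign A j else 0) \<noteq> (0 :: 'a)"
    by (rule sum.not_neutral_contains_not_neutral)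
  thus thesis using that A by (auto split: if_splits)
qed

lemma taylor_diff_insert:
  assumes "A \<in> taylor_basis N i" "j < N" "j \<notin> A"
  shows "taylor_diff N i A (insert j A) = subset_sign A j"
proof -
  have "taylor_diff N i A (insert j A) =
      (\<Sum>l\<in>{..<N} - A. if l = j then subset_sign A j else 0)"
  proof -
    have "insert j A = insert l A \<longleftrightarrow> l = j" if "l \<notin> A" for l using that assms(3) by blast
    thus ?thesis using assms unfolding taylor_diff_def by (auto intro!: sum.cong)
  qed
  also have "\<dots> = subset_sign A j" using assms by simp
  finally show ?thesis .
qed

text \<open>The terms with l < j are matched with those with j < l by exchanging the sums.
  Cancelling in pairs, rather than showing that twice the sum is 0, makes the argument valid in
  characteristic 2.\<close>

lemma sum_antisymmetric:
  fixes h :: "nat \<Rightarrow> nat \<Rightarrow> 'a::ab_group_add"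
  assumes "finite J" "\<And>j l. j \<in> J \<Longrightarrow> l \<in> J \<Longrightarrow> j < l \<Longrightarrow> h l j = - h j l"
  shows "(\<Sum>j\<in>J. \<Sum>l\<in>J - {j}. h j l) = 0"
proof -
  have split: "(\<Sum>l\<in>J - {j}. h j l) = (\<Sum>l\<in>J. if j < l then h j l else 0) + (\<Sum>l\<in>J. if l < j then h j l else 0)" for j
  proof -
    have "(\<Sum>l\<in>J - {j}. h j l) = (\<Sum>l\<in>J - {j}. (if j < l then h j l else 0) + (if l < j then h j l else 0))"
      by (rule sum.cong) auto
    also have "\<dots> = (\<Sum>l\<in>J. (if j < l then h j l else 0) + (if l < j then h j l else 0))"
      by (rule sum.mono_neutral_left) (use assms(1) in auto)
    finally show ?thesis by (simp add: sum.distrib)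
  qed
  have "(\<Sum>j\<in>J. \<Sum>l\<in>J. if l < j then h j l else 0) = (\<Sum>l\<in>J. \<Sum>j\<in>J. if l < j then h j l else 0)"
    by (rule sum.swap)
  also have "\<dots> = (\<Sum>l\<in>J. \<Sum>j\<in>J. - (if l < j then h l j else 0))"
    using assms(2) by (intro sum.cong) auto
  finally have "(\<Sum>j\<in>J. \<Sum>l\<in>J. if l < j then h j l else 0) = - (\<Sum>j\<in>J. \<Sum>l\<in>J. if j < l then h j l else 0)"
    by (simp add: sum_negf)
  thus ?thesis by (simp add: split sum.distrib)
qed

text \<open>A set arises from A by adding j and l in either order. For j < l, inserting j first
  flips the sign of l, while inserting l first leaves the sign of j unchanged, so the two
  contributions cancel.\<close>

lemma taylor_complex:
  "mmul (taylor_basis N (Suc i)) (taylor_diff N i) (taylor_diff N (Suc i)) = (\<lambda>_ _. 0 :: 'a::field)"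
proof (intro ext)
  fix A C
  show "mmul (taylor_basis N (Suc i)) (taylor_diff N i) (taylor_diff N (Suc i)) A C = (0 :: 'a)"
  proof (cases "A \<in> taylor_basis N i")
    case False
    thus ?thesis by (simp add: mmul_def taylor_diff_def)
  next
    case True
    define h where "h = (\<lambda>j l. if C = insert l (insert j A)
      then subset_sign A j * subset_sign (insert j A) l else 0 :: 'a)"
    have "mmul (taylor_basis N (Suc i)) (taylor_diff N i) (taylor_diff N (Suc i)) A C =
        (\<Sum>j\<in>{..<N} - A. subset_sign A j * taylor_diff N (Suc i) (insert j A) C)"
      unfolding mmul_def by (rule taylor_diff_sum[OF True])
    also have "\<dots> = (\<Sum>j\<in>{..<N} - A. \<Sum>l\<in>({..<N} - A) - {j}. h j l)"
    proof (rule sum.cong)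
      fix j assume j: "j \<in> {..<N} - A"
      have "{..<N} - insert j A = ({..<N} - A) - {j}" by auto
      hence eq: "taylor_diff N (Suc i) (insert j A) C = (\<Sum>l\<in>({..<N} - A) - {j}.
          if C = insert l (insert j A) then subset_sign (insert j A) l else 0 :: 'a)"
        using taylor_basis_insert[OF True, of j] j by (simp add: taylor_diff_def)
      show "subset_sign A j * taylor_diff N (Suc i) (insert j A) C = (\<Sum>l\<in>({..<N} - A) - {j}. h j l)"
        unfolding eq sum_distrib_left by (rule sum.cong) (simp_all add: h_def)
    qed simp
    also have "\<dots> = 0"
    proof (rule sum_antisymmetric)
      show "h l j = - h j l" if "j \<in> {..<N} - A" "l \<in> {..<N} - A" "j < l" for j l
        using that subset_sign_insert_less[OF taylor_basis_finite[OF True], of j l, where 'a = 'a]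
          subset_sign_insert_greater[of j l A, where 'a = 'a]
        by (simp add: h_def insert_commute mult.commute)
    qed simp
    finally show ?thesis .
  qed
qed

text \<open>In each degree the Taylor complex is the augmented chain complex of a full simplex, and coning
  with its least vertex \<open>v\<close> is a contracting homotopy.\<close>

lemma taylor_exact:
  fixes c :: "nat set \<Rightarrow> 'a::field"
  assumes f: "\<And>A \<beta>. A \<subseteq> {..<N} \<Longrightarrow> f A \<le> \<beta> \<longleftrightarrow> (\<forall>j\<in>A. b j \<le> (\<beta> :: 'o::order))"
    and c: "strand (taylor_basis N (Suc i)) f \<alpha> c"
    and cycle: "\<And>A. (\<Sum>C\<in>taylor_basis N (Suc i). taylor_diff N i A C * c C) = 0"
  shows "\<exists>w. strand (taylor_basis N (Suc (Suc i))) f \<alpha> w \<and>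
    (\<forall>A. (\<Sum>C\<in>taylor_basis N (Suc (Suc i)). taylor_diff N (Suc i) A C * w C) = c A)"
proof -
  \<comment> \<open>The sets of degree at most \<alpha> are the subsets of S, so the strand of
    degree \<alpha> is the chain complex of the simplex on S.\<close>
  define S where "S = {j. j < N \<and> b j \<le> \<alpha>}"
  have finS: "finite S" by (simp add: S_def)
  have cS: "A \<in> taylor_basis N (Suc i) \<and> A \<subseteq> S" if "c A \<noteq> 0" for A
  proof -
    from that c have A: "A \<in> taylor_basis N (Suc i)" "f A \<le> \<alpha>" by (auto simp: strand_def)
    hence "A \<subseteq> {..<N}" by (simp add: taylor_basis_def)
    thus ?thesis using A f by (auto simp: S_def)
  qed
  show ?thesis
  proof (cases "S = {}")
    case True
    \<comment> \<open>Basis sets in homological degree \<open>Suc i\<close> are nonempty, so without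
      vertices there are no chains to lift.\<close>
    hence "c A = 0" for A using cS[of A] by (cases "c A = 0") (auto simp: taylor_basis_def)
    thus ?thesis by (intro exI[of _ "\<lambda>_. 0"]) (simp add: strand_def)
  next
    case False
    define v where "v = Min S"
    have v: "v \<in> S" "v < N" "\<And>j. j \<in> S \<Longrightarrow> v \<le> j"
      using Min_in[OF finS False] Min_le[OF finS] by (auto simp: v_def S_def)
    define w where "w = (\<lambda>A. if v \<in> A \<and> A \<in> taylor_basis N (Suc (Suc i)) then c (A - {v}) else 0)"
    have "strand (taylor_basis N (Suc (Suc i))) f \<alpha> w"
      unfolding strand_def
    proof (intro allI impI)
      fix A assume "w A \<noteq> 0"
      hence A: "v \<in> A" "A \<in> taylor_basis N (Suc (Suc i))" "c (A - {v}) \<noteq> 0"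
        by (auto simp: w_def split: if_splits)
      hence "A \<subseteq> S" using cS[of "A - {v}"] v(1) by auto
      moreover have "A \<subseteq> {..<N}" using A(2) by (simp add: taylor_basis_def)
      ultimately show "A \<in> taylor_basis N (Suc (Suc i)) \<and> f A \<le> \<alpha>" using A(2) f by (auto simp: S_def)
    qed
    moreover have "(\<Sum>C\<in>taylor_basis N (Suc (Suc i)). taylor_diff N (Suc i) A C * w C) = c A" for A
    proof (cases "A \<in> taylor_basis N (Suc i)")
      case False
      thus ?thesis using cS[of A] by (auto simp: taylor_diff_def)
    next
      case A: True
      have "(\<Sum>j\<in>{..<N} - A. subset_sign A j * w (insert j A)) = c A"
      proof (cases "v \<in> A")
        case False
        hence "(\<Sum>j\<in>{..<N} - A. subset_sign A j * w (insert j A)) =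
            (\<Sum>j\<in>{v}. subset_sign A j * w (insert j A))"
          using v(2) by (intro sum.mono_neutral_right) (auto simp: w_def)
        also have "\<dots> = subset_sign A v * c A"
          using False taylor_basis_insert[OF A v(2)] by (simp add: w_def)
        also have "\<dots> = c A"
          using cS[of A] subset_sign_below[of A v, where 'a = 'a] v(3) by (cases "c A = 0") auto
        finally show ?thesis .
      next
        case True
        define A' where "A' = A - {v}"
        have A': "A' \<in> taylor_basis N i" "v \<notin> A'" "A = insert v A'" "finite A'"
          using A True taylor_basis_finite[OF A] by (auto simp: A'_def taylor_basis_def)
        \<comment> \<open>When v lies in A, every summand of the boundary of w at A may contribute.
          The cycle condition at A - {v} ties these summands to c A.\<close>
        have "0 = (\<Sum>j\<in>{..<N} - A'. subset_sign A' j * c (insert j A'))"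
          using cycle[of A'] taylor_diff_sum[OF A'(1)] by metis
        also have "{..<N} - A' = insert v ({..<N} - A)" using v(2) A' by auto
        finally have zero: "subset_sign A' v * c A + (\<Sum>j\<in>{..<N} - A. subset_sign A' j * c (insert j A')) = 0"
          using A'(3) by simp
        have "subset_sign A j * w (insert j A) = - (subset_sign A' j * c (insert j A'))"
          if j: "j \<in> {..<N} - A" for j
        proof -
          have "insert j A - {v} = insert j A'" using j True by (auto simp: A'_def)
          hence w: "w (insert j A) = c (insert j A')"
            using taylor_basis_insert[OF A, of j] j True by (simp add: w_def)
          show ?thesis
          proof (cases "c (insert j A') = 0")
            case False
            \<comment> \<open>A nonzero coefficient puts j into S, hence above the least vertex v;
              adding v to A' then flips the sign at j.\<close>
            hence "j \<in> S" using cS by blast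
            hence "v < j" using v(3)[of j] j True by (metis DiffD2 le_neq_implies_less)
            thus ?thesis using subset_sign_insert_less[OF A'(4,2), of j, where 'a = 'a] A'(3) w by simp
          qed (simp add: w)
        qed
        hence "(\<Sum>j\<in>{..<N} - A. subset_sign A j * w (insert j A)) =
            - (\<Sum>j\<in>{..<N} - A. subset_sign A' j * c (insert j A'))"
          by (simp add: sum_negf)
        also have "\<dots> = subset_sign A' v * c A" by (rule minus_unique) (subst add.commute, rule zero)
        also have "\<dots> = c A"
          using cS[of A] subset_sign_below[of A' v, where 'a = 'a] v(3) A'(3) by (cases "c A = 0") auto
        finally show ?thesis .
      qed
      thus ?thesis by (simp add: taylor_diff_sum[OF A])
    qed
    ultimately show ?thesis by blast
  qed
qed

text \<open>The first assumption says that f A is the least common multiple of the generators b j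
  with j in A. The first differential adds up the values at singletons, so it is nonzero somewhere
  in degree \<alpha> iff a generator divides \<alpha>.\<close>

lemma taylor_resolution:
  fixes f :: "nat set \<Rightarrow> 'o::order"
  assumes f: "\<And>A \<beta>. A \<subseteq> {..<N} \<Longrightarrow> f A \<le> \<beta> \<longleftrightarrow> (\<forall>j\<in>A. b j \<le> \<beta>)"
    and deg: "\<And>A. A \<subseteq> {..<N} \<Longrightarrow> f A \<in> \<Delta>"
    and M: "\<And>\<alpha>. \<alpha> \<in> \<Delta> \<Longrightarrow> \<alpha> \<in> M \<longleftrightarrow> (\<exists>j<N. b j \<le> \<alpha>)"
  shows "graded_resolution \<Delta> M (taylor_basis N) (\<lambda>_. f) (taylor_diff N :: nat \<Rightarrow> _ \<Rightarrow> _ \<Rightarrow> 'a::field)"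
  unfolding graded_resolution_def
proof (intro conjI allI)
  have b0: "taylor_basis N 0 = {{}}"
    by (auto simp: taylor_basis_def card_eq_0_iff dest: finite_subset)
  have sing: "insert j {} \<in> taylor_basis N 1" if "j < N" for j
    using that by (simp add: taylor_basis_def)
  have head: "(\<Sum>C\<in>taylor_basis N 1. taylor_diff N 0 {} C * w C) = (\<Sum>j<N. w {j})" for w :: "nat set \<Rightarrow> 'a"
    using taylor_diff_sum[of "{}" N 0 w] b0 by (simp add: subset_sign_def)
  show "\<exists>e. taylor_basis N 0 = {e} \<and> (\<forall>\<alpha>\<in>\<Delta>. f e \<le> \<alpha>) \<and> (\<forall>\<alpha>\<in>\<Delta>. (\<alpha> \<in> M) =
    (\<exists>w. strand (taylor_basis N 1) f \<alpha> w \<and> (\<Sum>C\<in>taylor_basis N 1. taylor_diff N 0 e C * w C) \<noteq> (0 :: 'a)))"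
  proof (intro exI[of _ "{}"] conjI ballI)
    show "f {} \<le> \<alpha>" for \<alpha> using f[of "{}"] by simp
    fix \<alpha> assume \<alpha>: "\<alpha> \<in> \<Delta>"
    show "(\<alpha> \<in> M) = (\<exists>w. strand (taylor_basis N 1) f \<alpha> w \<and>
        (\<Sum>C\<in>taylor_basis N 1. taylor_diff N 0 {} C * w C) \<noteq> (0 :: 'a))"
      unfolding M[OF \<alpha>] head
    proof
      assume "\<exists>j<N. b j \<le> \<alpha>"
      then obtain j where j: "j < N" "b j \<le> \<alpha>" by blast
      have "strand (taylor_basis N 1) f \<alpha> (\<lambda>C. if C = {j} then 1 else 0 :: 'a)"
        using j sing f[of "{j}" \<alpha>] by (auto simp: strand_def)
      moreover have "(\<Sum>l<N. if {l} = {j} then 1 else 0) = (1 :: 'a)" using j(1) by simp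
      ultimately show "\<exists>w. strand (taylor_basis N 1) f \<alpha> w \<and> (\<Sum>j<N. w {j}) \<noteq> (0 :: 'a)"
        by (intro exI[of _ "\<lambda>C. if C = {j} then 1 else 0"]) simp
    next
      assume "\<exists>w. strand (taylor_basis N 1) f \<alpha> w \<and> (\<Sum>j<N. w {j}) \<noteq> (0 :: 'a)"
      then obtain w :: "nat set \<Rightarrow> 'a" where w: "strand (taylor_basis N 1) f \<alpha> w" "(\<Sum>j<N. w {j}) \<noteq> 0" by blast
      from w(2) obtain j where "j \<in> {..<N}" "w {j} \<noteq> 0" by (rule sum.not_neutral_contains_not_neutral)
      thus "\<exists>j<N. b j \<le> \<alpha>" using w(1) f[of "{j}" \<alpha>] by (auto simp: strand_def)
    qed
  qed (rule b0)
  fix i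
  show "finite (taylor_basis N i)" by (rule finite_taylor_basis)
  show "f ` taylor_basis N i \<subseteq> \<Delta>" using deg by (auto simp: taylor_basis_def)
  show "gmat (taylor_basis N i) f (taylor_basis N (Suc i)) f (taylor_diff N i :: _ \<Rightarrow> _ \<Rightarrow> 'a)"
    unfolding gmat_def
  proof (intro allI impI)
    fix A C assume "taylor_diff N i A C \<noteq> (0 :: 'a)"
    then obtain j where j: "A \<in> taylor_basis N i" "j < N" "j \<notin> A" "C = insert j A"
      by (rule taylor_diff_nonzero)
    have C: "C \<in> taylor_basis N (Suc i)" using taylor_basis_insert[OF j(1-3)] j(4) by simp
    have "\<forall>l\<in>C. b l \<le> f C" using f[of C "f C"] C by (simp add: taylor_basis_def)
    hence "f A \<le> f C" using f[of A "f C"] j by (simp add: taylor_basis_def)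
    thus "A \<in> taylor_basis N i \<and> C \<in> taylor_basis N (Suc i) \<and> f A \<le> f C" using j C by simp
  qed
  show "mmul (taylor_basis N (Suc i)) (taylor_diff N i) (taylor_diff N (Suc i)) = (\<lambda>_ _. 0 :: 'a)"
    by (rule taylor_complex)
  show "\<forall>\<alpha>\<in>\<Delta>. \<forall>c. strand (taylor_basis N (Suc i)) f \<alpha> c \<and>
      (\<forall>A. (\<Sum>C\<in>taylor_basis N (Suc i). taylor_diff N i A C * c C) = (0 :: 'a)) \<longrightarrow>
      (\<exists>w. strand (taylor_basis N (Suc (Suc i))) f \<alpha> w \<and>
        (\<forall>A. (\<Sum>C\<in>taylor_basis N (Suc (Suc i)). taylor_diff N (Suc i) A C * w C) = c A))"
    using taylor_exact[OF f] by blast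
qed

text \<open>The entry from A to \<open>insert j A\<close> is always a sign. It is a unit of the
  polynomial matrix iff both sets have the same least common multiple, that is, iff b j divides that
  of A.\<close>

lemma minimal_at_taylor_iff:
  fixes f :: "nat set \<Rightarrow> 'o::order"
  assumes f: "\<And>A \<beta>. A \<subseteq> {..<N} \<Longrightarrow> f A \<le> \<beta> \<longleftrightarrow> (\<forall>j\<in>A. b j \<le> \<beta>)"
  shows "minimal_at (\<lambda>_. f) (taylor_diff N :: nat \<Rightarrow> _ \<Rightarrow> _ \<Rightarrow> 'a::field) i \<longleftrightarrow>
    (\<forall>A\<subseteq>{..<N}. \<forall>j<N. card A = i \<longrightarrow> j \<notin> A \<longrightarrow> \<not> b j \<le> f A)"
proof -
  have eq: "f A = f (insert j A) \<longleftrightarrow> b j \<le> f A" if "A \<subseteq> {..<N}" "j < N" for A j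
  proof -
    have "\<forall>l\<in>A. b l \<le> f A" using f[of A "f A"] that by simp
    moreover have "\<forall>l\<in>insert j A. b l \<le> f (insert j A)" using f[of "insert j A" "f (insert j A)"] that by simp
    ultimately show ?thesis
      using f[of A "f (insert j A)"] f[of "insert j A" "f A"] that
      by (metis insert_iff insert_subset lessThan_iff order_antisym)
  qed
  have "minimal_at (\<lambda>_. f) (taylor_diff N :: nat \<Rightarrow> _ \<Rightarrow> _ \<Rightarrow> 'a) i \<longleftrightarrow>
      (\<forall>A\<in>taylor_basis N i. \<forall>j<N. j \<notin> A \<longrightarrow> f A \<noteq> f (insert j A))"
    unfolding minimal_at_def
    using taylor_diff_nonzero[of N i _ _, where 'a = 'a] taylor_diff_insert[of _ N i, where 'a = 'a]
      subset_sign_nonzero[where 'a = 'a] by metis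
  thus ?thesis using eq by (auto simp: taylor_basis_def)
qed

section \<open>Betti numbers of block ideals\<close>

text \<open>The passage back from scalars to polynomials. A polynomial cycle splits into multidegree
  components, each is lifted by scalar exactness, and the lifts are added. The shift in
  \<open>i - 1\<close> reflects that \<open>d (Suc i)\<close> carries the scalars
  \<open>D i\<close>; the value at 0 is arbitrary.\<close>

lemma minimal_free_resolutionI:
  fixes D :: "nat \<Rightarrow> nat \<Rightarrow> nat \<Rightarrow> 'a::field"
  assumes r0: "r 0 = 1" and deg0: "deg 0 0 = 0"
    and deg: "\<And>i q. q < r i \<Longrightarrow> deg i q \<in> exponents n"
    and gm: "\<And>i. gmat {..<r i} (degs (deg i)) {..<r (Suc i)} (degs (deg (Suc i))) (D i)"
    and complex: "\<And>i. mmul {..<r (Suc i)} (D i) (D (Suc i)) = (\<lambda>_ _. 0)"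
    and exact: "\<And>i \<alpha> c. \<alpha> \<in> exponents n \<Longrightarrow> strand {..<r (Suc i)} (degs (deg (Suc i))) (lookup \<alpha>) c \<Longrightarrow>
       (\<And>p. (\<Sum>q<r (Suc i). D i p q * c q) = 0) \<Longrightarrow>
       \<exists>w. strand {..<r (Suc (Suc i))} (degs (deg (Suc (Suc i)))) (lookup \<alpha>) w \<and>
         (\<forall>p. (\<Sum>q<r (Suc (Suc i)). D (Suc i) p q * w q) = c p)"
    and min: "\<And>i. minimal_at (\<lambda>i. degs (deg i)) D i"
    and head: "{(homogeneous_mat (deg 0) (r 0) (deg 1) (r 1) (D 0) *\<^sub>v v) $ 0 |v. v \<in> free_module n (r 1)} = M"
  shows "minimal_free_resolution n M r deg
    (\<lambda>i. homogeneous_mat (deg (i - 1)) (r (i - 1)) (deg i) (r i) (D (i - 1)))"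
proof -
  define d where "d = (\<lambda>i. homogeneous_mat (deg (i - 1)) (r (i - 1)) (deg i) (r i) (D (i - 1)))"
  have hom: "d (Suc i) = homogeneous_mat (deg i) (r i) (deg (Suc i)) (r (Suc i)) (D i)" for i
    by (simp add: d_def)
  note cm = component_mult[OF gm, folded hom]
  have fmc: "v \<in> free_module n s \<Longrightarrow> v \<in> carrier_vec s" for v :: "'a mpoly vec" and s
    by (simp add: free_module_def)
  have comp0: "component \<delta> s \<alpha> (0\<^sub>v s) = (\<lambda>_. 0 :: 'a)" for \<delta> s \<alpha>
    by (auto simp: component_def)
  have dcar: "d (Suc i) *\<^sub>v v \<in> carrier_vec (r i)" for i v
    by (rule carrier_vecI) (simp add: hom homogeneous_mat_def)
  have entry: "d (Suc i) $$ (p, q) = Poly_Mapping.single (deg (Suc i) q - deg i p) (D i p q)"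
    if "p < r i" "q < r (Suc i)" for i p q
    using that by (simp add: hom homogeneous_mat_def)
  have diff_add: "deg (Suc i) q - deg i p + deg i p = deg (Suc i) q" if "D i p q \<noteq> 0" for i p q
    using gmatD[OF gm that] by (intro exponent_minus_add) blast
  show ?thesis
    unfolding minimal_free_resolution_def d_def[symmetric]
  proof (intro conjI allI impI ballI)
    show "r 0 = 1" "deg 0 0 = 0" by (fact r0 deg0)+
    show "{(d 1 *\<^sub>v v) $ 0 |v. v \<in> free_module n (r 1)} = M"
      using head by (simp add: d_def)
    fix i
    show "d (Suc i) \<in> carrier_mat (r i) (r (Suc i))" by (simp add: hom homogeneous_mat_carrier)
    show "deg i q \<in> exponents n" if "q < r i" for q by (rule deg[OF that])
    show "d (Suc i) $$ (p, q) \<in> poly_ring n" if "p < r i" "q < r (Suc i)" for p q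
      using deg[OF that(2)] by (auto simp: entry[OF that] poly_ring_def exponents_minus)
    show "m + deg i p = deg (Suc i) q"
      if "p < r i" "q < r (Suc i)" "m \<in> Poly_Mapping.keys (d (Suc i) $$ (p, q))" for p q m
      using that(3) diff_add[of i p q] by (auto simp: entry[OF that(1,2)] split: if_splits)
    show "d (Suc i) $$ (p, q) \<in> ideal_span n (var ` {1..n})" if pq: "p < r i" "q < r (Suc i)" for p q
    proof (cases "D i p q = 0")
      case True
      thus ?thesis unfolding entry[OF pq] ideal_span_def by (auto intro!: exI[of _ "{}"])
    next
      case False
      define m where "m = deg (Suc i) q - deg i p"
      \<comment> \<open>Minimality makes the two degrees differ, so the monomial of the entry
        contains a variable. It is one of the first n, and splitting it off shows membership in the
        ideal of the variables.\<close>
      have "m \<noteq> 0" using diff_add[OF False] min[of i] False unfolding minimal_at_def m_def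
        by (metis add_0)
      then obtain l where l: "lookup m l \<noteq> 0" by (metis lookup_zero poly_mapping_eqI)
      have m: "m \<in> exponents n" unfolding m_def by (rule exponents_minus[OF deg[OF pq(2)]])
      hence ln: "l \<in> {1..n}" using l by (auto simp: exponents_def in_keys_iff subset_iff)
      have "m - Poly_Mapping.single l 1 + Poly_Mapping.single l 1 = m"
        using l by (intro exponent_minus_add) (auto simp: le_fun_def lookup_single when_def)
      hence eq: "d (Suc i) $$ (p, q) =
          Poly_Mapping.single (m - Poly_Mapping.single l 1) (D i p q) * var l"
        unfolding entry[OF pq] m_def[symmetric] var_def mult_single by simp
      have "Poly_Mapping.single (m - Poly_Mapping.single l 1) (D i p q) \<in> poly_ring n"
        using exponents_minus[OF m] by (simp add: poly_ring_def)
      thus ?thesis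
        unfolding ideal_span_def eq using ln
        by (intro CollectI exI[of _ "{var l}"]
            exI[of _ "\<lambda>_. Poly_Mapping.single (m - Poly_Mapping.single l 1) (D i p q)"]) auto
    qed
    show "{v \<in> free_module n (r (Suc i)). d (Suc i) *\<^sub>v v = 0\<^sub>v (r i)} =
      {d (Suc (Suc i)) *\<^sub>v w |w. w \<in> free_module n (r (Suc (Suc i)))}" (is "?K = ?I")
    proof
      show "?I \<subseteq> ?K"
      proof safe
        fix w :: "'a mpoly vec" assume w: "w \<in> free_module n (r (Suc (Suc i)))"
        have "component (deg (Suc i)) (r (Suc i)) \<alpha> (d (Suc (Suc i)) *\<^sub>v w) = (\<lambda>_. 0)"
          if "\<alpha> \<notin> exponents n" for \<alpha>
        proof -
          have "component (deg (Suc (Suc i))) (r (Suc (Suc i))) \<alpha> w = (\<lambda>_. 0)"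
            using free_module_iff_component[of "r (Suc (Suc i))" "deg (Suc (Suc i))" n w] deg w that
            by blast
          thus ?thesis by (simp add: cm[OF fmc[OF w]])
        qed
        thus "d (Suc (Suc i)) *\<^sub>v w \<in> free_module n (r (Suc i))"
          using free_module_iff_component[of "r (Suc i)" "deg (Suc i)" n] deg dcar by blast
        show "d (Suc i) *\<^sub>v (d (Suc (Suc i)) *\<^sub>v w) = 0\<^sub>v (r i)"
        proof (rule component_eqI[OF dcar zero_carrier_vec])
          fix \<alpha>
          have "(\<Sum>q<r (Suc i). D i p q * (\<Sum>y<r (Suc (Suc i)). D (Suc i) q y *
              component (deg (Suc (Suc i))) (r (Suc (Suc i))) \<alpha> w y)) = 0" for p
          proof -
            have "(\<Sum>q<r (Suc i). D i p q * (\<Sum>y<r (Suc (Suc i)). D (Suc i) q y *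
                component (deg (Suc (Suc i))) (r (Suc (Suc i))) \<alpha> w y)) =
              (\<Sum>q<r (Suc i). \<Sum>y<r (Suc (Suc i)). D i p q * D (Suc i) q y *
                component (deg (Suc (Suc i))) (r (Suc (Suc i))) \<alpha> w y)"
              by (simp add: sum_distrib_left mult.assoc)
            also have "\<dots> = (\<Sum>y<r (Suc (Suc i)). \<Sum>q<r (Suc i). D i p q * D (Suc i) q y *
                component (deg (Suc (Suc i))) (r (Suc (Suc i))) \<alpha> w y)"
              by (rule sum.swap)
            also have "\<dots> = (\<Sum>y<r (Suc (Suc i)). mmul {..<r (Suc i)} (D i) (D (Suc i)) p y *
                component (deg (Suc (Suc i))) (r (Suc (Suc i))) \<alpha> w y)"
              by (simp add: mmul_def sum_distrib_right)
            finally show ?thesis by (simp add: complex)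
          qed
          thus "component (deg i) (r i) \<alpha> (d (Suc i) *\<^sub>v (d (Suc (Suc i)) *\<^sub>v w)) =
              component (deg i) (r i) \<alpha> (0\<^sub>v (r i))"
            unfolding cm[OF dcar] cm[OF fmc[OF w]] comp0 by simp
        qed
      qed
      show "?K \<subseteq> ?I"
      proof safe
        fix v :: "'a mpoly vec"
        assume v: "v \<in> free_module n (r (Suc i))" and dv: "d (Suc i) *\<^sub>v v = 0\<^sub>v (r i)"
        let ?c = "\<lambda>\<alpha>. component (deg (Suc i)) (r (Suc i)) \<alpha> v"
        have cycle: "(\<Sum>q<r (Suc i). D i p q * ?c \<alpha> q) = 0" for p \<alpha>
          using fun_cong[OF cm[OF fmc[OF v], of \<alpha>], of p] by (simp add: dv comp0)
        have out: "?c \<alpha> = (\<lambda>_. 0)" if "\<alpha> \<notin> exponents n" for \<alpha>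
          using free_module_iff_component[of "r (Suc i)" "deg (Suc i)" n v] deg v that by blast
        have "\<forall>\<alpha>. \<exists>w. strand {..<r (Suc (Suc i))} (degs (deg (Suc (Suc i)))) (lookup \<alpha>) w \<and>
            (\<forall>p. (\<Sum>q<r (Suc (Suc i)). D (Suc i) p q * w q) = ?c \<alpha> p)"
        proof
          fix \<alpha>
          show "\<exists>w. strand {..<r (Suc (Suc i))} (degs (deg (Suc (Suc i)))) (lookup \<alpha>) w \<and>
              (\<forall>p. (\<Sum>q<r (Suc (Suc i)). D (Suc i) p q * w q) = ?c \<alpha> p)"
          proof (cases "\<alpha> \<in> exponents n")
            case True
            show ?thesis by (rule exact[OF True strand_component cycle])
          next
            case False
            \<comment> \<open>The lifts are chosen for all exponents at once; outside
              \<open>exponents n\<close> the component of v is zero and is lifted by zero.\<close>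
            show ?thesis unfolding out[OF False]
              by (intro exI[of _ "\<lambda>_. 0"]) (simp add: strand_def)
          qed
        qed
        from choice[OF this] obtain c' where
          c': "\<And>\<alpha>. strand {..<r (Suc (Suc i))} (degs (deg (Suc (Suc i)))) (lookup \<alpha>) (c' \<alpha>)"
            "\<And>\<alpha> p. (\<Sum>q<r (Suc (Suc i)). D (Suc i) p q * c' \<alpha> q) = ?c \<alpha> p" by blast
        \<comment> \<open>Only finitely many multidegrees occur in v, so adding the lifts over T
          gives a polynomial vector. Off T the chosen lifts are discarded, which keeps w inside the
          free module over the first n variables.\<close>
        define T where "T = {\<alpha> \<in> exponents n. ?c \<alpha> \<noteq> (\<lambda>_. 0)}"
        have "T \<subseteq> (\<Union>q<r (Suc i). (\<lambda>m. m + deg (Suc i) q) ` Poly_Mapping.keys (v $ q))"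
        proof
          fix \<alpha> assume "\<alpha> \<in> T"
          then obtain q where "?c \<alpha> q \<noteq> 0" by (auto simp: T_def)
          hence q: "q < r (Suc i)" "degs (deg (Suc i)) q \<le> lookup \<alpha>" "lookup (v $ q) (\<alpha> - deg (Suc i) q) \<noteq> 0"
            by (auto simp: component_def split: if_splits)
          hence "\<alpha> = (\<alpha> - deg (Suc i) q) + deg (Suc i) q" "\<alpha> - deg (Suc i) q \<in> Poly_Mapping.keys (v $ q)"
            by (simp_all add: exponent_minus_add in_keys_iff)
          thus "\<alpha> \<in> (\<Union>q<r (Suc i). (\<lambda>m. m + deg (Suc i) q) ` Poly_Mapping.keys (v $ q))"
            using q(1) by (intro UN_I[of q]) (rule lessThan_iff[THEN iffD2], assumption, rule image_eqI)
        qed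
        hence finT: "finite T" by (rule finite_subset) auto
        define w where "w = vec (r (Suc (Suc i))) (\<lambda>q. \<Sum>\<alpha>\<in>T.
            Poly_Mapping.single (\<alpha> - deg (Suc (Suc i)) q) (c' \<alpha> q))"
        have wcar: "w \<in> carrier_vec (r (Suc (Suc i)))" by (simp add: w_def)
        have "component (deg (Suc (Suc i))) (r (Suc (Suc i))) \<beta> w = (\<lambda>q. if \<beta> \<in> T then c' \<beta> q else 0)" for \<beta>
        proof
          fix q
          show "component (deg (Suc (Suc i))) (r (Suc (Suc i))) \<beta> w q = (if \<beta> \<in> T then c' \<beta> q else 0)"
          proof (cases "q < r (Suc (Suc i)) \<and> degs (deg (Suc (Suc i))) q \<le> lookup \<beta>")
            case True
            hence "component (deg (Suc (Suc i))) (r (Suc (Suc i))) \<beta> w q =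
                (\<Sum>\<alpha>\<in>T. component (deg (Suc (Suc i))) (r (Suc (Suc i))) \<beta>
                   (homogeneous_vec (deg (Suc (Suc i))) (r (Suc (Suc i))) \<alpha> (c' \<alpha>)) q)"
              by (simp add: component_def w_def lookup_sum homogeneous_vec_def)
            also have "\<dots> = (\<Sum>\<alpha>\<in>T. if \<alpha> = \<beta> then c' \<beta> q else 0)"
              by (rule sum.cong) (auto simp: component_homogeneous_vec[OF c'(1)])
            finally show ?thesis using finT by simp
          next
            case False
            hence "c' \<beta> q = 0" using c'(1)[of \<beta>] by (auto simp: strand_def)
            thus ?thesis using False by (auto simp: component_def)
          qed
        qed
        note cw = this
        have "w \<in> free_module n (r (Suc (Suc i)))"
          using free_module_iff_component[of "r (Suc (Suc i))" "deg (Suc (Suc i))" n w] deg wcar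
          by (auto simp: cw T_def)
        moreover have "v = d (Suc (Suc i)) *\<^sub>v w"
        proof (rule component_eqI[OF fmc[OF v] dcar])
          fix \<beta>
          have "?c \<beta> p = (\<Sum>q<r (Suc (Suc i)). D (Suc i) p q * (if \<beta> \<in> T then c' \<beta> q else 0))" for p
          proof (cases "\<beta> \<in> T")
            case True
            thus ?thesis using c'(2)[of p \<beta>] by simp
          next
            case False
            hence "?c \<beta> = (\<lambda>_. 0)" using out by (auto simp: T_def)
            thus ?thesis using False by simp
          qed
          thus "?c \<beta> = component (deg (Suc i)) (r (Suc i)) \<beta> (d (Suc (Suc i)) *\<^sub>v w)"
            unfolding cm[OF wcar] cw by blast
        qed
        ultimately show "\<exists>w. v = d (Suc (Suc i)) *\<^sub>v w \<and> w \<in> free_module n (r (Suc (Suc i)))" by blast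
      qed
    qed
  qed
qed

section \<open>Block ideals and their squarefree resolutions\<close>

definition squarefree_exponent :: "nat set \<Rightarrow> exponent"
  where "squarefree_exponent A = (\<Sum>i\<in>A. Poly_Mapping.single i 1)"

lemma lookup_squarefree_exponent:
  "finite A \<Longrightarrow> lookup (squarefree_exponent A) i = (if i \<in> A then 1 else 0)"
  by (simp add: squarefree_exponent_def lookup_sum lookup_single when_def)

lemma squarefree_exponent_le_iff:
  "finite A \<Longrightarrow> lookup (squarefree_exponent A) \<le> \<alpha> \<longleftrightarrow> (\<forall>i\<in>A. \<alpha> i \<noteq> 0)"
  by (auto simp: le_fun_def lookup_squarefree_exponent Suc_le_eq)

lemma squarefree_exponent_exponents:
  "A \<subseteq> {1..n} \<Longrightarrow> squarefree_exponent A \<in> exponents n"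
  using finite_subset[of A "{1..n}"]
  by (auto simp: exponents_def in_keys_iff lookup_squarefree_exponent split: if_splits)

lemma prod_var: "finite A \<Longrightarrow> (\<Prod>i\<in>A. var i) = (Poly_Mapping.single (squarefree_exponent A) 1 :: 'a::field mpoly)"
  by (induction A rule: finite_induct) (auto simp: squarefree_exponent_def var_def mult_single)

lemma squarefree_exponent_inject:
  "finite A \<Longrightarrow> finite C \<Longrightarrow> squarefree_exponent A = squarefree_exponent C \<Longrightarrow> A = C"
  by (metis lookup_squarefree_exponent subsetI subset_antisym zero_neq_one)

text \<open>If a combination of generators has a nonzero coefficient at \<alpha>, so has one of its
  summands, and the generator in that summand divides \<alpha>.\<close>

lemma block_ideal_degree_iff:
  assumes B: "\<And>b. b \<in> B \<Longrightarrow> finite b" and \<alpha>: "\<alpha> \<in> exponents n"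
  shows "Poly_Mapping.single \<alpha> 1 \<in> (block_ideal n B :: 'a::field mpoly set) \<longleftrightarrow>
    (\<exists>b\<in>B. lookup (squarefree_exponent b) \<le> lookup \<alpha>)"
proof
  assume "Poly_Mapping.single \<alpha> 1 \<in> (block_ideal n B :: 'a mpoly set)"
  then obtain c :: "'a mpoly \<Rightarrow> 'a mpoly" and F where F: "Poly_Mapping.single \<alpha> 1 = (\<Sum>g\<in>F. c g * g)" "F \<subseteq> (\<lambda>b. \<Prod>i\<in>b. var i) ` B"
    unfolding block_ideal_def ideal_span_def by blast
  have "(\<Sum>g\<in>F. lookup (c g * g) \<alpha>) \<noteq> 0"
    using arg_cong[OF F(1), of "\<lambda>p. lookup p \<alpha>"] by (simp add: lookup_sum)
  then obtain g where g: "g \<in> F" "lookup (c g * g) \<alpha> \<noteq> 0"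
    by (rule sum.not_neutral_contains_not_neutral)
  then obtain b where b: "b \<in> B" "g = Poly_Mapping.single (squarefree_exponent b) 1"
    using F(2) prod_var[where 'a = 'a] B by blast
  have "lookup (Poly_Mapping.single (squarefree_exponent b) 1 * c g) \<alpha> \<noteq> 0"
    using g(2) b(2) by (simp add: mult.commute)
  hence "lookup (squarefree_exponent b) \<le> lookup \<alpha>"
    unfolding lookup_single_mult by (auto split: if_splits)
  thus "\<exists>b\<in>B. lookup (squarefree_exponent b) \<le> lookup \<alpha>" using b(1) by blast
next
  assume "\<exists>b\<in>B. lookup (squarefree_exponent b) \<le> lookup \<alpha>"
  then obtain b where b: "b \<in> B" "lookup (squarefree_exponent b) \<le> lookup \<alpha>" by blast
  have "Poly_Mapping.single \<alpha> 1 = Poly_Mapping.single (\<alpha> - squarefree_exponent b) 1 * (\<Prod>i\<in>b. var i :: 'a mpoly)"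
    using exponent_minus_add[OF b(2)] by (simp add: prod_var[OF B[OF b(1)]] mult_single)
  moreover have "Poly_Mapping.single (\<alpha> - squarefree_exponent b) (1 :: 'a) \<in> poly_ring n"
    using exponents_minus[OF \<alpha>] by (simp add: poly_ring_def)
  ultimately show "Poly_Mapping.single \<alpha> 1 \<in> (block_ideal n B :: 'a mpoly set)"
    unfolding block_ideal_def ideal_span_def using b(1)
    by (intro CollectI exI[of _ "{\<Prod>i\<in>b. var i}"]
        exI[of _ "\<lambda>_. Poly_Mapping.single (\<alpha> - squarefree_exponent b) 1"]) auto
qed

text \<open>An ideal element has one coefficient per generator, a vector has one entry per index.
  Distinct blocks give distinct monomials, so m translates between the two; generators absent from a
  combination receive entry 0.\<close>

lemma block_ideal_eq_image:
  fixes b :: "nat \<Rightarrow> nat set"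
  assumes bij: "bij_betw b {..<N} B" and fin: "\<And>j. j < N \<Longrightarrow> finite (b j)"
  shows "{\<Sum>j<N. Poly_Mapping.single (squarefree_exponent (b j)) 1 * v $ j |v. v \<in> free_module n N} =
    (block_ideal n B :: 'a::field mpoly set)"
proof -
  define m where "m = (\<lambda>j. Poly_Mapping.single (squarefree_exponent (b j)) (1 :: 'a))"
  have fold_m: "Poly_Mapping.single (squarefree_exponent (b j)) 1 = m j" for j
    by (simp add: m_def)
  have inj: "inj_on m {..<N}"
  proof (rule inj_onI)
    fix x y assume xy: "x \<in> {..<N}" "y \<in> {..<N}" "m x = m y"
    have "squarefree_exponent (b x) = squarefree_exponent (b y)"
      using arg_cong[OF xy(3), of Poly_Mapping.keys] by (simp add: m_def)
    hence "b x = b y" using squarefree_exponent_inject fin xy by blast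
    thus "x = y" using bij xy by (auto simp: bij_betw_def inj_on_def)
  qed
  have gens: "(\<lambda>b. \<Prod>i\<in>b. var i) ` B = m ` {..<N}"
  proof -
    have "(\<lambda>b. \<Prod>i\<in>b. var i) ` B = (\<lambda>b. \<Prod>i\<in>b. var i :: 'a mpoly) ` b ` {..<N}"
      using bij by (simp add: bij_betw_def)
    also have "\<dots> = m ` {..<N}"
      unfolding image_image by (rule image_cong) (use fin prod_var[where 'a = 'a] in \<open>auto simp: m_def\<close>)
    finally show ?thesis .
  qed
  show ?thesis
    unfolding block_ideal_def ideal_span_def gens fold_m
  proof (intro equalityI subsetI)
    fix p assume "p \<in> {\<Sum>j<N. m j * v $ j |v. v \<in> free_module n N}"
    then obtain v where v: "v \<in> free_module n N" "p = (\<Sum>j<N. m j * v $ j)" by blast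
    define c where "c = (\<lambda>g. v $ inv_into {..<N} m g)"
    have "(\<Sum>g\<in>m ` {..<N}. c g * g) = (\<Sum>j<N. c (m j) * m j)"
      by (rule sum.reindex[OF inj, unfolded o_def])
    also have "\<dots> = p"
      unfolding v(2) by (rule sum.cong) (simp_all add: c_def inv_into_f_f[OF inj] mult.commute)
    finally have "(\<Sum>g\<in>m ` {..<N}. c g * g) = p" .
    moreover have "\<forall>g\<in>m ` {..<N}. c g \<in> poly_ring n"
      using inj v(1) by (auto simp: c_def inv_into_f_f free_module_def)
    ultimately show "p \<in> {\<Sum>g\<in>F. c g * g |F c. finite F \<and> F \<subseteq> m ` {..<N} \<and> (\<forall>g\<in>F. c g \<in> poly_ring n)}"
      by (intro CollectI exI[of _ "m ` {..<N}"] exI[of _ c]) auto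
  next
    fix p assume "p \<in> {\<Sum>g\<in>F. c g * g |F c. finite F \<and> F \<subseteq> m ` {..<N} \<and> (\<forall>g\<in>F. c g \<in> poly_ring n)}"
    then obtain F c where F: "p = (\<Sum>g\<in>F. c g * g)" "F \<subseteq> m ` {..<N}" "\<forall>g\<in>F. c g \<in> poly_ring n" by blast
    define v where "v = vec N (\<lambda>j. if m j \<in> F then c (m j) else 0)"
    have "(\<Sum>j<N. m j * v $ j) = (\<Sum>j<N. if m j \<in> F then c (m j) * m j else 0)"
      by (rule sum.cong) (auto simp: v_def mult.commute)
    also have "\<dots> = (\<Sum>g\<in>m ` {..<N}. if g \<in> F then c g * g else 0)"
      by (simp add: sum.reindex[OF inj])
    also have "\<dots> = p"
      unfolding F(1) using F(2) by (subst sum.inter_restrict[symmetric]) (auto simp: Int_absorb1)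
    finally have "p = (\<Sum>j<N. m j * v $ j)" by simp
    moreover have "v \<in> free_module n N"
      using F(3) by (auto simp: free_module_def v_def poly_ring_def)
    ultimately show "p \<in> {\<Sum>j<N. m j * v $ j |v. v \<in> free_module n N}" by blast
  qed
qed

text \<open>Blocks of equal size form an antichain, so the squarefree construction applies and is
  then transferred to all multidegrees.\<close>

lemma block_ideal_minimal_free_resolution:
  assumes B: "B \<subseteq> blocks k n" and k: "k \<ge> 1"
  shows "\<exists>r deg d. minimal_free_resolution n (block_ideal n B :: 'a::field mpoly set) r deg d"
proof -
  have "finite B" using B by (rule finite_subset) (auto simp: blocks_def intro: finite_subset[of _ "Pow {1..n}"])
  then obtain b where b: "bij_betw b {..<card B} B"
    using ex_bij_betw_nat_finite[of B] by (auto simp: atLeast0LessThan)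
  define N where "N = card B"
  have bB: "b j \<subseteq> {1..n}" "card (b j) = k" "finite (b j)" if "j < N" for j
    using b B that finite_subset[of "b j" "{1..n}"] by (auto simp: N_def bij_betw_def blocks_def)
  have ne: "b j \<noteq> {}" if "j < N" for j using bB(2)[OF that] k by auto
  have antichain: "j' = j" if "j < N" "j' < N" "b j' \<subseteq> b j" for j j'
  proof -
    have "b j' = b j" using card_subset_eq[of "b j" "b j'"] bB that by simp
    thus ?thesis using b that by (auto simp: bij_betw_def inj_on_def N_def)
  qed
  obtain r L and D :: "nat \<Rightarrow> nat \<Rightarrow> nat \<Rightarrow> 'a" where
    R: "r 0 = 1" "L 0 = (\<lambda>_. {})" "r 1 = N" "L 1 = b" "\<And>q. q < N \<Longrightarrow> D 0 0 q = 1"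
    and L: "\<And>i q. q < r i \<Longrightarrow> L i q \<subseteq> {1..n}"
    and gm: "\<And>i. gmat {..<r i} (L i) {..<r (Suc i)} (L (Suc i)) (D i)"
    and complex: "\<And>i. mmul {..<r (Suc i)} (D i) (D (Suc i)) = (\<lambda>_ _. 0)"
    and exact: "\<And>i \<sigma> c. \<sigma> \<subseteq> {1..n} \<Longrightarrow> strand {..<r (Suc i)} (L (Suc i)) \<sigma> c \<Longrightarrow>
       \<forall>p. (\<Sum>q<r (Suc i). D i p q * c q) = 0 \<Longrightarrow>
       \<exists>w. strand {..<r (Suc (Suc i))} (L (Suc (Suc i))) \<sigma> w \<and> (\<forall>p. (\<Sum>q<r (Suc (Suc i)). D (Suc i) p q * w q) = c p)"
    and min: "\<And>i. minimal_at L D i"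
    by (rule squarefree_resolution_exists[of N b n])
      (rule bB(1), assumption, rule ne, assumption, rule antichain, assumption+, rule that)
  define deg where "deg = (\<lambda>i q. squarefree_exponent (L i q))"
  have finL: "finite (L i q)" if "q < r i" for i q
    using L[OF that] by (rule finite_subset) simp
  \<comment> \<open>A squarefree monomial divides \<alpha> iff its variables occur in \<alpha>. So
    exactness in degree \<alpha> is exactness in the squarefree degree given by the support of
    \<alpha>.\<close>
  have strand_iff: "strand {..<r i} (degs (deg i)) (lookup \<alpha>) c \<longleftrightarrow>
      strand {..<r i} (L i) (Poly_Mapping.keys \<alpha>) c" for i \<alpha> and c :: "nat \<Rightarrow> 'a"
    unfolding strand_def deg_def using finL squarefree_exponent_le_iff
    by (auto simp: in_keys_iff subset_iff)
  have "minimal_free_resolution n (block_ideal n B :: 'a mpoly set) r deg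
    (\<lambda>i. homogeneous_mat (deg (i - 1)) (r (i - 1)) (deg i) (r i) (D (i - 1)))"
  proof (rule minimal_free_resolutionI)
    show "r 0 = 1" by (rule R(1))
    show deg0: "deg 0 0 = 0" by (simp add: deg_def R(2) squarefree_exponent_def)
    show "deg i q \<in> exponents n" if "q < r i" for i q
      unfolding deg_def by (rule squarefree_exponent_exponents[OF L[OF that]])
    show "gmat {..<r i} (degs (deg i)) {..<r (Suc i)} (degs (deg (Suc i))) (D i)" for i
      unfolding gmat_def
    proof (intro allI impI)
      fix p q assume "D i p q \<noteq> 0"
      from gmatD[OF gm this]
      have pq: "p < r i" "q < r (Suc i)" "L i p \<subseteq> L (Suc i) q" by auto
      thus "p \<in> {..<r i} \<and> q \<in> {..<r (Suc i)} \<and> degs (deg i) p \<le> degs (deg (Suc i)) q"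
        using squarefree_exponent_le_iff[OF finL[OF pq(1)]] lookup_squarefree_exponent[OF finL[OF pq(2)]]
        by (auto simp: deg_def)
    qed
    show "mmul {..<r (Suc i)} (D i) (D (Suc i)) = (\<lambda>_ _. 0)" for i by (rule complex)
    show "\<exists>w. strand {..<r (Suc (Suc i))} (degs (deg (Suc (Suc i)))) (lookup \<alpha>) w \<and>
         (\<forall>p. (\<Sum>q<r (Suc (Suc i)). D (Suc i) p q * w q) = c p)"
      if "\<alpha> \<in> exponents n" "strand {..<r (Suc i)} (degs (deg (Suc i))) (lookup \<alpha>) c"
        "\<And>p. (\<Sum>q<r (Suc i). D i p q * c q) = 0" for i \<alpha> c
      unfolding strand_iff
      by (rule exact) (use that in \<open>auto simp: strand_iff exponents_def\<close>)
    show "minimal_at (\<lambda>i. degs (deg i)) D i" for i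
      unfolding minimal_at_def
    proof (intro allI impI notI)
      fix p q assume D: "D i p q \<noteq> 0" and eq: "degs (deg i) p = degs (deg (Suc i)) q"
      have "p < r i" "q < r (Suc i)" using gmatD[OF gm D] by auto
      moreover have "deg i p = deg (Suc i) q" using eq by (simp only: poly_mapping_eq_iff)
      ultimately have "L i p = L (Suc i) q"
        unfolding deg_def by (intro squarefree_exponent_inject finL)
      thus False using min[of i] D by (auto simp: minimal_at_def)
    qed
    have head: "(homogeneous_mat (deg 0) (r 0) (deg 1) (r 1) (D 0) *\<^sub>v v) $ 0 =
        (\<Sum>j<N. Poly_Mapping.single (squarefree_exponent (b j)) 1 * v $ j)"
      if "v \<in> free_module n (r 1)" for v
    proof -
      have "(homogeneous_mat (deg 0) (r 0) (deg 1) (r 1) (D 0) *\<^sub>v v) $ 0 =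
          (\<Sum>j<r 1. Poly_Mapping.single (deg 1 j - deg 0 0) (D 0 0 j) * v $ j)"
      proof -
        have "dim_vec v = r 1" using that by (auto simp: free_module_def)
        thus ?thesis using R(1) by (simp add: homogeneous_mat_def scalar_prod_def atLeast0LessThan)
      qed
      thus ?thesis unfolding deg0 R(3) by (simp add: R(5) deg_def R(4)[unfolded One_nat_def])
    qed
    show "{(homogeneous_mat (deg 0) (r 0) (deg 1) (r 1) (D 0) *\<^sub>v v) $ 0 |v. v \<in> free_module n (r 1)} =
        (block_ideal n B :: 'a mpoly set)"
    proof -
      have "{(homogeneous_mat (deg 0) (r 0) (deg 1) (r 1) (D 0) *\<^sub>v v) $ 0 |v. v \<in> free_module n (r 1)} =
          {\<Sum>j<N. Poly_Mapping.single (squarefree_exponent (b j)) 1 * v $ j |v. v \<in> free_module n (r 1)}"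
        by (intro Collect_cong ex_cong1 conj_cong[THEN trans[OF conj_commute trans[OF _ conj_commute]]])
          (simp_all only: head)
      thus ?thesis
        unfolding R(3) using block_ideal_eq_image[of b N B n, where 'a = 'a] b bB(3) by (simp add: N_def)
    qed
  qed
  thus ?thesis by blast
qed

section \<open>Betti numbers against Taylor ranks\<close>

lemma minimal_free_resolution_rank_unique:
  fixes M :: "'a::field mpoly set"
  assumes "minimal_free_resolution n M r deg d" "minimal_free_resolution n M r' deg' d'"
  shows "r (Suc i) = r' (Suc i)"
proof -
  obtain D :: "nat \<Rightarrow> nat \<Rightarrow> nat \<Rightarrow> 'a" where D: "graded_resolution (lookup ` exponents n) (ideal_degrees n M) (\<lambda>i. {..<r i}) (\<lambda>i. degs (deg i)) D"
    "\<And>i. minimal_at (\<lambda>i. degs (deg i)) D i"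
    using graded_resolution_of_minimal_free_resolution[OF assms(1)] by blast
  obtain D' :: "nat \<Rightarrow> nat \<Rightarrow> nat \<Rightarrow> 'a" where D': "graded_resolution (lookup ` exponents n) (ideal_degrees n M) (\<lambda>i. {..<r' i}) (\<lambda>i. degs (deg' i)) D'"
    "\<And>i. minimal_at (\<lambda>i. degs (deg' i)) D' i"
    using graded_resolution_of_minimal_free_resolution[OF assms(2)] by blast
  \<comment> \<open>The comparison applies with the resolution of larger rank in the role of X, and
    either may be the larger one.\<close>
  show ?thesis
    using minimal_rank_comparison(1)[OF D(1) D'(1) D(2) D(2), of i]
      minimal_rank_comparison(1)[OF D'(1) D(1) D'(2) D'(2), of i] by force
qed

lemma betti_eq_rank:
  fixes M :: "'a::field mpoly set"
  assumes "minimal_free_resolution n M r deg d"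
  shows "betti n M (Suc i) = r (Suc i)"
  unfolding betti_def
  by (rule the_equality) (use assms minimal_free_resolution_rank_unique in blast)+

text \<open>If the ranks agree, the comparison with the minimal resolution as X transfers minimality
  to the Taylor differentials next to degree i + 1; if these are minimal, the Taylor resolution
  itself can play X. They involve sets of i and i + 1 blocks, and divisibility of a least common
  multiple is containment in a union.\<close>

lemma betti_block_ideal_eq_choose_iff:
  fixes b :: "nat \<Rightarrow> nat set"
  assumes B: "B \<subseteq> blocks k n" and k: "k \<ge> 1" and b: "bij_betw b {..<N} B"
  shows "betti n (block_ideal n B :: 'a::field mpoly set) (Suc i) = N choose (Suc i) \<longleftrightarrow>
    (\<forall>A\<subseteq>{..<N}. \<forall>j<N. card A \<in> {i, Suc i} \<longrightarrow> j \<notin> A \<longrightarrow> \<not> b j \<subseteq> \<Union> (b ` A))"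
proof -
  define f where "f = (\<lambda>A. lookup (squarefree_exponent (\<Union> (b ` A))))"
  have bB: "b j \<subseteq> {1..n}" "finite (b j)" if "j < N" for j
    using b B that finite_subset[of "b j" "{1..n}"] by (auto simp: bij_betw_def blocks_def)
  have fin: "finite (\<Union> (b ` A))" if "A \<subseteq> {..<N}" for A
    using that bB(2) finite_subset[OF that] by auto
  have f: "f A \<le> \<beta> \<longleftrightarrow> (\<forall>j\<in>A. lookup (squarefree_exponent (b j)) \<le> \<beta>)" if "A \<subseteq> {..<N}" for A \<beta>
    using that fin[OF that] bB(2) unfolding f_def by (auto simp: squarefree_exponent_le_iff subset_iff)
  have deg: "f A \<in> lookup ` exponents n" if "A \<subseteq> {..<N}" for A
    unfolding f_def using that bB(1) by (intro imageI squarefree_exponent_exponents) blast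
  have M: "\<alpha> \<in> ideal_degrees n (block_ideal n B :: 'a mpoly set) \<longleftrightarrow>
      (\<exists>j<N. lookup (squarefree_exponent (b j)) \<le> \<alpha>)" if \<alpha>: "\<alpha> \<in> lookup ` exponents n" for \<alpha>
  proof -
    obtain m where m: "\<alpha> = lookup m" "m \<in> exponents n" using \<alpha> by blast
    have "x \<in> B \<Longrightarrow> finite x" for x using b bB(2) by (auto simp: bij_betw_def)
    hence "\<alpha> \<in> ideal_degrees n (block_ideal n B :: 'a mpoly set) \<longleftrightarrow>
        (\<exists>x\<in>B. lookup (squarefree_exponent x) \<le> \<alpha>)"
      using ideal_degrees_iff[OF m(2)] block_ideal_degree_iff[OF _ m(2)] m(1) by blast
    thus ?thesis using b by (auto simp: bij_betw_def)
  qed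
  note T = taylor_resolution[where b = "\<lambda>j. lookup (squarefree_exponent (b j))", OF f deg M, where 'a = 'a]
  obtain r deg d where F: "minimal_free_resolution n (block_ideal n B :: 'a mpoly set) r deg d"
    using block_ideal_minimal_free_resolution[OF B k] by blast
  obtain D :: "nat \<Rightarrow> nat \<Rightarrow> nat \<Rightarrow> 'a" where D: "graded_resolution (lookup ` exponents n) (ideal_degrees n (block_ideal n B :: 'a mpoly set))
      (\<lambda>i. {..<r i}) (\<lambda>i. degs (deg i)) D" "\<And>i. minimal_at (\<lambda>i. degs (deg i)) D i"
    using graded_resolution_of_minimal_free_resolution[OF F] by blast
  have cardT: "card (taylor_basis N i) = N choose i" for i
    unfolding taylor_basis_def using n_subsets[of "{..<N}" i] by simp
  have rank_iff: "r (Suc i) = N choose (Suc i) \<longleftrightarrow>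
      minimal_at (\<lambda>_. f) (taylor_diff N :: _ \<Rightarrow> _ \<Rightarrow> _ \<Rightarrow> 'a) i \<and>
      minimal_at (\<lambda>_. f) (taylor_diff N :: _ \<Rightarrow> _ \<Rightarrow> _ \<Rightarrow> 'a) (Suc i)" (is "?eq \<longleftrightarrow> ?min")
  proof
    assume ?eq
    thus ?min using minimal_rank_comparison(2,3)[OF D(1) T D(2) D(2), of i] by (simp add: cardT)
  next
    assume min: ?min
    show ?eq
    proof (cases "r (Suc i) \<le> N choose (Suc i)")
      case True
      thus ?thesis using minimal_rank_comparison(1)[OF T D(1), of i] min by (simp add: cardT)
    next
      case False
      \<comment> \<open>Here the Taylor rank would be the smaller one, so the minimal resolution may
        play X and the ranks are equal after all.\<close>
      thus ?thesis using minimal_rank_comparison(1)[OF D(1) T D(2) D(2), of i] by (simp add: cardT)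
    qed
  qed
  have le_iff: "lookup (squarefree_exponent (b j)) \<le> f A \<longleftrightarrow> b j \<subseteq> \<Union> (b ` A)"
    if "A \<subseteq> {..<N}" "j < N" for A j
    unfolding f_def squarefree_exponent_le_iff[OF bB(2)[OF that(2)]] lookup_squarefree_exponent[OF fin[OF that(1)]]
    by auto
  have min_iff: "minimal_at (\<lambda>_. f) (taylor_diff N :: _ \<Rightarrow> _ \<Rightarrow> _ \<Rightarrow> 'a) l \<longleftrightarrow>
      (\<forall>A\<subseteq>{..<N}. \<forall>j<N. card A = l \<longrightarrow> j \<notin> A \<longrightarrow> \<not> b j \<subseteq> \<Union> (b ` A))" for l
    using minimal_at_taylor_iff[where b = "\<lambda>j. lookup (squarefree_exponent (b j))", OF f, of N l, where 'a = 'a]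
      le_iff by blast
  show ?thesis
    unfolding betti_eq_rank[OF F] rank_iff min_iff by auto
qed

section \<open>Cover-free block collections\<close>

lemma two_choose_two: "2 * (m choose 2) = m * (m - 1)"
proof -
  have "even (m * (m - 1))" by (cases m) auto
  thus ?thesis by (simp add: choose_two)
qed

text \<open>A pair of points lies in at most one member of Q, so the sets of pairs inside the
  members are disjoint; equality of the counts means that they exhaust all pairs of P. The ground
  set P is kept general because the count is also made after removing private points.\<close>

lemma pair_counting:
  assumes finP: "finite P" and QP: "\<And>q. q \<in> Q \<Longrightarrow> q \<subseteq> P" and Qk: "\<And>q. q \<in> Q \<Longrightarrow> card q = k"
    and meet: "\<And>q q'. q \<in> Q \<Longrightarrow> q' \<in> Q \<Longrightarrow> q \<noteq> q' \<Longrightarrow> card (q \<inter> q') \<le> 1"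
  shows "card Q * (k choose 2) \<le> card P choose 2"
    and "card Q * (k choose 2) = card P choose 2 \<Longrightarrow> T \<subseteq> P \<Longrightarrow> card T = 2 \<Longrightarrow> \<exists>q\<in>Q. T \<subseteq> q"
proof -
  define pairs where "pairs = (\<lambda>q :: 'a set. {T. T \<subseteq> q \<and> card T = 2})"
  have finq: "finite q" if "q \<in> Q" for q using QP[OF that] finP by (rule finite_subset)
  have finQ: "finite Q" using QP finP by (intro finite_subset[of Q "Pow P"]) auto
  have fin: "finite (pairs q)" if "finite q" for q
    using that by (intro finite_subset[of "pairs q" "Pow q"]) (auto simp: pairs_def)
  have "pairs q \<inter> pairs q' = {}" if q: "q \<in> Q" "q' \<in> Q" "q \<noteq> q'" for q q'
  proof (rule ccontr)
    assume "pairs q \<inter> pairs q' \<noteq> {}"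
    then obtain T where "T \<subseteq> q \<inter> q'" "card T = 2" by (auto simp: pairs_def)
    hence "2 \<le> card (q \<inter> q')" using card_mono[of "q \<inter> q'" T] finq[OF q(1)] by simp
    thus False using meet[OF q] by simp
  qed
  hence "card (\<Union>q\<in>Q. pairs q) = (\<Sum>q\<in>Q. card (pairs q))"
    using finQ finq fin by (intro card_UN_disjoint) auto
  also have "\<dots> = card Q * (k choose 2)"
    using finq Qk by (simp add: pairs_def n_subsets)
  finally have card: "card (\<Union>q\<in>Q. pairs q) = card Q * (k choose 2)" .
  have sub: "(\<Union>q\<in>Q. pairs q) \<subseteq> pairs P" using QP by (auto simp: pairs_def)
  have cardP: "card (pairs P) = card P choose 2" using finP by (simp add: pairs_def n_subsets)
  show "card Q * (k choose 2) \<le> card P choose 2"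
    using card_mono[OF fin[OF finP] sub] card cardP by simp
  show "\<exists>q\<in>Q. T \<subseteq> q" if "card Q * (k choose 2) = card P choose 2" "T \<subseteq> P" "card T = 2"
  proof -
    have "(\<Union>q\<in>Q. pairs q) = pairs P"
      using card_subset_eq[OF fin[OF finP] sub] card cardP that(1) by simp
    moreover have "T \<in> pairs P" using that by (simp add: pairs_def)
    ultimately have "T \<in> (\<Union>q\<in>Q. pairs q)" by blast
    thus ?thesis unfolding pairs_def by blast
  qed
qed

section \<open>Steiner systems, covers and private points\<close>

lemma blocksD:
  assumes "B \<subseteq> blocks k n" "b \<in> B"
  shows "b \<subseteq> {1..n}" "card b = k" "finite b"
  using assms finite_subset[of b "{1..n}"] by (auto simp: blocks_def)

lemma finite_block_collection: "B \<subseteq> blocks k n \<Longrightarrow> finite B"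
  by (rule finite_subset[of _ "Pow {1..n}"]) (auto simp: blocks_def)

lemma steiner_system_pairwise:
  assumes "steiner_system 2 k n B" "b \<in> B" "c \<in> B" "b \<noteq> c"
  shows "card (b \<inter> c) \<le> 1"
proof (rule ccontr)
  assume "\<not> card (b \<inter> c) \<le> 1"
  hence "2 \<le> card (b \<inter> c)" by simp
  then obtain T where T: "T \<subseteq> b \<inter> c" "card T = 2"
    by (rule obtain_subset_with_card_n)
  have B: "B \<subseteq> blocks k n" using assms(1) by (simp add: steiner_system_def)
  have "T \<in> blocks 2 n" using T blocksD(1)[OF B assms(2)] by (auto simp: blocks_def)
  hence "\<exists>!b. b \<in> B \<and> T \<subseteq> b" using assms(1) by (simp add: steiner_system_def)
  moreover have "b \<in> B \<and> T \<subseteq> b" "c \<in> B \<and> T \<subseteq> c" using T(1) assms(2,3) by auto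
  ultimately show False using assms(4) by (elim ex1E) metis
qed

lemma steiner_system_card:
  assumes "steiner_system 2 k n B"
  shows "card B * (k * (k - 1)) = n * (n - 1)"
proof -
  have B: "B \<subseteq> blocks k n" using assms by (simp add: steiner_system_def)
  note pc = pair_counting[of "{1..n}" B k, OF _ blocksD(1)[OF B] blocksD(2)[OF B] steiner_system_pairwise[OF assms]]
  define pairs where "pairs = (\<lambda>q :: nat set. {T. T \<subseteq> q \<and> card T = 2})"
  have "(\<Union>b\<in>B. pairs b) = blocks 2 n"
  proof (intro equalityI subsetI)
    fix T assume "T \<in> (\<Union>b\<in>B. pairs b)"
    thus "T \<in> blocks 2 n" using blocksD(1)[OF B] by (auto simp: pairs_def blocks_def)
  next
    fix T assume T: "T \<in> blocks 2 n"
    hence "\<exists>!b. b \<in> B \<and> T \<subseteq> b" using assms by (simp add: steiner_system_def)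
    thus "T \<in> (\<Union>b\<in>B. pairs b)" using T by (auto simp: pairs_def blocks_def)
  qed
  moreover have "card (blocks 2 n) = n choose 2" using n_subsets[of "{1..n}" 2] by (simp add: blocks_def)
  \<comment> \<open>As every pair is covered, the union bound gives one inequality;
    \<open>pair_counting\<close> gives the other.\<close>
  moreover have "card (\<Union>b\<in>B. pairs b) \<le> (\<Sum>b\<in>B. card (pairs b))"
    by (rule card_UN_le[OF finite_block_collection[OF B]])
  moreover have "(\<Sum>b\<in>B. card (pairs b)) = card B * (k choose 2)"
    using blocksD[OF B] by (simp add: pairs_def n_subsets)
  moreover have "card B * (k choose 2) \<le> n choose 2" using pc(1) by simp
  ultimately have "card B * (k choose 2) = n choose 2" by simp
  hence "card B * (2 * (k choose 2)) = 2 * (n choose 2)" by simp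
  thus ?thesis unfolding two_choose_two .
qed

lemma steiner_system_cover_free:
  assumes "steiner_system 2 k n B" "A \<subseteq> B" "c \<in> B" "c \<notin> A" "card A < k"
  shows "\<not> c \<subseteq> \<Union> A"
proof
  assume "c \<subseteq> \<Union> A"
  have B: "B \<subseteq> blocks k n" using assms(1) by (simp add: steiner_system_def)
  have finA: "finite A" using assms(2) finite_block_collection[OF B] by (rule finite_subset)
  have "c = (\<Union>a\<in>A. c \<inter> a)" using \<open>c \<subseteq> \<Union> A\<close> by blast
  hence "card c \<le> (\<Sum>a\<in>A. card (c \<inter> a))" using card_UN_le[OF finA] by metis
  also have "\<dots> \<le> (\<Sum>a\<in>A. 1)"
    using assms(2-4) by (intro sum_mono steiner_system_pairwise[OF assms(1)]) auto
  finally show False using blocksD(2)[OF B assms(3)] assms(5) by simp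
qed

text \<open>A block all of whose points lie in further blocks cannot share two points with another block
  \<open>c'\<close>: its at most \<open>k - 2\<close> points outside \<open>c'\<close> would each be covered by one more block.\<close>

lemma cover_free_meet:
  assumes B: "B \<subseteq> blocks k n" and card: "card B \<ge> k" and k: "k \<ge> 2"
    and free: "\<And>A c. A \<subseteq> B \<Longrightarrow> c \<in> B \<Longrightarrow> c \<notin> A \<Longrightarrow> card A = k - 1 \<Longrightarrow> \<not> c \<subseteq> \<Union> A"
    and c: "c \<in> B" "c' \<in> B" "c \<noteq> c'" and nonprivate: "\<And>x. x \<in> c \<Longrightarrow> \<exists>a\<in>B. a \<noteq> c \<and> x \<in> a"
  shows "card (c \<inter> c') \<le> 1"
proof (rule ccontr)
  assume meet: "\<not> card (c \<inter> c') \<le> 1"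
  obtain g where g: "\<And>x. x \<in> c \<Longrightarrow> g x \<in> B \<and> g x \<noteq> c \<and> x \<in> g x" using nonprivate by metis
  note finB = finite_block_collection[OF B]
  define A0 where "A0 = insert c' (g ` (c - c'))"
  have A0: "A0 \<subseteq> B - {c}" using g c by (auto simp: A0_def)
  have "card A0 \<le> Suc (card (g ` (c - c')))" unfolding A0_def by (rule card_insert_le_m1) auto
  also have "\<dots> \<le> Suc (card (c - c'))" using blocksD(3)[OF B c(1)] by (simp add: card_image_le)
  also have "card (c - c') = k - card (c \<inter> c')"
    using blocksD(2,3)[OF B c(1)] by (simp add: card_Diff_subset_Int)
  finally have "card A0 \<le> k - 1" using meet k by simp
  \<comment> \<open>Cover-freeness is assumed for exactly k - 1 blocks, so the possibly smaller
    cover A0 is padded with further blocks other than c.\<close>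
  moreover have "k - 1 \<le> card (B - {c})" using c(1) finB card by simp
  ultimately obtain A where A: "A0 \<subseteq> A" "A \<subseteq> B - {c}" "card A = k - 1"
    using exists_subset_between[of A0 "k - 1" "B - {c}"] A0 finB by auto
  have "c \<subseteq> \<Union> A0" using g by (auto simp: A0_def)
  thus False using free[of A c] A c(1) by blast
qed

text \<open>Here s blocks have a private point, m points are left, and \<open>count\<close> is the
  pair bound for the other N - s blocks on these points. Subtracting it from the equation for N and
  dividing by s gives 2n - 1 - s \<le> k(k - 1), that is, m \<le> k(k - 1) + 1 - n, which n > (k -
  1)^2 reduces to k - 1. Integers are used so that differences are not truncated.\<close>

lemma steiner_parameter_contradiction:
  fixes n k s m N :: nat
  assumes k: "k \<ge> 3" and n: "n > (k - 1)\<^sup>2" and N: "N * (k * (k - 1)) = n * (n - 1)"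
    and s: "0 < s" "s + m = n" "s \<le> N"
    and count: "(N - s) * (k * (k - 1)) \<le> m * (m - 1)"
  shows "m \<le> k - 1" "m = k - 1 \<Longrightarrow> N \<noteq> s"
proof -
  define j where "j = int (k - 1)"
  define n' where "n' = int n"
  define s' where "s' = int s"
  define m' where "m' = int m"
  have j: "j \<ge> 2" "int k = j + 1" using k by (auto simp: j_def)
  have sq: "int ((k - 1)\<^sup>2) = j * j" by (simp add: j_def power2_eq_square)
  have n': "n' \<ge> j * j + 1" using n sq unfolding n'_def by linarith
  have s': "s' \<ge> 1" "m' = n' - s'" "m' \<ge> 0" using s by (auto simp: s'_def m'_def n'_def)
  have N': "int N * ((j + 1) * j) = n' * (n' - 1)"
  proof -
    have "int (N * (k * (k - 1))) = int (n * (n - 1))" using N by simp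
    thus ?thesis using n k by (simp add: n'_def j_def of_nat_diff)
  qed
  have "int ((N - s) * (k * (k - 1))) \<le> int (m * (m - 1))" using count by (simp only: of_nat_le_iff)
  moreover have "int ((N - s) * (k * (k - 1))) = (int N - s') * ((j + 1) * j)"
    using s(3) k by (simp add: j_def s'_def of_nat_diff)
  moreover have "int (m * (m - 1)) = m' * (m' - 1)" by (cases m) (auto simp: m'_def algebra_simps)
  ultimately have "(int N - s') * ((j + 1) * j) \<le> m' * (m' - 1)" by simp
  hence "s' * (2 * n' - 1 - s') \<le> s' * ((j + 1) * j)"
    using N' unfolding s'(2) by (simp add: algebra_simps)
  hence le: "2 * n' - 1 - s' \<le> (j + 1) * j" using s'(1) by (simp add: mult_le_cancel_left)
  hence m': "m' \<le> j * j + j + 1 - n'" unfolding s'(2) by (simp add: algebra_simps)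
  show "m \<le> k - 1" using m' n' unfolding m'_def j_def by linarith
  show "N \<noteq> s" if "m = k - 1"
  proof
    assume "N = s"
    have "m' = j" using that by (simp add: m'_def j_def)
    \<comment> \<open>The extremal value of m pins n to its least possible value. With N = n - j the
      equation for N reads j (j^3 + 1) = j (j^3 + j), impossible for j \<ge> 2.\<close>
    hence "n' = j * j + 1" using m' n' by linarith
    moreover have "int N = n' - j" using \<open>N = s\<close> s'(2) \<open>m' = j\<close> by (simp add: s'_def)
    ultimately have "(j * j + 1 - j) * ((j + 1) * j) = (j * j + 1) * (j * j)" using N' by simp
    hence "j * (j - 1) = 0" by (simp add: algebra_simps)
    thus False using j by auto
  qed
qed

lemma steiner_system_of_cover_free:
  assumes k: "k \<ge> 3" and n: "n > (k - 1)\<^sup>2" and B: "B \<subseteq> blocks k n"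
    and N: "card B * (k * (k - 1)) = n * (n - 1)"
    and free: "\<And>A c. A \<subseteq> B \<Longrightarrow> c \<in> B \<Longrightarrow> c \<notin> A \<Longrightarrow> card A = k - 1 \<Longrightarrow> \<not> c \<subseteq> \<Union> A"
  shows "steiner_system 2 k n B"
proof -
  note finB = finite_block_collection[OF B]
  \<comment> \<open>\<open>cover_free_meet\<close> pads covers and so requires k blocks. With fewer,
    the block count and n > (k - 1)^2 would give (k - 1)^2 \<le> k - 1.\<close>
  have cardB: "k \<le> card B"
  proof (rule ccontr)
    assume "\<not> k \<le> card B"
    hence "n * (n - 1) \<le> (k - 1) * (k * (k - 1))" unfolding N[symmetric] by (intro mult_right_mono) auto
    moreover have "(Suc ((k - 1)\<^sup>2)) * (k - 1)\<^sup>2 \<le> n * (n - 1)" using n by (intro mult_mono) auto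
    ultimately have "(Suc ((k - 1)\<^sup>2)) * (k - 1)\<^sup>2 \<le> (k - 1) * (k * (k - 1))"
      by (rule order_trans[rotated])
    also have "\<dots> = k * (k - 1)\<^sup>2" by (simp only: power2_eq_square mult.left_commute)
    finally have "(Suc ((k - 1)\<^sup>2)) * (k - 1)\<^sup>2 \<le> k * (k - 1)\<^sup>2" .
    hence "Suc ((k - 1)\<^sup>2) \<le> k" by (rule mult_right_le_imp_le) (use k in simp)
    hence "(k - 1) * (k - 1) \<le> (k - 1) * 1" unfolding power2_eq_square by linarith
    thus False using k by simp
  qed
  define Priv where "Priv = {c \<in> B. \<exists>x\<in>c. \<forall>a\<in>B. x \<in> a \<longrightarrow> a = c}"
  have meet: "card (c \<inter> c') \<le> 1" if "c \<in> B - Priv" "c' \<in> B" "c \<noteq> c'" for c c'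
    by (rule cover_free_meet[OF B cardB _ free]) (use that k in \<open>auto simp: Priv_def\<close>)
  have "\<forall>c\<in>Priv. \<exists>x. x \<in> c \<and> (\<forall>a\<in>B. x \<in> a \<longrightarrow> a = c)" by (auto simp: Priv_def)
  from bchoice[OF this] obtain h
    where h: "\<And>c. c \<in> Priv \<Longrightarrow> h c \<in> c \<and> (\<forall>a\<in>B. h c \<in> a \<longrightarrow> a = c)" by blast
  have PB: "Priv \<subseteq> B" by (auto simp: Priv_def)
  have inj: "inj_on h Priv"
  proof (rule inj_onI)
    fix c c' assume c: "c \<in> Priv" "c' \<in> Priv" "h c = h c'"
    thus "c = c'" using h[OF c(1)] h[OF c(2)] PB by auto
  qed
  \<comment> \<open>A chosen private point lies on its own block only. So blocks without private
    points stay inside P, and the others lose exactly one point.\<close>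
  define P where "P = {1..n} - h ` Priv"
  have hn: "h ` Priv \<subseteq> {1..n}" using h PB blocksD(1)[OF B] by blast
  have finPriv: "finite Priv" using PB finB by (rule finite_subset)
  have sm: "card Priv + card P = n"
    using card_Diff_subset[OF finite_imageI[OF finPriv] hn] card_mono[OF _ hn]
    by (simp add: P_def card_image[OF inj])
  have count: "(card B - card Priv) * (k choose 2) \<le> card P choose 2"
  proof -
    have "card (B - Priv) * (k choose 2) \<le> card P choose 2"
    proof (rule pair_counting(1))
      show "finite P" by (simp add: P_def)
      show "q \<subseteq> P" if "q \<in> B - Priv" for q
        using that h blocksD(1)[OF B] unfolding P_def by blast
      show "card q = k" if "q \<in> B - Priv" for q using that blocksD(2)[OF B] by blast
      show "card (q \<inter> q') \<le> 1" if "q \<in> B - Priv" "q' \<in> B - Priv" "q \<noteq> q'" for q q'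
        using meet that by blast
    qed
    thus ?thesis by (simp add: card_Diff_subset[OF finPriv PB])
  qed
  have "Priv = {}"
  proof (rule ccontr)
    assume ne: "Priv \<noteq> {}"
    hence pos: "0 < card Priv" using finPriv by (simp add: card_gt_0_iff)
    have "(card B - card Priv) * (2 * (k choose 2)) \<le> 2 * (card P choose 2)" using count by simp
    hence "(card B - card Priv) * (k * (k - 1)) \<le> card P * (card P - 1)"
      unfolding two_choose_two .
    note contra = steiner_parameter_contradiction[OF k n N pos sm card_mono[OF finB PB] this]
    \<comment> \<open>A block outside Priv would need k points in P, which has at most k -
      1.\<close>
    have "B = Priv"
    proof (rule ccontr)
      assume "B \<noteq> Priv"
      then obtain q where q: "q \<in> B" "q \<notin> Priv" using PB by blast
      hence "q \<subseteq> P" using h blocksD(1)[OF B] unfolding P_def by blast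
      hence "k \<le> card P" using card_mono[of P q] blocksD(2)[OF B q(1)] by (simp add: P_def)
      thus False using contra(1) k by simp
    qed
    moreover obtain c where c: "c \<in> Priv" using ne by blast
    \<comment> \<open>A block with a private point keeps k - 1 points in P, so P has exactly k - 1
      points and the extremal case is excluded.\<close>
    have "c - {h c} \<subseteq> P" using h c PB blocksD(1)[OF B] unfolding P_def by blast
    hence "card (c - {h c}) \<le> card P" by (intro card_mono) (simp_all add: P_def)
    moreover have "card (c - {h c}) = k - 1" using h[OF c] blocksD[OF B] c PB by auto
    ultimately show False using contra by simp
  qed
  hence meet': "card (c \<inter> c') \<le> 1" if "c \<in> B" "c' \<in> B" "c \<noteq> c'" for c c' using meet that by blast
  have "2 * (card B * (k choose 2)) = 2 * (n choose 2)"
    using N unfolding two_choose_two[symmetric] by simp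
  hence eq: "card B * (k choose 2) = n choose 2" by simp
  show ?thesis
    unfolding steiner_system_def
  proof (intro conjI ballI)
    show "B \<subseteq> blocks k n" by (rule B)
    fix T assume T: "T \<in> blocks 2 n"
    have "\<exists>b\<in>B. T \<subseteq> b"
      by (rule pair_counting(2)[of "{1..n}" B k]) (use blocksD[OF B] meet' eq T in \<open>auto simp: blocks_def\<close>)
    moreover have "b = c" if "b \<in> B" "c \<in> B" "T \<subseteq> b" "T \<subseteq> c" for b c
    proof (rule ccontr)
      assume "b \<noteq> c"
      have "card T \<le> card (b \<inter> c)" using that blocksD(3)[OF B that(1)] by (intro card_mono) auto
      thus False using meet'[OF that(1,2) \<open>b \<noteq> c\<close>] T by (simp add: blocks_def)
    qed
    ultimately show "\<exists>!b. b \<in> B \<and> T \<subseteq> b" by blast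
  qed
qed

section \<open>The Betti conditions in terms of blocks\<close>

lemma betti_block_ideal_cover_free_iff:
  assumes B: "B \<subseteq> blocks k n" and k: "k \<ge> 1"
  shows "betti n (block_ideal n B :: 'a::field mpoly set) (Suc i) = card B choose (Suc i) \<longleftrightarrow>
    (\<forall>A\<subseteq>B. \<forall>c\<in>B. card A \<in> {i, Suc i} \<longrightarrow> c \<notin> A \<longrightarrow> \<not> c \<subseteq> \<Union> A)"
proof -
  obtain b where b: "bij_betw b {..<card B} B"
    using ex_bij_betw_nat_finite[OF finite_block_collection[OF B]] by (auto simp: atLeast0LessThan)
  have inj: "inj_on b {..<card B}" and img: "b ` {..<card B} = B" using b by (auto simp: bij_betw_def)
  have "(\<forall>A\<subseteq>B. \<forall>c\<in>B. card A \<in> {i, Suc i} \<longrightarrow> c \<notin> A \<longrightarrow> \<not> c \<subseteq> \<Union> A) \<longleftrightarrow>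
      (\<forall>A\<subseteq>{..<card B}. \<forall>j<card B. card (b ` A) \<in> {i, Suc i} \<longrightarrow> b j \<notin> b ` A \<longrightarrow> \<not> b j \<subseteq> \<Union> (b ` A))"
    (is "?L \<longleftrightarrow> ?R")
  proof
    assume ?L
    thus ?R using img by (metis image_mono image_eqI lessThan_iff)
  next
    assume R: ?R
    show ?L
    proof (intro allI ballI impI)
      fix A c assume A: "A \<subseteq> B" "c \<in> B" "card A \<in> {i, Suc i}" "c \<notin> A"
      obtain A' where A': "A' \<subseteq> {..<card B}" "A = b ` A'" using A(1) img by (metis subset_image_iff)
      obtain j where "j < card B" "c = b j" using A(2) img by auto
      thus "\<not> c \<subseteq> \<Union> A" using R A A' by blast
    qed
  qed
  also have "\<dots> \<longleftrightarrow> (\<forall>A\<subseteq>{..<card B}. \<forall>j<card B. card A \<in> {i, Suc i} \<longrightarrow> j \<notin> A \<longrightarrow> \<not> b j \<subseteq> \<Union> (b ` A))"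
  proof -
    have "card (b ` A) = card A \<and> (b j \<in> b ` A \<longleftrightarrow> j \<in> A)" if "A \<subseteq> {..<card B}" "j < card B" for A j
      using that inj inj_on_subset[OF inj that(1)] by (simp add: card_image inj_on_image_mem_iff)
    thus ?thesis by simp
  qed
  finally show ?thesis using betti_block_ideal_eq_choose_iff[OF B k b, of i, where 'a = 'a] by simp
qed

text \<open>In degree 1 the covering sets have size 0 or 1: a nonempty block is not inside the empty
  union, and a block inside another of the same size equals it.\<close>

lemma betti_block_ideal_1:
  assumes B: "B \<subseteq> blocks k n" and k: "k \<ge> 1"
  shows "betti n (block_ideal n B :: 'a::field mpoly set) 1 = card B"
proof -
  have "\<not> c \<subseteq> \<Union> A" if A: "A \<subseteq> B" "c \<in> B" "card A \<in> {0, Suc 0}" "c \<notin> A" for A c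
  proof
    assume sub: "c \<subseteq> \<Union> A"
    have finA: "finite A" using A(1) finite_block_collection[OF B] by (rule finite_subset)
    have "c \<noteq> {}" using blocksD(2)[OF B A(2)] k by auto
    hence "A \<noteq> {}" using sub by auto
    then obtain a where a: "A = {a}" using A(3) finA by (auto simp: card_Suc_eq)
    hence "c = a"
      using card_subset_eq[of a c] sub A(1,2) blocksD(2,3)[OF B] by simp
    thus False using A(4) a by simp
  qed
  thus ?thesis using betti_block_ideal_cover_free_iff[OF B k, of 0, where 'a = 'a] by simp
qed

theorem theorem3p5:
  fixes k n :: nat and B :: "nat set set"
  assumes "k \<ge> 3" and "n > (k - 1)\<^sup>2" and "B \<subseteq> blocks k n"
  shows "steiner_system 2 k n B \<longleftrightarrow>
    real (betti n (block_ideal n B :: 'a::field mpoly set) 1) =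
      (real n * (real n - 1)) / (real k * (real k - 1)) \<and>
    real (betti n (block_ideal n B :: 'a::field mpoly set) (k - 1)) =
      ((real n * (real n - 1)) / (real k * (real k - 1))) gchoose (k - 1)"
proof -
  define \<rho> where "\<rho> = (real n * (real n - 1)) / (real k * (real k - 1))"
  have k1: "k \<ge> 1" and i: "k - 1 = Suc (k - 2)" using assms(1) by auto
  have card_iff: "real (card B) = \<rho> \<longleftrightarrow> card B * (k * (k - 1)) = n * (n - 1)"
  proof -
    have "real (card B) = \<rho> \<longleftrightarrow> real (card B) * (real k * (real k - 1)) = real n * (real n - 1)"
      using assms(1) by (simp add: \<rho>_def eq_divide_eq)
    also have "\<dots> \<longleftrightarrow> real (card B * (k * (k - 1))) = real (n * (n - 1))"
      using assms(1,2) by (simp add: of_nat_diff)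
    finally show ?thesis by (simp only: of_nat_eq_iff)
  qed
  have betti1: "betti n (block_ideal n B :: 'a mpoly set) 1 = card B"
    by (rule betti_block_ideal_1[OF assms(3) k1])
  \<comment> \<open>The quotient \<rho> need not be an integer by itself. Once it equals
    \<open>card B\<close>, the generalised binomial coefficient is the Taylor rank. The sizes k - 2
    and k - 1 belong to the two differentials next to degree k - 1.\<close>
  have betti_iff: "real (betti n (block_ideal n B :: 'a mpoly set) (k - 1)) = \<rho> gchoose (k - 1) \<longleftrightarrow>
      (\<forall>A\<subseteq>B. \<forall>c\<in>B. card A \<in> {k - 2, k - 1} \<longrightarrow> c \<notin> A \<longrightarrow> \<not> c \<subseteq> \<Union> A)" if "real (card B) = \<rho>"
    unfolding that[symmetric] binomial_gbinomial[symmetric] of_nat_eq_iff i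
    by (rule betti_block_ideal_cover_free_iff[OF assms(3) k1])
  show ?thesis
    unfolding \<rho>_def[symmetric] betti1
  proof (intro iffI conjI)
    assume S: "steiner_system 2 k n B"
    show card: "real (card B) = \<rho>" using steiner_system_card[OF S] card_iff by simp
    show "real (betti n (block_ideal n B :: 'a mpoly set) (k - 1)) = \<rho> gchoose (k - 1)"
      unfolding betti_iff[OF card] using steiner_system_cover_free[OF S] assms(1) by auto
  next
    assume R: "real (card B) = \<rho> \<and>
      real (betti n (block_ideal n B :: 'a mpoly set) (k - 1)) = \<rho> gchoose (k - 1)"
    show "steiner_system 2 k n B"
      using R card_iff betti_iff by (intro steiner_system_of_cover_free[OF assms]) auto
  qed
qed

end
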